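(* Let $T>0$ and $\Omega=\{(s,t)\mid s_0(t)\le s\le s_1(t),\ 0\le t<T\}$. (Direct part.) Let $\xi=\xi(s,t)\in\mathbb{R}^2$, $\gamma=\gamma(s,t)\in\mathbb{R}$ and $a=a(s,t)\in\mathbb{R}$ belong to $C^1_b(\Omega)$ and solve the Birkhoff-Rott system $$\xi_t+a(s,t)\,\xi_s=\mathcal{U}[\xi;\gamma],\qquad \gamma_t+(a(s,t)\gamma)_s=0,\qquad \left|\frac{\partial\xi}{\partial s}\right|=1,\tag{BR}$$ with $\gamma\in L^\infty((0,T);L^1(ds))$. Assume also that if an endpoint $s_j(t)$ ($j\in\{0,1\}$) is finite then $$\gamma(s_j(t),t)\,\big[s_j'(t)-a(s_j(t),t)\big]=0,\tag{E}$$ while if $s_j(t)$ is infinite but $\xi(s_j(t),t)$ is finite then $$\int_{s_0(t)}^{s_1(t)}|\gamma(s,t)|\,ds\le c<\infty .$$ Then $(\gamma,\xi)$ is a weak solution of the Birkhoff-Rott equations with initial data $(\gamma(s,0),\xi(s,0))$. (Converse part.) Suppose that $(\gamma,\xi)$ is a weak solution of the Birkhoff-Rott equations with initial data $(\gamma_0,\xi_0)$, where $s$ is an arclength parameter and at each fixed time $\xi$ is one-to-one except that $\xi(s_1(t),t)$ is allowed to equal $\xi(s_0(t),t)$. Assume in addition that: (1) the parametrization $\xi$ and the density $\gamma$ are $C^1_b$ on $\Omega$; (2) the velocity $\mathcal{U}[\xi;\gamma]$ is $C^0_b$ on $\Omega$; (3) if $|s_i|<\infty$ then $s_i$ is $C^1_b([0,T))$.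 Then $\gamma$ and $\xi$ satisfy (BR), and (E) at the finite endpoints, with $a=\xi_s\cdot[\mathcal{U}[\xi;\gamma]-\xi_t]$, except that the equation $\xi_t+a\xi_s=\mathcal{U}[\xi;\gamma]$ need not hold in any open set on which $\gamma$ vanishes identically.
   Context: For each $t$ the endpoints satisfy $-\infty\le s_0(t)<s_1(t)\le\infty$ and $\mathcal{C}_t=\{\xi(s,t)\mid s_0(t)\le s\le s_1(t)\}$ is a curve in $\mathbb{R}^2$ parametrized by arclength $s$; $\gamma$ is the vorticity density on it. When $s_j(t)$ is infinite, $\xi(s_j(t),t)$ is understood as the limit of $\xi(s,t)$ as $s\to s_j(t)$. $C^k_b$ denotes functions that are bounded and continuous together with their derivatives up to order $k$. In condition (E), the finite endpoint functions $s_j$ are understood to be differentiable so that the condition makes sense. Kernel: $K(x)=\dfrac{x^\perp}{2\pi|x|^2}$ for $x\in\mathbb{R}^2\setminus\{0\}$, with $(x_1,x_2)^\perp=(-x_2,x_1)$. Principal-value velocity: $$\mathcal{U}[\xi;\gamma](s,t)=\lim_{\varepsilon\to0^+}\int_{|\xi(s,t)-\xi(s',t)|\ge\varepsilon}K(\xi(s,t)-\xi(s',t))\,\gamma(s',t)\,ds'.$$ Weak solution of Birkhoff-Rott: Let $\mathcal{C}_t=\{\xi(s,t)\mid s_0(t)\le s\le s_1(t)\}$ be a rectifiable curve for each $t\in[0,T)$, and let $\gamma\in L^\infty((0,T);L^1(ds))$ be such that $\mathcal{U}[\xi;\gamma]$ is defined and $\gamma\,\mathcal{U}[\xi;\gamma]\in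 L^\infty((0,T);L^1(ds))$. Then $(\gamma,\xi)$ is a weak solution of the Birkhoff-Rott equations with initial data $(\gamma_0,\xi_0)$ if for every $\varphi\in C_c^\infty([0,T)\times\mathbb{R}^2)$ $$\int_0^T\!\!\int_{s_0(t)}^{s_1(t)}\gamma(s,t)\big\{\varphi_t(\xi(s,t),t)+\mathcal{U}[\xi;\gamma](s,t)\cdot\nabla\varphi(\xi(s,t),t)\big\}\,ds\,dt+\int_{s_0(0)}^{s_1(0)}\gamma_0(s)\,\varphi(\xi_0(s),0)\,ds=0.$$
   Formalization: When ξ(s_0,t)=ξ(s_1,t) at finite ends, the converse gives only equality of the two quantities γ[s_j'-a], since (E) fails for the unit circle with γ=1; in the direct part the endpoints s_j are assumed continuous into the extended reals, excluding jumps between finite and infinite. *)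

theory Defs
  imports "HOL-Analysis.Analysis"
begin

section \<open>Function spaces\<close>

text \<open>
  \<open>Ckb_on k X f\<close>: bounded and continuous on \<open>X\<close> together with all derivatives of order up to
  \<open>k\<close>.  Derivatives are Frechet derivatives within \<open>X\<close>, so they also make sense on the part of the
  boundary that belongs to \<open>X\<close>.
\<close>

primrec Ckb_on ::
  "nat \<Rightarrow> 'a::euclidean_space set \<Rightarrow> ('a \<Rightarrow> 'b::real_normed_vector) \<Rightarrow> bool" where
  "Ckb_on 0 X f \<longleftrightarrow> continuous_on X f \<and> bounded (f ` X)"
| "Ckb_on (Suc k) X f \<longleftrightarrow>
     continuous_on X f \<and> bounded (f ` X) \<and> f differentiable_on X \<and>
     (\<forall>v\<in>Basis. Ckb_on k X (\<lambda>x. frechet_derivative f (at x within X) v))"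

primrec Ck :: "nat \<Rightarrow> ('a::euclidean_space \<Rightarrow> 'b::real_normed_vector) \<Rightarrow> bool" where
  "Ck 0 f \<longleftrightarrow> continuous_on UNIV f"
| "Ck (Suc k) f \<longleftrightarrow>
     f differentiable_on UNIV \<and> (\<forall>v\<in>Basis. Ck k (\<lambda>x. frechet_derivative f (at x) v))"

text \<open>
  The class \<open>C_c^\<infinity>([0,T) \<times> \<real>\<^sup>2)\<close>, with arguments ordered as \<open>(x, t)\<close>.  A function smooth up to
  \<open>t = 0\<close> is represented by a smooth extension to negative times; only its values for \<open>t \<ge> 0\<close> are
  ever used.
\<close>

definition test_function :: "real \<Rightarrow> ((real^2) \<times> real \<Rightarrow> real) \<Rightarrow> bool" where
  "test_function T \<phi> \<longleftrightarrow>
     (\<forall>k. Ck k \<phi>) \<and>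
     (\<exists>C. compact C \<and> C \<subseteq> UNIV \<times> {..<T} \<and> (\<forall>p. p \<notin> C \<longrightarrow> \<phi> p = 0))"

definition time_deriv :: "((real^2) \<times> real \<Rightarrow> real) \<Rightarrow> real^2 \<Rightarrow> real \<Rightarrow> real" where
  "time_deriv \<phi> x t = frechet_derivative \<phi> (at (x, t)) (0, 1)"

definition space_grad :: "((real^2) \<times> real \<Rightarrow> real) \<Rightarrow> real^2 \<Rightarrow> real \<Rightarrow> real^2" where
  "space_grad \<phi> x t = (\<chi> i. frechet_derivative \<phi> (at (x, t)) (axis i 1, 0))"

section \<open>The parameter domain\<close>

definition slice :: "(real \<Rightarrow> ereal) \<Rightarrow> (real \<Rightarrow> ereal) \<Rightarrow> real \<Rightarrow> real set" where
  "slice s0 s1 t = {s. s0 t \<le> ereal s \<and> ereal s \<le> s1 t}"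

definition sheet_domain ::
  "real \<Rightarrow> (real \<Rightarrow> ereal) \<Rightarrow> (real \<Rightarrow> ereal) \<Rightarrow> (real \<times> real) set" where
  "sheet_domain T s0 s1 = {(s, t). 0 \<le> t \<and> t < T \<and> s \<in> slice s0 s1 t}"

definition pd_s ::
  "(real \<times> real) set \<Rightarrow> (real \<times> real \<Rightarrow> 'b::real_normed_vector) \<Rightarrow> real \<times> real \<Rightarrow> 'b" where
  "pd_s \<Omega> f p = frechet_derivative f (at p within \<Omega>) (1, 0)"

definition pd_t ::
  "(real \<times> real) set \<Rightarrow> (real \<times> real \<Rightarrow> 'b::real_normed_vector) \<Rightarrow> real \<times> real \<Rightarrow> 'b" where
  "pd_t \<Omega> f p = frechet_derivative f (at p within \<Omega>) (0, 1)"

text \<open>The space \<open>L\<^sup>\<infinity>((0,T); L\<^sup>1(ds))\<close>.\<close>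

definition Linf_L1 ::
  "real \<Rightarrow> (real \<Rightarrow> ereal) \<Rightarrow> (real \<Rightarrow> ereal) \<Rightarrow>
     (real \<times> real \<Rightarrow> 'b::{banach, second_countable_topology}) \<Rightarrow> bool" where
  "Linf_L1 T s0 s1 g \<longleftrightarrow>
     set_borel_measurable lebesgue (sheet_domain T s0 s1) g \<and>
     (\<exists>M. AE t in lborel. 0 < t \<and> t < T \<longrightarrow>
        set_integrable lebesgue (slice s0 s1 t) (\<lambda>s. g (s, t)) \<and>
        (LINT s:slice s0 s1 t|lebesgue. norm (g (s, t))) \<le> M)"

text \<open>
  Regularity of an endpoint function where only differentiability at finite values is required.
  Continuity into the extended reals matters only if \<open>\<sigma>\<close> takes both finite and infinite values; it
  excludes, e.g., an endpoint jumping from \<open>0\<close> to \<open>\<infinity>\<close>.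
\<close>

definition endpoint_differentiable :: "real \<Rightarrow> (real \<Rightarrow> ereal) \<Rightarrow> bool" where
  "endpoint_differentiable T \<sigma> \<longleftrightarrow>
     continuous_on {0..<T} \<sigma> \<and>
     (\<forall>t\<in>{0..<T}. \<bar>\<sigma> t\<bar> \<noteq> \<infinity> \<longrightarrow>
        (\<lambda>\<tau>. real_of_ereal (\<sigma> \<tau>)) differentiable (at t within {0..<T}))"

definition endpoint_C1b :: "real \<Rightarrow> (real \<Rightarrow> ereal) \<Rightarrow> bool" where
  "endpoint_C1b T \<sigma> \<longleftrightarrow>
     (\<forall>t\<in>{0..<T}. \<bar>\<sigma> t\<bar> \<noteq> \<infinity>) \<and> Ckb_on 1 {0..<T} (\<lambda>t. real_of_ereal (\<sigma> t))"

text \<open>\<open>\<gamma>(\<sigma>(t),t) [\<sigma>'(t) - a(\<sigma>(t),t)]\<close> for a finite endpoint \<open>\<sigma>\<close>.\<close>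

definition endpoint_flux ::
  "real \<Rightarrow> (real \<times> real \<Rightarrow> real) \<Rightarrow> (real \<times> real \<Rightarrow> real) \<Rightarrow> (real \<Rightarrow> ereal) \<Rightarrow> real \<Rightarrow> real" where
  "endpoint_flux T \<gamma> a \<sigma> t =
     \<gamma> (real_of_ereal (\<sigma> t), t) *
       (vector_derivative (\<lambda>\<tau>. real_of_ereal (\<sigma> \<tau>)) (at t within {0..<T})
        - a (real_of_ereal (\<sigma> t), t))"

section \<open>Curves\<close>

text \<open>Length of \<open>c\<close> on \<open>[a,b]\<close> (for \<open>a \<le> b\<close>) as the supremum over inscribed polygons.\<close>

definition curve_length :: "(real \<Rightarrow> 'a::metric_space) \<Rightarrow> real \<Rightarrow> real \<Rightarrow> ennreal" where
  "curve_length c a b =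
     (SUP (n, p) \<in> {(n, p :: nat \<Rightarrow> real). mono p \<and> p 0 = a \<and> p n = b}.
        \<Sum>i<n. ennreal (dist (c (p i)) (c (p (Suc i)))))"

text \<open>
  \<open>s\<close> is an arclength parameter at every time; in particular every curve is rectifiable (locally,
  i.e. on compact parameter intervals, if the parameter interval is unbounded).
\<close>

definition arclength_parametrized ::
  "real \<Rightarrow> (real \<Rightarrow> ereal) \<Rightarrow> (real \<Rightarrow> ereal) \<Rightarrow> (real \<times> real \<Rightarrow> real^2) \<Rightarrow> bool" where
  "arclength_parametrized T s0 s1 \<xi> \<longleftrightarrow>
     (\<forall>t\<in>{0..<T}. \<forall>a\<in>slice s0 s1 t. \<forall>b\<in>slice s0 s1 t. a \<le> b \<longrightarrow>
        curve_length (\<lambda>s. \<xi> (s, t)) a b = ennreal (b - a))"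

text \<open>
  \<open>curve_value \<xi> t \<sigma> x\<close>: \<open>\<xi>(\<sigma>,t)\<close> is the finite point \<open>x\<close>, with \<open>\<xi>(\<plusminus>\<infinity>,t)\<close> understood as a limit.
\<close>

definition curve_value :: "(real \<times> real \<Rightarrow> real^2) \<Rightarrow> real \<Rightarrow> ereal \<Rightarrow> real^2 \<Rightarrow> bool" where
  "curve_value \<xi> t \<sigma> x =
     (case \<sigma> of
        ereal r \<Rightarrow> \<xi> (r, t) = x
      | PInfty \<Rightarrow> ((\<lambda>r. \<xi> (r, t)) \<longlongrightarrow> x) at_top
      | MInfty \<Rightarrow> ((\<lambda>r. \<xi> (r, t)) \<longlongrightarrow> x) at_bot)"

definition curve_escapes :: "(real \<times> real \<Rightarrow> real^2) \<Rightarrow> real \<Rightarrow> ereal \<Rightarrow> bool" where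
  "curve_escapes \<xi> t \<sigma> \<longleftrightarrow>
     (\<sigma> = \<infinity> \<and> filterlim (\<lambda>r. \<xi> (r, t)) at_infinity at_top) \<or>
     (\<sigma> = - \<infinity> \<and> filterlim (\<lambda>r. \<xi> (r, t)) at_infinity at_bot)"

text \<open>
  At each time \<open>\<xi>\<close> is one-to-one on the extended interval \<open>[s0(t), s1(t)]\<close>, except that the two
  end values may coincide.  The end values at infinite endpoints are limits, which are required to
  exist in \<open>\<real>\<^sup>2\<close> or to be the point at infinity.
\<close>

definition one_to_one_sheet ::
  "real \<Rightarrow> (real \<Rightarrow> ereal) \<Rightarrow> (real \<Rightarrow> ereal) \<Rightarrow> (real \<times> real \<Rightarrow> real^2) \<Rightarrow> bool" where
  "one_to_one_sheet T s0 s1 \<xi> \<longleftrightarrow>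
     (\<forall>t\<in>{0..<T}.
        (\<forall>\<sigma>\<in>{s0 t, s1 t}. (\<exists>x. curve_value \<xi> t \<sigma> x) \<or> curve_escapes \<xi> t \<sigma>) \<and>
        (\<forall>\<sigma>\<in>{s0 t..s1 t}. \<forall>\<sigma>'\<in>{s0 t..s1 t}. \<forall>x.
           curve_value \<xi> t \<sigma> x \<and> curve_value \<xi> t \<sigma>' x \<longrightarrow>
           \<sigma> = \<sigma>' \<or> {\<sigma>, \<sigma>'} = {s0 t, s1 t}))"

text \<open>
  At a time when the two finite ends meet, the curve is a loop and \<open>s0(t)\<close>, \<open>s1(t)\<close> mark one and the
  same point of it; vorticity leaving through one end re-enters through the other.  There only the
  two fluxes \<open>\<gamma>(s_j,t) [s_j' - a(s_j,t)]\<close> have to agree: they are both nonzero for the stationary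
  sheet \<open>\<xi> = (cos s, sin s)\<close>, \<open>\<gamma> = 1\<close>, \<open>0 \<le> s \<le> 2\<pi>\<close>, where \<open>a = 1/2\<close>.
\<close>

definition closed_at ::
  "(real \<Rightarrow> ereal) \<Rightarrow> (real \<Rightarrow> ereal) \<Rightarrow> (real \<times> real \<Rightarrow> real^2) \<Rightarrow> real \<Rightarrow> bool" where
  "closed_at s0 s1 \<xi> t \<longleftrightarrow>
     \<bar>s0 t\<bar> \<noteq> \<infinity> \<and> \<bar>s1 t\<bar> \<noteq> \<infinity> \<and>
     \<xi> (real_of_ereal (s0 t), t) = \<xi> (real_of_ereal (s1 t), t)"

section \<open>The principal-value velocity\<close>

definition perp :: "real^2 \<Rightarrow> real^2" where
  "perp x = vector [- (x $ 2), x $ 1]"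

definition BR_kernel :: "real^2 \<Rightarrow> real^2" where
  "BR_kernel x = (1 / (2 * pi * (norm x)\<^sup>2)) *\<^sub>R perp x"

definition far_part ::
  "(real \<Rightarrow> ereal) \<Rightarrow> (real \<Rightarrow> ereal) \<Rightarrow> (real \<times> real \<Rightarrow> real^2) \<Rightarrow> real \<Rightarrow> real \<times> real \<Rightarrow> real set" where
  "far_part s0 s1 \<xi> \<epsilon> = (\<lambda>(s, t). {s' \<in> slice s0 s1 t. norm (\<xi> (s, t) - \<xi> (s', t)) \<ge> \<epsilon>})"

definition BR_integrand ::
  "(real \<times> real \<Rightarrow> real^2) \<Rightarrow> (real \<times> real \<Rightarrow> real) \<Rightarrow> real \<times> real \<Rightarrow> real \<Rightarrow> real^2" where
  "BR_integrand \<xi> \<gamma> = (\<lambda>(s, t) s'. \<gamma> (s', t) *\<^sub>R BR_kernel (\<xi> (s, t) - \<xi> (s', t)))"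

definition truncated_velocity ::
  "(real \<Rightarrow> ereal) \<Rightarrow> (real \<Rightarrow> ereal) \<Rightarrow> (real \<times> real \<Rightarrow> real^2) \<Rightarrow> (real \<times> real \<Rightarrow> real) \<Rightarrow>
     real \<Rightarrow> real \<times> real \<Rightarrow> real^2" where
  "truncated_velocity s0 s1 \<xi> \<gamma> \<epsilon> p =
     (LINT s':far_part s0 s1 \<xi> \<epsilon> p|lebesgue. BR_integrand \<xi> \<gamma> p s')"

definition velocity_defined ::
  "(real \<Rightarrow> ereal) \<Rightarrow> (real \<Rightarrow> ereal) \<Rightarrow> (real \<times> real \<Rightarrow> real^2) \<Rightarrow> (real \<times> real \<Rightarrow> real) \<Rightarrow>
     real \<times> real \<Rightarrow> bool" where
  "velocity_defined s0 s1 \<xi> \<gamma> p \<longleftrightarrow>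
     (\<forall>\<epsilon>>0. set_integrable lebesgue (far_part s0 s1 \<xi> \<epsilon> p) (BR_integrand \<xi> \<gamma> p)) \<and>
     (\<exists>u. ((\<lambda>\<epsilon>. truncated_velocity s0 s1 \<xi> \<gamma> \<epsilon> p) \<longlongrightarrow> u) (at_right 0))"

definition velocity ::
  "(real \<Rightarrow> ereal) \<Rightarrow> (real \<Rightarrow> ereal) \<Rightarrow> (real \<times> real \<Rightarrow> real^2) \<Rightarrow> (real \<times> real \<Rightarrow> real) \<Rightarrow>
     real \<times> real \<Rightarrow> real^2" where
  "velocity s0 s1 \<xi> \<gamma> p = Lim (at_right 0) (\<lambda>\<epsilon>. truncated_velocity s0 s1 \<xi> \<gamma> \<epsilon> p)"

section \<open>The Birkhoff-Rott system and its weak solutions\<close>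

definition BR_motion_at ::
  "real \<Rightarrow> (real \<Rightarrow> ereal) \<Rightarrow> (real \<Rightarrow> ereal) \<Rightarrow> (real \<times> real \<Rightarrow> real^2) \<Rightarrow> (real \<times> real \<Rightarrow> real) \<Rightarrow>
     (real \<times> real \<Rightarrow> real) \<Rightarrow> real \<times> real \<Rightarrow> bool" where
  "BR_motion_at T s0 s1 \<xi> \<gamma> a p \<longleftrightarrow>
     (let \<Omega> = sheet_domain T s0 s1 in
        velocity_defined s0 s1 \<xi> \<gamma> p \<and>
        pd_t \<Omega> \<xi> p + a p *\<^sub>R pd_s \<Omega> \<xi> p = velocity s0 s1 \<xi> \<gamma> p)"

text \<open>
  Only the product \<open>a \<gamma>\<close> needs an \<open>s\<close>-derivative: in the converse direction \<open>a\<close> itself is merely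
  continuous.
\<close>

definition BR_conservation ::
  "real \<Rightarrow> (real \<Rightarrow> ereal) \<Rightarrow> (real \<Rightarrow> ereal) \<Rightarrow> (real \<times> real \<Rightarrow> real) \<Rightarrow>
     (real \<times> real \<Rightarrow> real) \<Rightarrow> bool" where
  "BR_conservation T s0 s1 \<gamma> a \<longleftrightarrow>
     (let \<Omega> = sheet_domain T s0 s1 in
        \<forall>(s, t)\<in>\<Omega>. \<exists>D.
          ((\<lambda>s'. a (s', t) * \<gamma> (s', t)) has_real_derivative D) (at s within slice s0 s1 t) \<and>
          pd_t \<Omega> \<gamma> (s, t) + D = 0)"

definition BR_unit_speed ::
  "real \<Rightarrow> (real \<Rightarrow> ereal) \<Rightarrow> (real \<Rightarrow> ereal) \<Rightarrow> (real \<times> real \<Rightarrow> real^2) \<Rightarrow> bool" where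
  "BR_unit_speed T s0 s1 \<xi> \<longleftrightarrow>
     (let \<Omega> = sheet_domain T s0 s1 in \<forall>p\<in>\<Omega>. norm (pd_s \<Omega> \<xi> p) = 1)"

text \<open>
  Integrability of \<open>\<gamma>0\<close> and measurability of \<open>\<xi>\<close> and \<open>\<xi>0\<close> are part of the definition so that all
  integrals in the weak formulation are genuine.
\<close>

definition weak_BR_solution ::
  "real \<Rightarrow> (real \<Rightarrow> ereal) \<Rightarrow> (real \<Rightarrow> ereal) \<Rightarrow> (real \<times> real \<Rightarrow> real) \<Rightarrow> (real \<times> real \<Rightarrow> real^2) \<Rightarrow>
     (real \<Rightarrow> real) \<Rightarrow> (real \<Rightarrow> real^2) \<Rightarrow> bool" where
  "weak_BR_solution T s0 s1 \<gamma> \<xi> \<gamma>0 \<xi>0 \<longleftrightarrow>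
     arclength_parametrized T s0 s1 \<xi> \<and>
     set_borel_measurable lebesgue (sheet_domain T s0 s1) \<xi> \<and>
     Linf_L1 T s0 s1 \<gamma> \<and>
     (\<forall>p\<in>sheet_domain T s0 s1. velocity_defined s0 s1 \<xi> \<gamma> p) \<and>
     Linf_L1 T s0 s1 (\<lambda>p. \<gamma> p *\<^sub>R velocity s0 s1 \<xi> \<gamma> p) \<and>
     set_integrable lebesgue (slice s0 s1 0) \<gamma>0 \<and>
     set_borel_measurable lebesgue (slice s0 s1 0) \<xi>0 \<and>
     (\<forall>\<phi>. test_function T \<phi> \<longrightarrow>
        (LINT t:{0<..<T}|lebesgue. LINT s:slice s0 s1 t|lebesgue.
           \<gamma> (s, t) * (time_deriv \<phi> (\<xi> (s, t)) t
                        + velocity s0 s1 \<xi> \<gamma> (s, t) \<bullet> space_grad \<phi> (\<xi> (s, t)) t))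
        + (LINT s:slice s0 s1 0|lebesgue. \<gamma>0 s * \<phi> (\<xi>0 s, 0)) = 0)"

end

theory Submission
  imports Defs
begin

text \<open>
  Put \<open>f(s,t) = \<phi>(\<xi>(s,t),t)\<close> for a test function \<open>\<phi>\<close>.  If \<open>\<xi>\<^sub>t + a \<xi>\<^sub>s = U\<close>, the chain
  rule turns \<open>\<phi>\<^sub>t + U \<bullet> \<nabla>\<phi>\<close> on the sheet into \<open>f\<^sub>t + a f\<^sub>s\<close>, and \<open>\<gamma>\<^sub>t + (a \<gamma>)\<^sub>s = 0\<close> turns
  \<open>\<gamma> (f\<^sub>t + a f\<^sub>s)\<close> into the space-time divergence of \<open>(a \<gamma> f, \<gamma> f)\<close>.  Integrating over
  \<open>\<Omega>\<close> leaves the initial contribution and, along each finite endpoint, \<open>f\<close> times the flux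
  \<open>\<gamma> (s\<^sub>j' - a)\<close> of condition (E).  This is \<open>weak_identity\<close>.  The endpoints are only
  differentiable and may run off to infinity in finite time, so the divergence theorem is replaced by
  the derivative of \<open>t \<mapsto> \<integral> \<gamma> f \<chi>\<^sub>R ds\<close> with a cutoff \<open>\<chi>\<^sub>R\<close> in arclength; it is
  computed at one time at a time by \<open>leibniz_moving_endpoints\<close>.  The cutoff costs
  \<open>\<integral> a \<gamma> f \<chi>\<^sub>R' ds\<close>, which is at most a constant times \<open>(1/R) \<integral> |\<gamma>| ds\<close>: no vorticity
  is lost at infinity, because \<open>\<gamma>\<close> is in \<open>L\<^sup>1(ds)\<close> uniformly in time (\<open>slice_L1_bound\<close>).
  With zero fluxes the identity is the weak formulation, which is the direct part.

  For the converse, test with \<open>\<psi>(x) b(t)\<close>.  Let \<open>\<psi>\<close> live near an interior point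
  \<open>\<xi>(s,t)\<close> of the sheet.  The sheet is one-to-one and moves with bounded speed, so \<open>\<psi>\<close> only sees
  parameters near \<open>s\<close> at all times near \<open>t\<close> (\<open>localization\<close>).  Shrinking the support of
  \<open>b\<close> to the time \<open>t\<close> gives an identity on a single arc,
  \<open>\<integral> \<gamma> (U - \<xi>\<^sub>t) \<bullet> \<nabla>\<psi>(\<xi>) - \<gamma>\<^sub>t \<psi>(\<xi>) ds = 0\<close> (\<open>fixed_time_identity\<close>): the vector measure
  \<open>\<gamma> (U - \<xi>\<^sub>t) ds\<close> on the arc has divergence \<open>- \<gamma>\<^sub>t ds\<close>.  A vector measure on a \<open>C\<^sup>1\<close> arc
  whose divergence is again a measure on the arc must be tangent to it (\<open>normal_eq_0\<close>), which gives
  \<open>\<gamma> (\<xi>\<^sub>t + a \<xi>\<^sub>s - U) = 0\<close>, and its tangential density has the divergence as derivative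
  (\<open>tangential_derivative\<close>), which is \<open>(a \<gamma>)\<^sub>s = - \<gamma>\<^sub>t\<close>.  Continuity carries both equations to
  \<open>t = 0\<close> and to the ends of the sheet.

  Once the equations hold, \<open>weak_identity\<close> applies to the weak solution itself, and comparing it with
  the weak formulation leaves only the endpoint terms.  Concentrating them in time gives
  \<open>\<psi>(\<xi>(s\<^sub>0)) flux\<^sub>0 = \<psi>(\<xi>(s\<^sub>1)) flux\<^sub>1\<close> for every \<open>\<psi>\<close> (\<open>outflow_balance\<close>): if the
  ends are different points, each flux vanishes, and if they coincide, the fluxes agree.
\<close>

section \<open>Smooth bump functions\<close>

text \<open>
  The derivatives of \<open>exp (- 1 / x)\<close>, continued by \<open>0\<close> to \<open>x \<le> 0\<close>, are linear combinations
  of the functions \<open>flat n\<close>; this family is closed under differentiation, which is all that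
  smoothness requires.
\<close>

definition flat :: "nat \<Rightarrow> real \<Rightarrow> real" where
  "flat n x = (if x > 0 then (1 / x) ^ n * exp (- (1 / x)) else 0)"

lemma flat_nonneg: "flat n x \<ge> 0"
  by (simp add: flat_def)

lemma flat_pos: "x > 0 \<Longrightarrow> flat n x > 0"
  by (simp add: flat_def)

lemma flat_nonpos_eq_0: "x \<le> 0 \<Longrightarrow> flat n x = 0"
  by (simp add: flat_def)

lemma flat_tendsto_0: "(flat n \<longlongrightarrow> 0) (at 0)"
proof -
  have "((\<lambda>x. (inverse x) ^ n / exp (inverse x)) \<longlongrightarrow> (0::real)) (at_right 0)"
    using filterlim_compose[OF tendsto_power_div_exp_0 filterlim_inverse_at_top_right] .
  moreover have "\<forall>\<^sub>F x in at_right (0::real). (inverse x) ^ n / exp (inverse x) = flat n x"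
    by (auto simp: flat_def eventually_at_right_less exp_minus field_simps
        intro!: eventually_mono[OF eventually_at_right_less[of 0]])
  ultimately have R: "(flat n \<longlongrightarrow> 0) (at_right 0)"
    using Lim_transform_eventually by blast
  have "\<forall>\<^sub>F x in at_left (0::real). 0 = flat n x"
    by (auto simp: flat_def eventually_at_filter)
  hence "(flat n \<longlongrightarrow> 0) (at_left 0)"
    using Lim_transform_eventually[OF tendsto_const] by blast
  with R show ?thesis
    using filterlim_split_at by blast
qed

lemma flat_has_derivative_0: "(flat n has_real_derivative 0) (at 0)"
proof -
  have "((\<lambda>h. flat (Suc n) h) \<longlongrightarrow> 0) (at 0)" by (rule flat_tendsto_0)
  moreover have "(\<lambda>h. (flat n (0 + h) - flat n 0) / h) = flat (Suc n)"
    by (auto simp: flat_def fun_eq_iff)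
  ultimately show ?thesis by (simp add: DERIV_def)
qed

lemma DERIV_flat: "(flat n has_real_derivative flat (n + 2) x - real n * flat (n + 1) x) (at x)"
proof -
  consider "x > 0" | "x < 0" | "x = 0" by linarith
  then show ?thesis
  proof cases
    case 1
    have eq: "\<forall>\<^sub>F y in nhds x. flat n y = (1 / y) ^ n * exp (- (1 / y))"
      using 1 by (auto simp: flat_def intro!: eventually_mono[OF order_tendstoD(1)[OF filterlim_ident 1]])
    have "((\<lambda>y. (1 / y) ^ n * exp (- (1 / y))) has_real_derivative
        (real n * (1 / x) ^ (n - 1) * (- 1 / x^2)) * exp (- (1 / x))
         + (1 / x) ^ n * (exp (- (1 / x)) * (1 / x^2))) (at x)"
      using 1 by (auto intro!: derivative_eq_intros simp: power2_eq_square)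
    moreover have "(real n * (1 / x) ^ (n - 1) * (- 1 / x^2)) * exp (- (1 / x))
         + (1 / x) ^ n * (exp (- (1 / x)) * (1 / x^2)) = flat (n + 2) x - real n * flat (n + 1) x"
      using 1 by (cases n) (auto simp: flat_def power2_eq_square field_simps)
    ultimately show ?thesis using DERIV_cong_ev[OF refl eq refl] by simp
  next
    case 2
    have eq: "\<forall>\<^sub>F y in nhds x. flat n y = 0"
      by (auto simp: flat_def intro!: eventually_mono[OF order_tendstoD(2)[OF filterlim_ident 2]])
    have "((\<lambda>y. 0) has_real_derivative 0) (at x)" by simp
    then show ?thesis using DERIV_cong_ev[OF refl eq refl] 2 by (simp add: flat_nonpos_eq_0)
  next
    case 3
    then show ?thesis using flat_has_derivative_0[of n] by (simp add: flat_def)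
  qed
qed

text \<open>
  An algebra of functions that contains the bump functions and is closed under partial derivatives.
  Closure under \<open>inverse\<close> provides the normalized step function below.
\<close>

inductive smooth_alg :: "('a::euclidean_space \<Rightarrow> real) \<Rightarrow> bool" where
  const: "smooth_alg (\<lambda>x. c)"
| affine: "smooth_alg (\<lambda>x. x \<bullet> v + c)"
| flat: "smooth_alg (\<lambda>x. flat n (x \<bullet> v + c))"
| add: "smooth_alg f \<Longrightarrow> smooth_alg g \<Longrightarrow> smooth_alg (\<lambda>x. f x + g x)"
| mult: "smooth_alg f \<Longrightarrow> smooth_alg g \<Longrightarrow> smooth_alg (\<lambda>x. f x * g x)"
| inv: "smooth_alg f \<Longrightarrow> (\<And>x. f x \<noteq> 0) \<Longrightarrow> smooth_alg (\<lambda>x. inverse (f x))"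

text \<open>
  Only closure under one derivative is needed for each generator; \<open>smooth_alg_Ck\<close> then follows by
  induction on the order.
\<close>

lemma smooth_alg_has_derivative:
  "smooth_alg f \<Longrightarrow> \<exists>f'. (\<forall>x. (f has_derivative f' x) (at x)) \<and> (\<forall>v. smooth_alg (\<lambda>x. f' x v))"
proof (induction rule: smooth_alg.induct)
  case (const c)
  show ?case by (rule exI[of _ "\<lambda>x v. 0"]) (auto intro: smooth_alg.const)
next
  case (affine v c)
  show ?case
    by (rule exI[of _ "\<lambda>x w. w \<bullet> v"]) (auto intro!: smooth_alg.const derivative_eq_intros)
next
  case (flat n v c)
  let ?d = "\<lambda>x. flat (n + 2) (x \<bullet> v + c) + (- real n) * flat (n + 1) (x \<bullet> v + c)"
  have "((\<lambda>x. flat n (x \<bullet> v + c)) has_derivative (\<lambda>w. ?d x * (w \<bullet> v))) (at x)" for x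
    by (rule has_derivative_eq_rhs[OF has_derivative_compose[OF _ DERIV_flat[unfolded has_field_derivative_def],
            of "\<lambda>x. x \<bullet> v + c" "\<lambda>w. w \<bullet> v"]])
      (auto intro!: derivative_eq_intros)
  moreover have "smooth_alg (\<lambda>x. ?d x * (w \<bullet> v))" for w
    by (intro smooth_alg.mult smooth_alg.add smooth_alg.const smooth_alg.flat)
  ultimately show ?case
    by (intro exI[of _ "\<lambda>x w. ?d x * (w \<bullet> v)"] conjI allI)
next
  case (add f g)
  then obtain f' g' where "\<And>x. (f has_derivative f' x) (at x)" "\<And>v. smooth_alg (\<lambda>x. f' x v)"
    "\<And>x. (g has_derivative g' x) (at x)" "\<And>v. smooth_alg (\<lambda>x. g' x v)" by blast
  then show ?case
    by (intro exI[of _ "\<lambda>x v. f' x v + g' x v"]) (auto intro!: smooth_alg.add has_derivative_add)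
next
  case (mult f g)
  then obtain f' g' where *: "\<And>x. (f has_derivative f' x) (at x)" "\<And>v. smooth_alg (\<lambda>x. f' x v)"
    "\<And>x. (g has_derivative g' x) (at x)" "\<And>v. smooth_alg (\<lambda>x. g' x v)" by blast
  then show ?case using mult(1,2)
    by (intro exI[of _ "\<lambda>x v. f x * g' x v + f' x v * g x"])
      (auto intro!: smooth_alg.add smooth_alg.mult has_derivative_mult)
next
  case (inv f)
  then obtain f' where *: "\<And>x. (f has_derivative f' x) (at x)" "\<And>v. smooth_alg (\<lambda>x. f' x v)"
    by blast
  have "((\<lambda>x. inverse (f x)) has_derivative (\<lambda>v. (-1) * (inverse (f x) * f' x v * inverse (f x)))) (at x)" for x
    using Deriv.has_derivative_inverse[OF inv(2) *(1)] by simp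
  moreover have "smooth_alg (\<lambda>x. (-1) * (inverse (f x) * f' x v * inverse (f x)))" for v
    using inv * by (intro smooth_alg.mult smooth_alg.inv smooth_alg.const) auto
  ultimately show ?case
    by (intro exI[of _ "\<lambda>x v. (-1) * (inverse (f x) * f' x v * inverse (f x))"]) auto
qed

lemma smooth_alg_differentiable: "smooth_alg f \<Longrightarrow> f differentiable (at x)"
  using smooth_alg_has_derivative unfolding differentiable_def by blast

lemma smooth_alg_continuous: "smooth_alg f \<Longrightarrow> continuous_on S f"
  by (meson smooth_alg_differentiable differentiable_imp_continuous_on differentiable_on_def
      differentiable_at_withinI)

lemma smooth_alg_frechet: "smooth_alg f \<Longrightarrow> smooth_alg (\<lambda>x. frechet_derivative f (at x) v)"
proof -
  assume "smooth_alg f"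
  then obtain f' where f': "\<And>x. (f has_derivative f' x) (at x)" "\<And>v. smooth_alg (\<lambda>x. f' x v)"
    using smooth_alg_has_derivative by blast
  have "frechet_derivative f (at x) = f' x" for x
    using frechet_derivative_at[OF f'(1)[of x]] by simp
  with f'(2)[of v] show ?thesis by simp
qed

lemma smooth_alg_Ck: "smooth_alg f \<Longrightarrow> Ck k f"
  by (induction k arbitrary: f)
     (auto simp: smooth_alg_continuous smooth_alg_frechet differentiable_on_def smooth_alg_differentiable)

lemma smooth_alg_fst: "smooth_alg f \<Longrightarrow> smooth_alg (\<lambda>p :: 'a::euclidean_space \<times> 'b::euclidean_space. f (fst p))"
proof (induction rule: smooth_alg.induct)
  case (affine v c)
  then show ?case using smooth_alg.affine[of "(v, 0)" c] by (simp add: inner_prod_def)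
next
  case (flat n v c)
  then show ?case using smooth_alg.flat[of n "(v, 0)" c] by (simp add: inner_prod_def)
qed (auto intro: smooth_alg.intros)

lemma smooth_alg_snd: "smooth_alg f \<Longrightarrow> smooth_alg (\<lambda>p :: 'a::euclidean_space \<times> 'b::euclidean_space. f (snd p))"
proof (induction rule: smooth_alg.induct)
  case (affine v c)
  then show ?case using smooth_alg.affine[of "(0, v)" c] by (simp add: inner_prod_def)
next
  case (flat n v c)
  then show ?case using smooth_alg.flat[of n "(0, v)" c] by (simp add: inner_prod_def)
qed (auto intro: smooth_alg.intros)

text \<open>
  A smooth monotone step from \<open>0\<close> (on \<open>x \<le> 0\<close>) to \<open>1\<close> (on \<open>x \<ge> 1\<close>).
\<close>

definition step :: "real \<Rightarrow> real" where
  "step x = flat 0 x * inverse (flat 0 x + flat 0 (1 - x))"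

lemma step_denominator_pos: "flat 0 x + flat 0 (1 - x) > 0"
  using flat_pos[of x 0] flat_pos[of "1 - x" 0] flat_nonneg[of 0 x] flat_nonneg[of 0 "1 - x"]
  by (cases "x > 0") (auto simp: add_pos_nonneg add_nonneg_pos)

lemma smooth_alg_step: "smooth_alg (\<lambda>x. step (x \<bullet> v + c))"
proof -
  have "smooth_alg (\<lambda>x. flat 0 (x \<bullet> (- v) + (1 - c)))" by (rule smooth_alg.flat)
  hence "smooth_alg (\<lambda>x. flat 0 (1 - (x \<bullet> v + c)))" by (simp add: algebra_simps)
  then show ?thesis unfolding step_def
    using step_denominator_pos
    by (intro smooth_alg.mult smooth_alg.inv smooth_alg.add smooth_alg.flat) (auto simp: less_le)
qed

lemma step_0: "x \<le> 0 \<Longrightarrow> step x = 0"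
  by (simp add: step_def flat_nonpos_eq_0)

lemma step_1: "x \<ge> 1 \<Longrightarrow> step x = 1"
  using flat_pos[of x 0] by (simp add: step_def flat_nonpos_eq_0)

lemma step_bounds: "0 \<le> step x" "step x \<le> 1"
  using step_denominator_pos[of x] flat_nonneg[of 0 x] flat_nonneg[of 0 "1 - x"]
  by (auto simp: step_def field_simps)

definition dstep :: "real \<Rightarrow> real" where
  "dstep x = deriv step x"

lemma DERIV_step: "(step has_real_derivative dstep x) (at x)"
proof -
  have "smooth_alg (\<lambda>x::real. step (x \<bullet> 1 + 0))" by (rule smooth_alg_step)
  then have "step differentiable (at x)"
    using smooth_alg_differentiable by fastforce
  then show ?thesis by (simp add: dstep_def DERIV_deriv_iff_real_differentiable)
qed

lemma step_mono: "x \<le> y \<Longrightarrow> step x \<le> step y"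
proof -
  have m: "flat 0 x \<le> flat 0 y" if "x \<le> y" for x y
    using that by (auto simp: flat_def frac_le)
  assume xy: "x \<le> y"
  have "flat 0 x * flat 0 (1 - y) \<le> flat 0 y * flat 0 (1 - x)"
    using m[OF xy] m[of "1 - y" "1 - x"] xy by (intro mult_mono) (auto simp: flat_nonneg)
  then show ?thesis
    using step_denominator_pos[of x] step_denominator_pos[of y]
    by (simp add: step_def field_simps)
qed

lemma dstep_nonneg: "dstep x \<ge> 0"
proof -
  have "mono_on UNIV step" by (auto simp: monotone_on_def step_mono)
  then show ?thesis using mono_on_imp_deriv_nonneg[OF _ DERIV_step, of UNIV x] by simp
qed

lemma continuous_dstep: "continuous_on S dstep"
proof -
  have A: "smooth_alg (\<lambda>x::real. step (x \<bullet> 1 + 0))" by (rule smooth_alg_step)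
  have "frechet_derivative step (at x) 1 = dstep x" for x
    using frechet_derivative_at[OF DERIV_step[unfolded has_field_derivative_def, of x]]
    by (metis mult.right_neutral)
  then show ?thesis
    using smooth_alg_continuous[OF smooth_alg_frechet[OF A, of 1], of S] by simp
qed

lemma dstep_eq_0: assumes "x \<le> 0 \<or> x \<ge> 1" shows "dstep x = 0"
proof -
  have mx: "(step has_real_derivative 0) (at x)" if "\<And>y. step y \<ge> step x"
    using DERIV_local_min[OF DERIV_step[of x], of 1] that DERIV_step[of x] by auto
  have mn: "dstep x = 0" if "\<And>y. step y \<le> step x"
    using DERIV_local_max[OF DERIV_step[of x], of 1] that by auto
  show ?thesis
    using assms mx mn step_0[of x] step_1[of x] step_bounds DERIV_unique[OF DERIV_step[of x]]
    by metis
qed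

text \<open>
  A plateau function: \<open>1\<close> on \<open>[-1/2, 1/2]\<close> and \<open>0\<close> outside \<open>(-1, 1)\<close>.  The plateau is what
  makes a bump in the normal direction invisible along a curve.
\<close>

definition bump :: "real \<Rightarrow> real" where
  "bump x = step (2 * (1 - x)) * step (2 * (1 + x))"

lemma smooth_alg_bump: "smooth_alg (\<lambda>x. bump (x \<bullet> v + c))"
proof -
  have "smooth_alg (\<lambda>x. step (x \<bullet> (-2 *\<^sub>R v) + (2 - 2 * c)) * step (x \<bullet> (2 *\<^sub>R v) + (2 + 2 * c)))"
    by (intro smooth_alg.mult smooth_alg_step)
  then show ?thesis by (simp add: bump_def algebra_simps)
qed

lemma bump_bounds: "0 \<le> bump x" "bump x \<le> 1"
  using step_bounds by (auto simp: bump_def mult_le_one)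

lemma bump_1: "\<bar>x\<bar> \<le> 1 / 2 \<Longrightarrow> bump x = 1"
  by (auto simp: bump_def step_1)

lemma bump_0: "\<bar>x\<bar> \<ge> 1 \<Longrightarrow> bump x = 0"
  by (cases "x \<ge> 0") (auto simp: bump_def step_0)

definition dbump :: "real \<Rightarrow> real" where
  "dbump x = - 2 * dstep (2 * (1 - x)) * step (2 * (1 + x)) + step (2 * (1 - x)) * (2 * dstep (2 * (1 + x)))"

lemma DERIV_bump: "(bump has_real_derivative dbump x) (at x)"
  unfolding bump_def[abs_def] dbump_def
  by (auto intro!: derivative_eq_intros DERIV_chain2[OF DERIV_step] simp: algebra_simps)

lemma continuous_step: "continuous_on S step"
  by (meson DERIV_step DERIV_continuous_on has_field_derivative_at_within)

lemma continuous_bump: "continuous_on S bump"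
  by (meson DERIV_bump DERIV_continuous_on has_field_derivative_at_within)

lemma continuous_dbump: "continuous_on S dbump"
  unfolding dbump_def
  by (intro continuous_intros continuous_on_compose2[OF continuous_dstep[of UNIV]]
      continuous_on_compose2[OF continuous_step[of UNIV]]) auto

lemma dbump_0: assumes "\<bar>x\<bar> \<le> 1/2 \<or> \<bar>x\<bar> \<ge> 1" shows "dbump x = 0"
  using assms by (auto simp: dbump_def dstep_eq_0 step_0 abs_le_iff abs_if split: if_splits)

section \<open>Differentiating integrals over moving intervals\<close>

text \<open>
  The endpoint is differentiable at the single time \<open>t\<close> only, so between \<open>t\<close> and \<open>\<tau>\<close> it may
  oscillate and a vertical segment near the boundary may leave the region.  The proof therefore splits
  the interval at \<open>c = b t - K |\<tau> - t|\<close>: to the left of \<open>c\<close> vertical segments stay in the region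
  and the mean value theorem applies, while the two remaining layers have width \<open>O(|\<tau> - t|)\<close> and
  only the value of \<open>F\<close> at the corner \<open>(b t, t)\<close> matters there.
\<close>

lemma leibniz_moving_upper_endpoint:
  fixes F Ft :: "real \<times> real \<Rightarrow> real" and b :: "real \<Rightarrow> real" and m :: real
  defines "D \<equiv> \<lambda>\<alpha> \<beta>. {(s, \<tau>). \<tau> \<in> {\<alpha>..\<beta>} \<and> m \<le> s \<and> s \<le> b \<tau>}"
  assumes t: "t \<in> {\<alpha>..\<beta>}"
    and b: "continuous_on {\<alpha>..\<beta>} b" "\<And>\<tau>. \<tau> \<in> {\<alpha>..\<beta>} \<Longrightarrow> m < b \<tau>"
    and b': "(b has_real_derivative b') (at t within {\<alpha>..\<beta>})"
    and F: "continuous_on (D \<alpha> \<beta>) F" "continuous_on (D \<alpha> \<beta>) Ft"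
    and Ft: "\<And>s \<tau>. (s, \<tau>) \<in> D \<alpha> \<beta> \<Longrightarrow>
        ((\<lambda>\<tau>. F (s, \<tau>)) has_real_derivative Ft (s, \<tau>)) (at \<tau> within {\<tau>. (s, \<tau>) \<in> D \<alpha> \<beta>})"
  shows "((\<lambda>\<tau>. integral {m..b \<tau>} (\<lambda>s. F (s, \<tau>))) has_real_derivative
      integral {m..b t} (\<lambda>s. Ft (s, t)) + F (b t, t) * b') (at t within {\<alpha>..\<beta>})"
proof -
  define E where "E = D \<alpha> \<beta>"
  note F = F[folded E_def] and Ft = Ft[folded E_def]
  have E_iff: "(s, \<tau>) \<in> E \<longleftrightarrow> \<tau> \<in> {\<alpha>..\<beta>} \<and> m \<le> s \<and> s \<le> b \<tau>" for s \<tau>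
    by (auto simp: E_def D_def)
  have "E = (\<lambda>(y, \<tau>). (m + y * (b \<tau> - m), \<tau>)) ` ({0..1} \<times> {\<alpha>..\<beta>})"
  proof (intro set_eqI iffI)
    fix p assume "p \<in> E"
    obtain s \<tau> where p: "p = (s, \<tau>)" by (cases p)
    have *: "\<tau> \<in> {\<alpha>..\<beta>}" "m \<le> s" "s \<le> b \<tau>" using \<open>p \<in> E\<close> E_iff p by auto
    have "b \<tau> - m > 0" using b(2)[OF *(1)] by simp
    then show "p \<in> (\<lambda>(y, \<tau>). (m + y * (b \<tau> - m), \<tau>)) ` ({0..1} \<times> {\<alpha>..\<beta>})"
      using * by (intro image_eqI[of _ _ "((s - m) / (b \<tau> - m), \<tau>)"]) (auto simp: p)
  next
    fix p assume "p \<in> (\<lambda>(y, \<tau>). (m + y * (b \<tau> - m), \<tau>)) ` ({0..1} \<times> {\<alpha>..\<beta>})"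
    then obtain q where q: "p = (\<lambda>(y, \<tau>). (m + y * (b \<tau> - m), \<tau>)) q" "q \<in> {0..1} \<times> {\<alpha>..\<beta>}"
      by (rule imageE)
    obtain y \<tau> where "q = (y, \<tau>)" by (cases q)
    with q have *: "p = (m + y * (b \<tau> - m), \<tau>)" "0 \<le> y" "y \<le> 1" "\<tau> \<in> {\<alpha>..\<beta>}" by simp_all
    have "y * (b \<tau> - m) \<le> b \<tau> - m" "0 \<le> y * (b \<tau> - m)"
      using b(2)[OF *(4)] * by (auto intro!: mult_left_le_one_le)
    then show "p \<in> E" using * E_iff by auto
  qed
  moreover have "compact ((\<lambda>(y, \<tau>). (m + y * (b \<tau> - m), \<tau>)) ` ({0..1} \<times> {\<alpha>..\<beta>}))"
    unfolding split_beta
    by (intro compact_continuous_image continuous_intros compact_Times compact_Icc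
        continuous_on_compose2[OF b(1)]) auto
  ultimately have cE: "compact E" by simp
  have ucF: "uniformly_continuous_on E F" and ucFt: "uniformly_continuous_on E Ft"
    using compact_uniformly_continuous F cE by auto
  have "bounded (Ft ` E)" using compact_imp_bounded[OF compact_continuous_image[OF F(2) cE]] .
  then obtain A0 where A0: "\<And>p. p \<in> E \<Longrightarrow> \<bar>Ft p\<bar> \<le> A0" by (auto simp: bounded_iff)
  define A where "A = max A0 1"
  have A: "\<bar>Ft p\<bar> \<le> A" if "p \<in> E" for p using A0[OF that] by (simp add: A_def)
  have A_pos: "A > 0" by (simp add: A_def)
  \<comment> \<open>a Lipschitz constant of \<open>b\<close> as seen from the time \<open>t\<close>\<close>
  define K where "K = \<bar>b'\<bar> + 1"
  have K: "K > 0" by (simp add: K_def)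
  let ?G = "\<lambda>\<tau>. integral {m..b \<tau>} (\<lambda>s. F (s, \<tau>))"
  let ?d = "integral {m..b t} (\<lambda>s. Ft (s, t)) + F (b t, t) * b'"
  have contF: "continuous_on {l..u} (\<lambda>s. F (s, \<tau>))" and contFt: "continuous_on {l..u} (\<lambda>s. Ft (s, \<tau>))"
    if "\<tau> \<in> {\<alpha>..\<beta>}" "m \<le> l" "u \<le> b \<tau>" for l u \<tau>
    using that
    by (auto intro!: continuous_on_compose2[OF F(1)] continuous_on_compose2[OF F(2)] continuous_intros
        simp: E_iff)
  note intF = integrable_continuous_real[OF contF] and intFt = integrable_continuous_real[OF contFt]
  have bt: "m < b t" using b(2)[OF t] .
  have main: "\<exists>\<delta>>0. \<forall>\<tau>\<in>{\<alpha>..\<beta>}. norm (\<tau> - t) < \<delta> \<longrightarrow>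
      norm (?G \<tau> - ?G t - (\<lambda>h. ?d * h) (\<tau> - t)) \<le> \<epsilon> * norm (\<tau> - t)" if "\<epsilon> > 0" for \<epsilon> :: real
  proof -
    \<comment> \<open>chosen so that the error terms add up to \<open>\<epsilon>1 * C\<close> times \<open>|\<tau> - t|\<close>\<close>
    define C where "C = (b t - m) + 1 + 3 * K + \<bar>F (b t, t)\<bar>"
    have C: "C > 0" using bt K by (simp add: C_def)
    define \<epsilon>1 where "\<epsilon>1 = \<epsilon> / C"
    have \<epsilon>1: "\<epsilon>1 > 0" using C that by (simp add: \<epsilon>1_def)
    obtain \<delta>F where \<delta>F: "\<delta>F > 0" "\<And>p q. p \<in> E \<Longrightarrow> q \<in> E \<Longrightarrow> dist p q < \<delta>F \<Longrightarrow> \<bar>F p - F q\<bar> < \<epsilon>1"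
      using ucF \<epsilon>1 unfolding uniformly_continuous_on_def dist_real_def by metis
    obtain \<delta>G where \<delta>G: "\<delta>G > 0" "\<And>p q. p \<in> E \<Longrightarrow> q \<in> E \<Longrightarrow> dist p q < \<delta>G \<Longrightarrow> \<bar>Ft p - Ft q\<bar> < \<epsilon>1"
      using ucFt \<epsilon>1 unfolding uniformly_continuous_on_def dist_real_def by metis
    have "min \<epsilon>1 1 > 0" using \<epsilon>1 by simp
    with b' obtain \<delta>b where \<delta>b: "\<delta>b > 0" "\<And>\<tau>. \<tau> \<in> {\<alpha>..\<beta>} \<Longrightarrow> \<bar>\<tau> - t\<bar> < \<delta>b \<Longrightarrow>
        \<bar>b \<tau> - b t - b' * (\<tau> - t)\<bar> \<le> min \<epsilon>1 1 * \<bar>\<tau> - t\<bar>"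
      unfolding has_field_derivative_def has_derivative_within_alt real_norm_def by metis
    define \<delta> where "\<delta> = Min {\<delta>F / (K + 1), \<delta>G, \<delta>b, (b t - m) / K, \<epsilon>1 / (A * K)}"
    have "\<delta> > 0" using \<delta>F \<delta>G \<delta>b bt K \<epsilon>1 A_pos by (auto simp: \<delta>_def)
    moreover have "\<bar>?G \<tau> - ?G t - ?d * (\<tau> - t)\<bar> \<le> \<epsilon> * \<bar>\<tau> - t\<bar>"
      if \<tau>: "\<tau> \<in> {\<alpha>..\<beta>}" and h\<delta>: "\<bar>\<tau> - t\<bar> < \<delta>" for \<tau>
    proof -
      define h where "h = \<bar>\<tau> - t\<bar>"
      have h0: "h \<ge> 0" by (simp add: h_def)
      have hs: "h < \<delta>F / (K + 1)" "h < \<delta>G" "h < \<delta>b" "h < (b t - m) / K" "h < \<epsilon>1 / (A * K)"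
        using h\<delta> by (auto simp: \<delta>_def h_def)
      define c where "c = b t - K * h"
      have c: "m \<le> c" "c \<le> b t" using hs(4) K h0 by (auto simp: c_def field_simps)
      have bK: "\<bar>b \<sigma> - b t\<bar> \<le> K * \<bar>\<sigma> - t\<bar>" if "\<sigma> \<in> {\<alpha>..\<beta>}" "\<bar>\<sigma> - t\<bar> \<le> h" for \<sigma>
      proof -
        have "\<bar>b \<sigma> - b t - b' * (\<sigma> - t)\<bar> \<le> min \<epsilon>1 1 * \<bar>\<sigma> - t\<bar>"
          using \<delta>b(2)[OF that(1)] that(2) hs(3) by simp
        also have "\<dots> \<le> 1 * \<bar>\<sigma> - t\<bar>" by (intro mult_right_mono) auto
        finally have "\<bar>b \<sigma> - b t\<bar> \<le> \<bar>b' * (\<sigma> - t)\<bar> + \<bar>\<sigma> - t\<bar>"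
          using abs_triangle_ineq[of "b \<sigma> - b t - b' * (\<sigma> - t)" "b' * (\<sigma> - t)"] by simp
        then show ?thesis by (simp add: K_def abs_mult distrib_right)
      qed
      have c\<sigma>: "c \<le> b \<sigma>" if "\<sigma> \<in> closed_segment t \<tau>" for \<sigma>
      proof -
        have s: "\<sigma> \<in> {\<alpha>..\<beta>}" "\<bar>\<sigma> - t\<bar> \<le> h"
          using that t \<tau> by (auto simp: closed_segment_eq_real_ivl h_def split: if_splits)
        have "K * \<bar>\<sigma> - t\<bar> \<le> K * h" using s K by simp
        with bK[OF s] show ?thesis by (simp add: c_def)
      qed
      have segJ: "closed_segment t \<tau> \<subseteq> {\<alpha>..\<beta>}"
        using t \<tau> by (auto simp: closed_segment_eq_real_ivl)
      have mv: "\<bar>F (s, \<tau>) - F (s, t) - (\<tau> - t) * Ft (s, t)\<bar> \<le> \<epsilon>1 * h" if s: "s \<in> {m..c}" for s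
      proof -
        have segE: "(s, \<sigma>) \<in> E" if "\<sigma> \<in> closed_segment t \<tau>" for \<sigma>
          using c\<sigma>[OF that] segJ that s by (auto simp: E_iff)
        have "norm ((\<lambda>\<sigma>. F (s, \<sigma>) - \<sigma> * Ft (s, t)) \<tau> - (\<lambda>\<sigma>. F (s, \<sigma>) - \<sigma> * Ft (s, t)) t) \<le> \<epsilon>1 * norm (\<tau> - t)"
        proof (rule field_differentiable_bound[of "closed_segment t \<tau>" _ "\<lambda>\<sigma>. Ft (s, \<sigma>) - Ft (s, t)"])
          fix \<sigma> assume \<sigma>: "\<sigma> \<in> closed_segment t \<tau>"
          have "((\<lambda>\<sigma>. F (s, \<sigma>)) has_real_derivative Ft (s, \<sigma>)) (at \<sigma> within closed_segment t \<tau>)"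
            using Ft[OF segE[OF \<sigma>]] by (rule DERIV_subset) (use segE in auto)
          then show "((\<lambda>\<sigma>. F (s, \<sigma>) - \<sigma> * Ft (s, t)) has_real_derivative Ft (s, \<sigma>) - Ft (s, t))
              (at \<sigma> within closed_segment t \<tau>)"
            by (auto intro!: derivative_eq_intros)
          have "dist (s, \<sigma>) (s, t) \<le> h"
            using \<sigma> by (auto simp: dist_Pair_Pair dist_real_def h_def closed_segment_eq_real_ivl split: if_splits)
          then show "norm (Ft (s, \<sigma>) - Ft (s, t)) \<le> \<epsilon>1"
            using \<delta>G(2)[OF segE[OF \<sigma>] segE, of t] hs(2) by (auto simp: less_imp_le)
        qed auto
        then show ?thesis by (simp add: h_def algebra_simps)
      qed
      have c\<tau>: "c \<le> b \<tau>" and bb: "\<bar>b \<tau> - b t\<bar> \<le> K * h" using c\<sigma>[of \<tau>] bK[of \<tau>] \<tau> by (auto simp: h_def)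
      have near: "\<bar>F (s, \<sigma>) - F (b t, t)\<bar> \<le> \<epsilon>1"
        if "c \<le> s" "s \<le> b \<sigma>" "\<sigma> \<in> {t, \<tau>}" for s \<sigma>
      proof -
        have "\<bar>s - b t\<bar> \<le> K * h" "\<bar>\<sigma> - t\<bar> \<le> h" using that bb h0 K by (auto simp: c_def h_def)
        then have "dist (s, \<sigma>) (b t, t) \<le> K * h + h"
          using dist_triangle_le[of "(s,\<sigma>)" "(b t, \<sigma>)" "(b t, t)" "K * h + h"]
          by (simp add: dist_Pair_Pair dist_real_def)
        also have "\<dots> < \<delta>F" using hs(1) K by (simp add: field_simps)
        finally have "dist (s, \<sigma>) (b t, t) < \<delta>F" .
        then have "\<bar>F (s, \<sigma>) - F (b t, t)\<bar> < \<epsilon>1"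
          using that t \<tau> c bt by (intro \<delta>F(2)) (auto simp: E_iff)
        then show ?thesis by simp
      qed
      have I1: "\<bar>integral {m..c} (\<lambda>s. F (s, \<tau>) - F (s, t) - (\<tau> - t) * Ft (s, t))\<bar> \<le> (\<epsilon>1 * h) * (c - m)"
      proof -
        have "continuous_on {m..c} (\<lambda>s. F (s, \<tau>) - F (s, t) - (\<tau> - t) * Ft (s, t))"
          using t \<tau> c c\<tau> by (intro continuous_intros contF contFt) auto
        from integral_bound[OF c(1) this] mv show ?thesis by simp
      qed
      have I2: "\<bar>integral {c..b \<tau>} (\<lambda>s. F (s, \<tau>) - F (b t, t))\<bar> \<le> \<epsilon>1 * (b \<tau> - c)"
      proof -
        have "continuous_on {c..b \<tau>} (\<lambda>s. F (s, \<tau>) - F (b t, t))"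
          using \<tau> c by (intro continuous_intros contF) auto
        from integral_bound[OF c\<tau> this] near show ?thesis by simp
      qed
      have I3: "\<bar>integral {c..b t} (\<lambda>s. F (s, t) - F (b t, t))\<bar> \<le> \<epsilon>1 * (b t - c)"
      proof -
        have "continuous_on {c..b t} (\<lambda>s. F (s, t) - F (b t, t))"
          using t c by (intro continuous_intros contF) auto
        from integral_bound[OF c(2) this] near show ?thesis by simp
      qed
      have I4: "\<bar>integral {c..b t} (\<lambda>s. Ft (s, t))\<bar> \<le> A * (b t - c)"
        using integral_bound[OF c(2) contFt[OF t c(1) order_refl]] A t c by (auto simp: E_iff)
      have S1: "?G \<tau> = integral {m..c} (\<lambda>s. F (s, \<tau>)) + integral {c..b \<tau>} (\<lambda>s. F (s, \<tau>))"
        using Henstock_Kurzweil_Integration.integral_combine[OF c(1) c\<tau> intF[OF \<tau>]] by simp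
      have S2: "?G t = integral {m..c} (\<lambda>s. F (s, t)) + integral {c..b t} (\<lambda>s. F (s, t))"
        using Henstock_Kurzweil_Integration.integral_combine[OF c(1) c(2) intF[OF t]] by simp
      have S3: "integral {m..b t} (\<lambda>s. Ft (s, t)) = integral {m..c} (\<lambda>s. Ft (s, t)) + integral {c..b t} (\<lambda>s. Ft (s, t))"
        using Henstock_Kurzweil_Integration.integral_combine[OF c(1) c(2) intFt[OF t]] by simp
      have J1: "integral {m..c} (\<lambda>s. F (s, \<tau>) - F (s, t) - (\<tau> - t) * Ft (s, t)) =
          integral {m..c} (\<lambda>s. F (s, \<tau>)) - integral {m..c} (\<lambda>s. F (s, t)) - (\<tau> - t) * integral {m..c} (\<lambda>s. Ft (s, t))"
        using intF[OF \<tau> order_refl c\<tau>] intF[OF t order_refl c(2)]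
          integrable_continuous_real[OF continuous_on_mult_left[OF contFt[OF t order_refl c(2)]], of "\<tau> - t"]
        by (simp add: Henstock_Kurzweil_Integration.integral_diff Henstock_Kurzweil_Integration.integrable_diff)
      have J2: "integral {c..b \<tau>} (\<lambda>s. F (s, \<tau>) - F (b t, t)) = integral {c..b \<tau>} (\<lambda>s. F (s, \<tau>)) - F (b t, t) * (b \<tau> - c)"
        using intF[OF \<tau> c(1) order_refl] c\<tau> by (subst Henstock_Kurzweil_Integration.integral_diff) (auto intro!: integrable_continuous_real)
      have J3: "integral {c..b t} (\<lambda>s. F (s, t) - F (b t, t)) = integral {c..b t} (\<lambda>s. F (s, t)) - F (b t, t) * (b t - c)"
        using intF[OF t c(1) order_refl] c by (subst Henstock_Kurzweil_Integration.integral_diff) (auto intro!: integrable_continuous_real)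
      have e1: "?G \<tau> - ?G t - ?d * (\<tau> - t)
        = integral {m..c} (\<lambda>s. F (s, \<tau>) - F (s, t) - (\<tau> - t) * Ft (s, t))
          + integral {c..b \<tau>} (\<lambda>s. F (s, \<tau>) - F (b t, t))
          - integral {c..b t} (\<lambda>s. F (s, t) - F (b t, t))
          - (\<tau> - t) * integral {c..b t} (\<lambda>s. Ft (s, t))
          + F (b t, t) * (b \<tau> - b t - b' * (\<tau> - t))"
        unfolding S1 S2 S3 J1 J2 J3 by (simp add: algebra_simps)
      have e2: "\<bar>integral {m..c} (\<lambda>s. F (s, \<tau>) - F (s, t) - (\<tau> - t) * Ft (s, t))
          + integral {c..b \<tau>} (\<lambda>s. F (s, \<tau>) - F (b t, t))
          - integral {c..b t} (\<lambda>s. F (s, t) - F (b t, t))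
          - (\<tau> - t) * integral {c..b t} (\<lambda>s. Ft (s, t))
          + F (b t, t) * (b \<tau> - b t - b' * (\<tau> - t))\<bar> \<le> (\<epsilon>1 * h) * (c - m) + \<epsilon>1 * (b \<tau> - c) + \<epsilon>1 * (b t - c) + h * (A * (b t - c)) + \<bar>F (b t, t)\<bar> * (\<epsilon>1 * h)"
      proof -
        have "\<bar>(\<tau> - t) * integral {c..b t} (\<lambda>s. Ft (s, t))\<bar> \<le> h * (A * (b t - c))"
          unfolding abs_mult h_def[symmetric] using I4 h0 by (intro mult_left_mono) auto
        moreover have "\<bar>F (b t, t) * (b \<tau> - b t - b' * (\<tau> - t))\<bar> \<le> \<bar>F (b t, t)\<bar> * (\<epsilon>1 * h)"
        proof -
          have "\<bar>b \<tau> - b t - b' * (\<tau> - t)\<bar> \<le> min \<epsilon>1 1 * h" using \<delta>b(2)[OF \<tau>] hs(3) by (simp add: h_def)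
          also have "\<dots> \<le> \<epsilon>1 * h" using h0 by (intro mult_right_mono) auto
          finally show ?thesis unfolding abs_mult by (intro mult_left_mono) auto
        qed
        ultimately show ?thesis using I1 I2 I3 by linarith
      qed
      have e3: "(\<epsilon>1 * h) * (c - m) + \<epsilon>1 * (b \<tau> - c) + \<epsilon>1 * (b t - c) + h * (A * (b t - c)) + \<bar>F (b t, t)\<bar> * (\<epsilon>1 * h)
          \<le> (\<epsilon>1 * h) * (b t - m) + \<epsilon>1 * (2 * K * h) + \<epsilon>1 * (K * h) + h * \<epsilon>1 + \<bar>F (b t, t)\<bar> * (\<epsilon>1 * h)"
      proof -
        have "(\<epsilon>1 * h) * (c - m) \<le> (\<epsilon>1 * h) * (b t - m)" using \<epsilon>1 h0 c by (intro mult_left_mono) auto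
        moreover have "\<epsilon>1 * (b \<tau> - c) \<le> \<epsilon>1 * (2 * K * h)" using bb \<epsilon>1 by (intro mult_left_mono) (auto simp: c_def)
        moreover have "A * (b t - c) \<le> \<epsilon>1" using hs(5) A_pos K by (auto simp: c_def field_simps)
        then have "h * (A * (b t - c)) \<le> h * \<epsilon>1" using h0 by (intro mult_left_mono) auto
        moreover have "\<epsilon>1 * (b t - c) = \<epsilon>1 * (K * h)" by (simp add: c_def)
        ultimately show ?thesis by linarith
      qed
      have e4: "(\<epsilon>1 * h) * (b t - m) + \<epsilon>1 * (2 * K * h) + \<epsilon>1 * (K * h) + h * \<epsilon>1 + \<bar>F (b t, t)\<bar> * (\<epsilon>1 * h) = \<epsilon>1 * C * h"
        by (simp add: C_def algebra_simps)
      have e5: "\<epsilon>1 * C * h = \<epsilon> * \<bar>\<tau> - t\<bar>" using C by (simp add: \<epsilon>1_def h_def)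
      show ?thesis unfolding e1 using order_trans[OF e2 order_trans[OF e3]] unfolding e4 e5 by simp
    qed
    ultimately show ?thesis by (intro exI[of _ \<delta>]) auto
  qed
  show ?thesis
    unfolding has_field_derivative_def has_derivative_within_alt
    using main by (auto intro: bounded_linear_mult_right)
qed

lemma leibniz_moving_endpoints:
  fixes F Ft :: "real \<times> real \<Rightarrow> real" and l u :: "real \<Rightarrow> real"
  defines "D \<equiv> \<lambda>\<alpha> \<beta>. {(s, \<tau>). \<tau> \<in> {\<alpha>..\<beta>} \<and> l \<tau> \<le> s \<and> s \<le> u \<tau>}"
  assumes t: "t \<in> {\<alpha>..\<beta>}"
    and lu: "continuous_on {\<alpha>..\<beta>} l" "continuous_on {\<alpha>..\<beta>} u"
            "\<And>\<tau>. \<tau> \<in> {\<alpha>..\<beta>} \<Longrightarrow> l \<tau> < m \<and> m < u \<tau>"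
    and l': "(l has_real_derivative l') (at t within {\<alpha>..\<beta>})"
    and u': "(u has_real_derivative u') (at t within {\<alpha>..\<beta>})"
    and F: "continuous_on (D \<alpha> \<beta>) F" "continuous_on (D \<alpha> \<beta>) Ft"
    and Ft: "\<And>s \<tau>. (s, \<tau>) \<in> D \<alpha> \<beta> \<Longrightarrow>
        ((\<lambda>\<tau>. F (s, \<tau>)) has_real_derivative Ft (s, \<tau>)) (at \<tau> within {\<tau>. (s, \<tau>) \<in> D \<alpha> \<beta>})"
  shows "((\<lambda>\<tau>. integral {l \<tau>..u \<tau>} (\<lambda>s. F (s, \<tau>))) has_real_derivative
      integral {l t..u t} (\<lambda>s. Ft (s, t)) + F (u t, t) * u' - F (l t, t) * l') (at t within {\<alpha>..\<beta>})"
proof -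
  have cont: "continuous_on {l \<tau>..u \<tau>} (\<lambda>s. H (s, \<tau>))" if "\<tau> \<in> {\<alpha>..\<beta>}" "continuous_on (D \<alpha> \<beta>) H"
    for \<tau> and H :: "real \<times> real \<Rightarrow> real"
    using that by (auto intro!: continuous_on_compose2[OF that(2)] continuous_intros simp: D_def)
  have split: "integral {l \<tau>..u \<tau>} (\<lambda>s. H (s, \<tau>)) =
      integral {m..u \<tau>} (\<lambda>s. H (s, \<tau>)) + integral {-m..- l \<tau>} (\<lambda>s. H (- s, \<tau>))"
    if "\<tau> \<in> {\<alpha>..\<beta>}" "continuous_on (D \<alpha> \<beta>) H" for \<tau> and H :: "real \<times> real \<Rightarrow> real"
    using Henstock_Kurzweil_Integration.integral_combine[OF _ _ integrable_continuous_real[OF cont[OF that]], of m]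
      lu(3)[OF that(1)] Henstock_Kurzweil_Integration.integral_reflect_real[of m "l \<tau>" "\<lambda>s. H (s, \<tau>)"] by simp
  have U: "((\<lambda>\<tau>. integral {m..u \<tau>} (\<lambda>s. F (s, \<tau>))) has_real_derivative
      integral {m..u t} (\<lambda>s. Ft (s, t)) + F (u t, t) * u') (at t within {\<alpha>..\<beta>})"
  proof (rule leibniz_moving_upper_endpoint[OF t lu(2) _ u'])
    show "m < u \<tau>" if "\<tau> \<in> {\<alpha>..\<beta>}" for \<tau> using lu(3)[OF that] by simp
    have sub: "{(s, \<tau>). \<tau> \<in> {\<alpha>..\<beta>} \<and> m \<le> s \<and> s \<le> u \<tau>} \<subseteq> D \<alpha> \<beta>" using lu(3) by (force simp: D_def)
    then show "continuous_on {(s, \<tau>). \<tau> \<in> {\<alpha>..\<beta>} \<and> m \<le> s \<and> s \<le> u \<tau>} F"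
      "continuous_on {(s, \<tau>). \<tau> \<in> {\<alpha>..\<beta>} \<and> m \<le> s \<and> s \<le> u \<tau>} Ft"
      using F continuous_on_subset by blast+
    fix s \<tau> assume "(s, \<tau>) \<in> {(s, \<tau>). \<tau> \<in> {\<alpha>..\<beta>} \<and> m \<le> s \<and> s \<le> u \<tau>}"
    with sub have "(s, \<tau>) \<in> D \<alpha> \<beta>" by blast
    from Ft[OF this]
    show "((\<lambda>\<tau>. F (s, \<tau>)) has_real_derivative Ft (s, \<tau>))
        (at \<tau> within {\<tau>. (s, \<tau>) \<in> {(s, \<tau>). \<tau> \<in> {\<alpha>..\<beta>} \<and> m \<le> s \<and> s \<le> u \<tau>}})"
      by (rule DERIV_subset) (use sub in auto)
  qed
  have L: "((\<lambda>\<tau>. integral {-m..- l \<tau>} (\<lambda>s. F (- fst (s, \<tau>), snd (s, \<tau>)))) has_real_derivative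
      integral {-m..- l t} (\<lambda>s. Ft (- fst (s, t), snd (s, t))) + F (- fst (- l t, t), snd (- l t, t)) * (- l')) (at t within {\<alpha>..\<beta>})"
  proof (rule leibniz_moving_upper_endpoint[OF t, where b = "\<lambda>\<tau>. - l \<tau>" and m = "- m" and b' = "- l'" and
      F = "\<lambda>p. F (- fst p, snd p)" and Ft = "\<lambda>p. Ft (- fst p, snd p)"])
    show "continuous_on {\<alpha>..\<beta>} (\<lambda>\<tau>. - l \<tau>)" by (intro continuous_intros lu)
    show "((\<lambda>\<tau>. - l \<tau>) has_real_derivative - l') (at t within {\<alpha>..\<beta>})" using l' by (rule DERIV_minus)
    show "- m < - l \<tau>" if "\<tau> \<in> {\<alpha>..\<beta>}" for \<tau> using lu(3)[OF that] by simp
    have sub: "(- s, \<tau>) \<in> D \<alpha> \<beta>" if "(s, \<tau>) \<in> {(s, \<tau>). \<tau> \<in> {\<alpha>..\<beta>} \<and> - m \<le> s \<and> s \<le> - l \<tau>}" for s \<tau>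
      using lu(3)[of \<tau>] that by (force simp: D_def)
    show "continuous_on {(s, \<tau>). \<tau> \<in> {\<alpha>..\<beta>} \<and> - m \<le> s \<and> s \<le> - l \<tau>} (\<lambda>p. F (- fst p, snd p))"
      "continuous_on {(s, \<tau>). \<tau> \<in> {\<alpha>..\<beta>} \<and> - m \<le> s \<and> s \<le> - l \<tau>} (\<lambda>p. Ft (- fst p, snd p))"
      using sub by (auto intro!: continuous_on_compose2[OF F(1)] continuous_on_compose2[OF F(2)] continuous_intros)
    fix s \<tau> assume "(s, \<tau>) \<in> {(s, \<tau>). \<tau> \<in> {\<alpha>..\<beta>} \<and> - m \<le> s \<and> s \<le> - l \<tau>}"
    from Ft[OF sub[OF this]]
    show "((\<lambda>\<tau>. F (- fst (s, \<tau>), snd (s, \<tau>))) has_real_derivative Ft (- fst (s, \<tau>), snd (s, \<tau>)))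
        (at \<tau> within {\<tau>. (s, \<tau>) \<in> {(s, \<tau>). \<tau> \<in> {\<alpha>..\<beta>} \<and> - m \<le> s \<and> s \<le> - l \<tau>}})"
      unfolding fst_conv snd_conv by (rule DERIV_subset) (use sub in auto)
  qed
  have "((\<lambda>\<tau>. integral {m..u \<tau>} (\<lambda>s. F (s, \<tau>)) + integral {-m..- l \<tau>} (\<lambda>s. F (- s, \<tau>))) has_real_derivative
      integral {l t..u t} (\<lambda>s. Ft (s, t)) + F (u t, t) * u' - F (l t, t) * l') (at t within {\<alpha>..\<beta>})"
    using DERIV_add[OF U L] split[OF t F(2)] by (simp add: algebra_simps)
  then show ?thesis
    by (rule has_field_derivative_transform_within[OF _ zero_less_one t]) (simp add: split[OF _ F(1)])
qed

section \<open>Concentration in time and cutoff in arclength\<close>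

lemma set_integral_eq_on_subinterval:
  fixes g :: "real \<Rightarrow> real"
  assumes "continuous_on {l..u} g" "{l..u} \<subseteq> S" "\<And>s. s \<in> S \<Longrightarrow> s \<notin> {l..u} \<Longrightarrow> g s = 0"
  shows "(LINT s:S|lebesgue. g s) = integral {l..u} g"
proof -
  have "(LINT s:S|lebesgue. g s) = (LINT s:{l..u}|lebesgue. g s)"
    unfolding set_lebesgue_integral_def
  proof (rule Bochner_Integration.integral_cong[OF refl])
    fix s show "indicator S s *\<^sub>R g s = indicator {l..u} s *\<^sub>R g s"
      using assms(2,3) by (cases "s \<in> {l..u}") (auto simp: indicator_def)
  qed
  also have "\<dots> = integral {l..u} g"
    using set_lebesgue_integral_eq_integral(2)[OF absolutely_integrable_continuous_real[OF assms(1)]] .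
  finally show ?thesis .
qed

lemma integral_eq_on_subinterval:
  fixes g :: "real \<Rightarrow> real"
  assumes c: "continuous_on {a..b} g" and sub: "{l..u} \<subseteq> {a..b}" and z: "\<And>s. s \<in> {a..b} \<Longrightarrow> s \<notin> {l..u} \<Longrightarrow> g s = 0"
  shows "integral {a..b} g = integral {l..u} g"
  using set_integral_eq_on_subinterval[OF continuous_on_subset[OF c sub] sub z]
    set_integral_eq_on_subinterval[OF c order_refl] by simp

text \<open>
  Integrals against bumps that shrink to \<open>t\<close> determine a continuous function at \<open>t\<close>: if
  \<open>g t \<noteq> 0\<close>, a narrow bump meets only one sign of \<open>g\<close>, and the integral of a nonnegative
  continuous function vanishes only if the function does.
\<close>

lemma bump_concentration:
  fixes g :: "real \<Rightarrow> real"
  assumes e: "e > 0" and c: "continuous_on {t - e..t + e} g"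
    and z: "\<And>\<epsilon>. 0 < \<epsilon> \<Longrightarrow> \<epsilon> < e \<Longrightarrow> integral {t - \<epsilon>..t + \<epsilon>} (\<lambda>\<tau>. bump ((\<tau> - t) / \<epsilon>) * g \<tau>) = 0"
  shows "g t = 0"
proof (rule ccontr)
  assume nz: "g t \<noteq> 0"
  define k where "k = (\<lambda>\<tau>. sgn (g t) * g \<tau>)"
  have kt: "k t > 0" using nz by (simp add: k_def sgn_real_def)
  have ck: "continuous_on {t - e..t + e} k" unfolding k_def by (intro continuous_intros c)
  obtain d where d: "d > 0" "\<And>\<tau>. \<tau> \<in> {t - e..t + e} \<Longrightarrow> \<bar>\<tau> - t\<bar> < d \<Longrightarrow> \<bar>k \<tau> - k t\<bar> < k t"
    using ck kt e unfolding continuous_on_iff dist_real_def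
    by (metis add.commute atLeastAtMost_iff diff_le_eq le_add_same_cancel1 less_imp_le)
  define \<epsilon> where "\<epsilon> = min d e / 2"
  have \<epsilon>: "0 < \<epsilon>" "\<epsilon> < e" "\<epsilon> < d" using d(1) e by (auto simp: \<epsilon>_def)
  let ?h = "\<lambda>\<tau>. bump ((\<tau> - t) / \<epsilon>) * k \<tau>"
  have "integral {t - \<epsilon>..t + \<epsilon>} ?h = sgn (g t) * integral {t - \<epsilon>..t + \<epsilon>} (\<lambda>\<tau>. bump ((\<tau> - t) / \<epsilon>) * g \<tau>)"
    unfolding k_def by (subst Henstock_Kurzweil_Integration.integral_mult_right[symmetric]) (simp add: mult_ac)
  then have i0: "integral {t - \<epsilon>..t + \<epsilon>} ?h = 0" using z[OF \<epsilon>(1,2)] by simp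
  have ch: "continuous_on {t - \<epsilon>..t + \<epsilon>} ?h"
    using \<epsilon> by (intro continuous_intros continuous_on_compose2[OF continuous_bump[of UNIV]] continuous_on_subset[OF ck]) auto
  have "?h \<tau> \<ge> 0" if "\<tau> \<in> {t - \<epsilon>..t + \<epsilon>}" for \<tau>
    using d(2)[of \<tau>] that \<epsilon> bump_bounds by (intro mult_nonneg_nonneg) (auto simp: abs_less_iff)
  then have "integral {t - \<epsilon>..t + \<epsilon>} ?h = 0 \<longleftrightarrow> (\<forall>\<tau>\<in>{t - \<epsilon>..t + \<epsilon>}. ?h \<tau> = 0)"
    by (intro integral_eq_0_iff[OF ch]) (use \<epsilon> in auto)
  with i0 have "\<forall>\<tau>\<in>{t - \<epsilon>..t + \<epsilon>}. ?h \<tau> = 0" by (rule iffD1[rotated])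
  then have "?h t = 0" by (rule bspec) (use \<epsilon> in auto)
  then have "k t = 0" using bump_1[of 0] by simp
  then show False using kt by simp
qed

text \<open>
  A \<open>C\<^sup>1\<close> cutoff in arclength with slope \<open>O(1/R)\<close>; it only multiplies \<open>C\<^sup>1\<close> functions of the
  parameters and never enters a test function.
\<close>

definition cutoff :: "real \<Rightarrow> real \<Rightarrow> real" where
  "cutoff R s = (max 0 (1 - (s / R)\<^sup>2))\<^sup>2"

definition dcutoff :: "real \<Rightarrow> real \<Rightarrow> real" where
  "dcutoff R s = - 4 * s / R\<^sup>2 * max 0 (1 - (s / R)\<^sup>2)"

lemma DERIV_max_power2: "((\<lambda>u::real. (max 0 u)\<^sup>2) has_real_derivative 2 * max 0 x) (at x)"
proof -
  consider "x > 0" | "x < 0" | "x = 0" by linarith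
  then show ?thesis
  proof cases
    case 1
    have d: "((\<lambda>u. u\<^sup>2) has_real_derivative 2 * max 0 x) (at x)"
      using 1 by (auto intro!: derivative_eq_intros)
    have e: "\<forall>\<^sub>F u in nhds x. (max 0 u)\<^sup>2 = u\<^sup>2"
      by (auto intro!: eventually_mono[OF order_tendstoD(1)[OF filterlim_ident 1]])
    show ?thesis using iffD2[OF DERIV_cong_ev[OF refl e refl] d] .
  next
    case 2
    have d: "((\<lambda>u. 0) has_real_derivative 2 * max 0 x) (at x)"
      using 2 by (auto intro!: derivative_eq_intros)
    have e: "\<forall>\<^sub>F u in nhds x. (max 0 u)\<^sup>2 = 0"
      by (auto intro!: eventually_mono[OF order_tendstoD(2)[OF filterlim_ident 2]])
    show ?thesis using iffD2[OF DERIV_cong_ev[OF refl e refl] d] .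
  next
    case 3
    have "((\<lambda>h::real. max 0 h) \<longlongrightarrow> max 0 0) (at 0)" by (intro tendsto_intros)
    moreover have "(\<lambda>h::real. ((max 0 (0 + h))\<^sup>2 - (max 0 0)\<^sup>2) / h) = max 0"
      by (auto simp: fun_eq_iff power2_eq_square max_def)
    ultimately show ?thesis using 3 by (simp add: DERIV_def)
  qed
qed

lemma DERIV_cutoff: assumes "R > 0" shows "(cutoff R has_real_derivative dcutoff R s) (at s)"
  unfolding cutoff_def[abs_def] dcutoff_def
  by (rule DERIV_cong[OF DERIV_chain2[OF DERIV_max_power2, of _ "- 2 * s / R\<^sup>2"]])
    (use assms in \<open>auto intro!: derivative_eq_intros simp: power2_eq_square\<close>)

lemma cutoff_bounds: "0 \<le> cutoff R s" "cutoff R s \<le> 1"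
  by (auto simp: cutoff_def power_le_one)

lemma cutoff_outside: "R > 0 \<Longrightarrow> \<bar>s\<bar> \<ge> R \<Longrightarrow> cutoff R s = 0" "R > 0 \<Longrightarrow> \<bar>s\<bar> \<ge> R \<Longrightarrow> dcutoff R s = 0"
proof -
  assume "R > 0" "\<bar>s\<bar> \<ge> R"
  then have "1 \<le> \<bar>s / R\<bar>\<^sup>2" by (intro one_le_power) (auto simp: abs_divide)
  then have "max 0 (1 - (s / R)\<^sup>2) = 0" by (simp only: power2_abs max_def) auto
  then show "cutoff R s = 0" "dcutoff R s = 0" by (simp_all add: cutoff_def dcutoff_def)
qed

lemma dcutoff_bound: assumes "R > 0" shows "\<bar>dcutoff R s\<bar> \<le> 4 / R"
proof (cases "\<bar>s\<bar> \<ge> R")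
  case True
  then show ?thesis using assms by (simp add: cutoff_outside)
next
  case False
  have "\<bar>dcutoff R s\<bar> = (4 / R) * ((\<bar>s\<bar> / R) * max 0 (1 - (s / R)\<^sup>2))"
    using assms by (simp add: dcutoff_def abs_mult power2_eq_square)
  also have "\<dots> \<le> (4 / R) * (1 * 1)"
    using assms False by (intro mult_left_mono mult_mono) auto
  finally show ?thesis by simp
qed

lemma cutoff_tendsto_1: "((\<lambda>R. cutoff R s) \<longlongrightarrow> 1) at_top"
proof -
  have "((\<lambda>R. (max 0 (1 - (s / R)\<^sup>2))\<^sup>2) \<longlongrightarrow> (max 0 (1 - 0\<^sup>2))\<^sup>2) at_top"
    by (intro tendsto_intros tendsto_divide_0[OF tendsto_const] filterlim_at_top_imp_at_infinity filterlim_ident)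
  then show ?thesis by (simp add: cutoff_def)
qed

lemma continuous_cutoff: "R > 0 \<Longrightarrow> continuous_on S (cutoff R)" "continuous_on S (dcutoff R)"
proof -
  show "R > 0 \<Longrightarrow> continuous_on S (cutoff R)"
    by (meson DERIV_cutoff DERIV_continuous_on has_field_derivative_at_within)
  show "continuous_on S (dcutoff R)" unfolding dcutoff_def divide_inverse by (intro continuous_intros)
qed

section \<open>Arclength and unit speed\<close>

lemma vector_derivative_lipschitz:
  fixes c :: "real \<Rightarrow> 'a::real_normed_vector"
  assumes "convex S" "\<And>s. s \<in> S \<Longrightarrow> (c has_vector_derivative c' s) (at s within S)"
    "\<And>s. s \<in> S \<Longrightarrow> norm (c' s) \<le> B" "x \<in> S" "y \<in> S"
  shows "norm (c x - c y) \<le> B * \<bar>x - y\<bar>"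
proof -
  have "onorm (\<lambda>h. h *\<^sub>R c' s) \<le> B" if "s \<in> S" for s
    using assms(3)[OF that] by (intro onorm_le) (auto intro!: mult_left_mono simp: mult.commute[of B])
  then show ?thesis
    using differentiable_bound[OF assms(1), of c "\<lambda>s h. h *\<^sub>R c' s" B x y] assms
    by (auto simp: has_vector_derivative_def)
qed

lemma curve_length_le:
  assumes "a \<le> b" "B \<ge> 0" "\<And>x y. x \<in> {a..b} \<Longrightarrow> y \<in> {a..b} \<Longrightarrow> dist (c x) (c y) \<le> B * \<bar>x - y\<bar>"
  shows "curve_length c a b \<le> ennreal (B * (b - a))"
  unfolding curve_length_def
proof (rule SUP_least, clarify)
  fix n :: nat and p :: "nat \<Rightarrow> real"
  assume p: "mono p" and ab: "a = p 0" "b = p n"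
  have "(\<Sum>i<n. ennreal (dist (c (p i)) (c (p (Suc i))))) = ennreal (\<Sum>i<n. dist (c (p i)) (c (p (Suc i))))"
    by (rule sum_ennreal) simp
  also have "\<dots> \<le> ennreal (\<Sum>i<n. B * (p (Suc i) - p i))"
  proof (intro ennreal_leI sum_mono)
    fix i assume "i \<in> {..<n}"
    then have "p 0 \<le> p i" "p i \<le> p (Suc i)" "p (Suc i) \<le> p n" using p by (auto intro!: monoD[OF p])
    then show "dist (c (p i)) (c (p (Suc i))) \<le> B * (p (Suc i) - p i)"
      using assms(3)[of "p i" "p (Suc i)"] by (auto simp: ab)
  qed
  also have "(\<Sum>i<n. B * (p (Suc i) - p i)) = B * (p n - p 0)"
    by (simp add: sum_distrib_left[symmetric] sum_lessThan_telescope)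
  finally show "(\<Sum>i<n. ennreal (dist (c (p i)) (c (p (Suc i))))) \<le> ennreal (B * (p n - p 0))" .
qed

lemma dist_le_curve_length: assumes "a \<le> b" shows "ennreal (dist (c a) (c b)) \<le> curve_length c a b"
proof -
  let ?p = "\<lambda>i::nat. if i = 0 then a else b"
  have "mono ?p" using assms by (auto simp: mono_def)
  then have "(\<Sum>i<1::nat. ennreal (dist (c (?p i)) (c (?p (Suc i))))) \<le> curve_length c a b"
    unfolding curve_length_def by (intro SUP_upper2[of "(1, ?p)"]) auto
  then show ?thesis by simp
qed

text \<open>
  Inscribed polygons are never longer than \<open>b - a\<close> since the curve is 1-Lipschitz.  Conversely
  \<open>c'\<close> is uniformly continuous, so each chord of a fine partition is almost as long as its parameter
  interval.
\<close>

lemma curve_length_unit_speed: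
  fixes c :: "real \<Rightarrow> 'a::real_normed_vector"
  assumes ab: "a \<le> b" and c': "\<And>s. s \<in> {a..b} \<Longrightarrow> (c has_vector_derivative c' s) (at s within {a..b})"
    and cont: "continuous_on {a..b} c'" and n1: "\<And>s. s \<in> {a..b} \<Longrightarrow> norm (c' s) = 1"
  shows "curve_length c a b = ennreal (b - a)"
proof -
  have le: "curve_length c a b \<le> ennreal (1 * (b - a))"
    using ab vector_derivative_lipschitz[OF _ c', of 1] n1 by (intro curve_length_le) (auto simp: dist_norm)
  then have "curve_length c a b < top" by (metis ennreal_less_top order_le_less_trans)
  then obtain l where l: "curve_length c a b = ennreal l" "l \<ge> 0" by (metis ennreal_cases not_less_iff_gr_or_eq)
  have "b - a \<le> l"
  proof (rule field_le_mult_one_interval)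
    fix z :: real assume z: "0 < z" "z < 1"
    have "uniformly_continuous_on {a..b} c'" using cont compact_uniformly_continuous by blast
    then obtain \<delta> where \<delta>: "\<delta> > 0" "\<And>x y. x \<in> {a..b} \<Longrightarrow> y \<in> {a..b} \<Longrightarrow> dist x y < \<delta> \<Longrightarrow> dist (c' x) (c' y) < 1 - z"
      using z unfolding uniformly_continuous_on_def by (metis diff_gt_0_iff_gt)
    have low: "z * (y - x) \<le> dist (c x) (c y)" if "x \<in> {a..b}" "y \<in> {a..b}" "x \<le> y" "y - x < \<delta>" for x y
    proof -
      have "norm ((\<lambda>s. c s - s *\<^sub>R c' x) y - (\<lambda>s. c s - s *\<^sub>R c' x) x) \<le> (1 - z) * \<bar>y - x\<bar>"
      proof (rule vector_derivative_lipschitz[of "{x..y}" _ "\<lambda>s. c' s - c' x"])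
        fix s assume s: "s \<in> {x..y}"
        have "(c has_vector_derivative c' s) (at s within {x..y})"
          using c'[of s] s that by (auto intro: has_vector_derivative_within_subset)
        then show "((\<lambda>s. c s - s *\<^sub>R c' x) has_vector_derivative c' s - c' x) (at s within {x..y})"
          by (auto intro!: derivative_eq_intros)
        show "norm (c' s - c' x) \<le> 1 - z"
          using \<delta>(2)[of s x] s that by (auto simp: dist_norm)
      qed (use that in auto)
      then have "norm (c y - c x - (y - x) *\<^sub>R c' x) \<le> (1 - z) * (y - x)"
        using that by (simp add: algebra_simps)
      moreover have "norm ((y - x) *\<^sub>R c' x) = y - x" using n1 that by simp
      ultimately have "y - x - norm (c y - c x) \<le> (1 - z) * (y - x)"
        using norm_triangle_ineq2[of "(y - x) *\<^sub>R c' x" "c y - c x"] norm_minus_commute[of "(y - x) *\<^sub>R c' x" "c y - c x"]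
        by linarith
      then show ?thesis by (simp add: dist_norm norm_minus_commute algebra_simps)
    qed
    obtain n :: nat where n: "(b - a) / \<delta> < n" using reals_Archimedean2 by blast
    have n0: "n > 0 \<or> a = b" using n ab \<delta>(1) by (cases "n = 0") (auto simp: divide_less_0_iff field_simps)
    show "z * (b - a) \<le> l"
    proof (cases "a = b")
      case True then show ?thesis using l by simp
    next
      case False
      then have n0: "n > 0" using n0 by simp
      define p where "p = (\<lambda>i. a + real (min i n) * ((b - a) / n))"
      have p: "mono p" using ab by (auto simp: mono_def p_def intro!: mult_right_mono divide_right_mono)
      have pn: "p 0 = a" "p n = b" using n0 by (auto simp: p_def)
      have "ennreal (z * (b - a)) = ennreal (\<Sum>i<n. z * (p (Suc i) - p i))"
        by (simp add: sum_distrib_left[symmetric] sum_lessThan_telescope pn)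
      also have "\<dots> \<le> ennreal (\<Sum>i<n. dist (c (p i)) (c (p (Suc i))))"
      proof (intro ennreal_leI sum_mono)
        fix i assume i: "i \<in> {..<n}"
        then have "p 0 \<le> p i" "p i \<le> p (Suc i)" "p (Suc i) \<le> p n" using p by (auto intro!: monoD[OF p])
        moreover have "p (Suc i) - p i = (b - a) / n" using i by (simp add: p_def left_diff_distrib[symmetric] min_absorb1 del: times_divide_eq_right)
        moreover have "(b - a) / n < \<delta>" using n n0 \<delta>(1) by (simp add: field_simps)
        ultimately show "z * (p (Suc i) - p i) \<le> dist (c (p i)) (c (p (Suc i)))"
          using low[of "p i" "p (Suc i)"] by (auto simp: pn)
      qed
      also have "\<dots> = (\<Sum>i<n. ennreal (dist (c (p i)) (c (p (Suc i)))))" by (rule sum_ennreal[symmetric]) simp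
      also have "\<dots> \<le> curve_length c a b"
        unfolding curve_length_def using p pn by (intro SUP_upper2[of "(n, p)"]) auto
      finally show ?thesis using l by simp
    qed
  qed
  then have "ennreal (b - a) \<le> curve_length c a b" using l by (simp add: ennreal_leI)
  with le show ?thesis by simp
qed

text \<open>
  A chord is no longer than the arc, so \<open>|c'| \<le> 1\<close>; and if \<open>|c'| < 1\<close> at some point, then by
  continuity the curve is a strict contraction nearby and the arcs there are too short.
\<close>

lemma unit_speed_if_arclength:
  fixes c :: "real \<Rightarrow> 'a::real_normed_vector"
  assumes S: "is_interval S" "s \<in> S" "s' \<in> S" "s \<noteq> s'"
    and len: "\<And>a b. a \<in> S \<Longrightarrow> b \<in> S \<Longrightarrow> a \<le> b \<Longrightarrow> curve_length c a b = ennreal (b - a)"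
    and c': "\<And>s. s \<in> S \<Longrightarrow> (c has_vector_derivative c' s) (at s within S)"
    and cont: "continuous_on S c'"
  shows "norm (c' s) = 1"
proof -
  have "convex S" using S(1) is_interval_convex by blast
  have lip: "dist (c a) (c b) \<le> \<bar>b - a\<bar>" if "a \<in> S" "b \<in> S" for a b
    using dist_le_curve_length[of a b c] dist_le_curve_length[of b a c] len[of a b] len[of b a] that
    by (cases "a \<le> b") (auto simp: dist_commute)
  have ivl: "{a..b} \<subseteq> S" if "a \<in> S" "b \<in> S" for a b
    using S(1) that unfolding is_interval_1 by (meson atLeastAtMost_iff subsetI)
  have near: "\<exists>y\<in>S. y \<noteq> s \<and> \<bar>y - s\<bar> < d" if "d > 0" for d
  proof -
    define r where "r = min (1/2) (d / (2 * \<bar>s' - s\<bar>))"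
    have r: "0 < r" "r < 1" using that S(4) by (auto simp: r_def min_def)
    have "r * \<bar>s' - s\<bar> \<le> d / (2 * \<bar>s' - s\<bar>) * \<bar>s' - s\<bar>" by (intro mult_right_mono) (auto simp: r_def)
    then have "\<bar>r * (s' - s)\<bar> < d" using r S(4) that by (simp add: abs_mult)
    moreover have "(1 - r) *\<^sub>R s + r *\<^sub>R s' \<in> S"
      using \<open>convex S\<close> S r by (intro convexD) auto
    then have "s + r * (s' - s) \<in> S" by (simp add: algebra_simps)
    ultimately show ?thesis using r S(4) by (intro bexI[of _ "s + r * (s' - s)"]) auto
  qed
  have "norm (c' s) \<le> 1 + e" if e: "e > 0" for e
  proof -
    obtain d where d: "d > 0" "\<And>y. y \<in> S \<Longrightarrow> \<bar>y - s\<bar> < d \<Longrightarrow> norm (c y - c s - (y - s) *\<^sub>R c' s) \<le> e * \<bar>y - s\<bar>"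
      using c'[OF S(2), unfolded has_vector_derivative_def has_derivative_within_alt real_norm_def,
          THEN conjunct2, THEN spec, THEN mp, OF e] by auto
    obtain y where y: "y \<in> S" "y \<noteq> s" "\<bar>y - s\<bar> < d" using near[OF d(1)] by blast
    have "norm ((y - s) *\<^sub>R c' s) \<le> norm (c y - c s) + norm (c y - c s - (y - s) *\<^sub>R c' s)"
      using norm_triangle_sub[of "(y - s) *\<^sub>R c' s" "c y - c s"]
        norm_minus_commute[of "(y - s) *\<^sub>R c' s" "c y - c s"] by linarith
    also have "\<dots> \<le> \<bar>y - s\<bar> + e * \<bar>y - s\<bar>"
      using d(2)[OF y(1,3)] lip[OF S(2) y(1)] by (simp add: dist_norm norm_minus_commute)
    finally have "\<bar>y - s\<bar> * norm (c' s) \<le> \<bar>y - s\<bar> * (1 + e)" by (simp add: distrib_left distrib_right mult.commute)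
    then show ?thesis using y(2) by simp
  qed
  then have "norm (c' s) \<le> 1" by (rule field_le_epsilon)
  moreover have "\<not> norm (c' s) < 1"
  proof
    assume *: "norm (c' s) < 1"
    define B where "B = (norm (c' s) + 1) / 2"
    have B: "norm (c' s) < B" "B < 1" "B \<ge> 0" using * by (auto simp: B_def add_nonneg_nonneg)
    have "continuous_on S (\<lambda>x. norm (c' x))" by (intro continuous_intros cont)
    then obtain d where d: "d > 0" "\<And>y. y \<in> S \<Longrightarrow> \<bar>y - s\<bar> < d \<Longrightarrow> \<bar>norm (c' y) - norm (c' s)\<bar> < B - norm (c' s)"
      using S(2) B(1) unfolding continuous_on_iff dist_real_def by (metis diff_gt_0_iff_gt)
    obtain y where y: "y \<in> S" "y \<noteq> s" "\<bar>y - s\<bar> < d" using near[OF d(1)] by blast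
    define a b where "a = min s y" and "b = max s y"
    have ab: "a < b" "a \<in> S" "b \<in> S" using y S(2) by (auto simp: a_def b_def min_def max_def)
    have small: "norm (c' x) \<le> B" if "x \<in> {a..b}" for x
    proof -
      have "x \<in> S" using ivl[OF ab(2,3)] that by blast
      moreover have "\<bar>x - s\<bar> < d" using that y by (auto simp: a_def b_def min_def max_def split: if_splits)
      ultimately show ?thesis using d(2)[of x] by simp
    qed
    have "dist (c x) (c z) \<le> B * \<bar>x - z\<bar>" if "x \<in> {a..b}" "z \<in> {a..b}" for x z
      unfolding dist_norm
    proof (rule vector_derivative_lipschitz[of "{a..b}" c c'])
      show "(c has_vector_derivative c' x) (at x within {a..b})" if "x \<in> {a..b}" for x
        using ivl[OF ab(2,3)] that by (intro has_vector_derivative_within_subset[OF c']) auto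
    qed (use that small in auto)
    then have "curve_length c a b \<le> ennreal (B * (b - a))" using ab B by (intro curve_length_le) auto
    then have "b - a \<le> B * (b - a)" using len[OF ab(2,3)] ab B by (simp add: ennreal_le_iff)
    then show False using B(2) ab by simp
  qed
  ultimately show ?thesis by simp
qed

section \<open>First derivatives within plane regions and of test functions\<close>

lemma Basis_plane: "(Basis :: (real \<times> real) set) = {(1, 0), (0, 1)}"
  by (auto simp: Basis_prod_def)

lemma Ckb_on_1D:
  fixes f :: "real \<times> real \<Rightarrow> 'b::real_normed_vector"
  assumes "Ckb_on 1 X f"
  shows "continuous_on X f" "bounded (f ` X)"
    "continuous_on X (pd_s X f)" "bounded (pd_s X f ` X)"
    "continuous_on X (pd_t X f)" "bounded (pd_t X f ` X)"
    "f differentiable_on X"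
  using assms by (auto simp: Basis_plane pd_s_def[abs_def] pd_t_def[abs_def])

text \<open>
  Derivatives within \<open>X\<close> need not be unique at boundary points; the chosen one is still a
  derivative along every path in \<open>X\<close>, which is how \<open>pd_s\<close> and \<open>pd_t\<close> enter below.
\<close>

lemma Ckb_on_1_has_derivative:
  fixes f :: "real \<times> real \<Rightarrow> 'b::real_normed_vector"
  assumes "Ckb_on 1 X f" "p \<in> X"
  shows "(f has_derivative (\<lambda>h. fst h *\<^sub>R pd_s X f p + snd h *\<^sub>R pd_t X f p)) (at p within X)"
proof -
  have D: "(f has_derivative frechet_derivative f (at p within X)) (at p within X)"
    using Ckb_on_1D(7)[OF assms(1)] assms(2) frechet_derivative_works differentiable_on_def by blast
  then interpret bounded_linear "frechet_derivative f (at p within X)" by (rule has_derivative_bounded_linear)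
  have "frechet_derivative f (at p within X) h = fst h *\<^sub>R pd_s X f p + snd h *\<^sub>R pd_t X f p" for h
  proof -
    have "frechet_derivative f (at p within X) (fst h *\<^sub>R (1, 0) + snd h *\<^sub>R (0, 1)) = fst h *\<^sub>R pd_s X f p + snd h *\<^sub>R pd_t X f p"
      unfolding add scale pd_s_def pd_t_def ..
    then show ?thesis by (cases h) simp
  qed
  then have "frechet_derivative f (at p within X) = (\<lambda>h. fst h *\<^sub>R pd_s X f p + snd h *\<^sub>R pd_t X f p)" by (rule ext)
  with D show ?thesis by simp
qed

lemma Ckb_on_1_has_vector_derivative:
  fixes f :: "real \<times> real \<Rightarrow> 'b::real_normed_vector"
  assumes "Ckb_on 1 X f" "(s, t) \<in> X"
  shows "((\<lambda>\<sigma>. f (\<sigma>, t)) has_vector_derivative pd_s X f (s, t)) (at s within {\<sigma>. (\<sigma>, t) \<in> X})"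
    and "((\<lambda>\<tau>. f (s, \<tau>)) has_vector_derivative pd_t X f (s, t)) (at t within {\<tau>. (s, \<tau>) \<in> X})"
proof -
  have D: "(f has_derivative (\<lambda>h. fst h *\<^sub>R pd_s X f (s, t) + snd h *\<^sub>R pd_t X f (s, t))) (at (s, t) within X)"
    by (rule Ckb_on_1_has_derivative[OF assms])
  have "((\<lambda>\<sigma>. (\<sigma>, t)) has_derivative (\<lambda>h. (h, 0))) (at s within {\<sigma>. (\<sigma>, t) \<in> X})"
    by (auto intro!: derivative_eq_intros)
  from has_derivative_in_compose[OF this has_derivative_subset[OF D]]
  show "((\<lambda>\<sigma>. f (\<sigma>, t)) has_vector_derivative pd_s X f (s, t)) (at s within {\<sigma>. (\<sigma>, t) \<in> X})"
    by (auto simp: has_vector_derivative_def)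
  have "((\<lambda>\<tau>. (s, \<tau>)) has_derivative (\<lambda>h. (0, h))) (at t within {\<tau>. (s, \<tau>) \<in> X})"
    by (auto intro!: derivative_eq_intros)
  from has_derivative_in_compose[OF this has_derivative_subset[OF D]]
  show "((\<lambda>\<tau>. f (s, \<tau>)) has_vector_derivative pd_t X f (s, t)) (at t within {\<tau>. (s, \<tau>) \<in> X})"
    by (auto simp: has_vector_derivative_def)
qed

lemma has_derivative_test:
  assumes "Ck 1 \<phi>"
  shows "(\<phi> has_derivative (\<lambda>h. space_grad \<phi> x t \<bullet> fst h + time_deriv \<phi> x t * snd h)) (at (x, t))"
proof -
  have "\<phi> differentiable (at (x, t))" using assms by (simp add: differentiable_on_def)
  then have D: "(\<phi> has_derivative frechet_derivative \<phi> (at (x, t))) (at (x, t))"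
    using frechet_derivative_works by blast
  then interpret bounded_linear "frechet_derivative \<phi> (at (x, t))" by (rule has_derivative_bounded_linear)
  have "frechet_derivative \<phi> (at (x, t)) h = space_grad \<phi> x t \<bullet> fst h + time_deriv \<phi> x t * snd h" for h
  proof -
    have e: "fst h = fst h $ 1 *\<^sub>R axis 1 1 + fst h $ 2 *\<^sub>R axis 2 1"
      by (simp add: vec_eq_iff forall_2 axis_def)
    have "h = fst h $ 1 *\<^sub>R (axis 1 1, 0) + fst h $ 2 *\<^sub>R (axis 2 1, 0) + snd h *\<^sub>R (0, 1)"
      using e by (cases h) simp
    then have "frechet_derivative \<phi> (at (x, t)) h = frechet_derivative \<phi> (at (x, t))
        (fst h $ 1 *\<^sub>R (axis 1 1, 0) + fst h $ 2 *\<^sub>R (axis 2 1, 0) + snd h *\<^sub>R (0, 1))" by simp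
    also have "\<dots> = space_grad \<phi> x t \<bullet> fst h + time_deriv \<phi> x t * snd h"
      unfolding add scale by (simp add: space_grad_def time_deriv_def inner_vec_def sum_2 algebra_simps)
    finally show ?thesis .
  qed
  then have "frechet_derivative \<phi> (at (x, t)) = (\<lambda>h. space_grad \<phi> x t \<bullet> fst h + time_deriv \<phi> x t * snd h)" by (rule ext)
  with D show ?thesis by simp
qed

lemma test_derivatives_continuous:
  assumes "Ck 1 \<phi>"
  shows "continuous_on UNIV (\<lambda>p. space_grad \<phi> (fst p) (snd p))"
    "continuous_on UNIV (\<lambda>p. time_deriv \<phi> (fst p) (snd p))" "continuous_on UNIV \<phi>"
proof -
  have B: "continuous_on UNIV (\<lambda>p. frechet_derivative \<phi> (at p) v)" if "v \<in> Basis" for v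
    using assms that by simp
  have "(axis i 1, 0) \<in> (Basis :: ((real^2) \<times> real) set)" "(0, 1) \<in> (Basis :: ((real^2) \<times> real) set)" for i
    by (auto simp: Basis_prod_def axis_in_Basis_iff)
  with B show "continuous_on UNIV (\<lambda>p. space_grad \<phi> (fst p) (snd p))"
    "continuous_on UNIV (\<lambda>p. time_deriv \<phi> (fst p) (snd p))"
    by (auto simp: space_grad_def time_deriv_def intro!: continuous_on_vec_lambda)
  show "continuous_on UNIV \<phi>"
    using assms by (auto intro: differentiable_imp_continuous_on)
qed

lemma test_function_bounds:
  assumes "test_function T \<phi>"
  obtains B where "B \<ge> 0" "\<And>x t. \<bar>\<phi> (x, t)\<bar> \<le> B" "\<And>x t. norm (space_grad \<phi> x t) \<le> B" "\<And>x t. \<bar>time_deriv \<phi> x t\<bar> \<le> B"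
proof -
  obtain C where C: "compact C" "\<And>p. p \<notin> C \<Longrightarrow> \<phi> p = 0" and k: "Ck 1 \<phi>"
    using assms by (auto simp: test_function_def simp del: Ck.simps One_nat_def)
  have bd: "\<exists>B. \<forall>p\<in>C. norm (g p) \<le> B" if "continuous_on UNIV g" for g :: "(real^2) \<times> real \<Rightarrow> 'c::real_normed_vector"
    using compact_imp_bounded[OF compact_continuous_image[OF continuous_on_subset[OF that] C(1)]]
    by (auto simp: bounded_iff)
  obtain B1 where B1: "\<forall>p\<in>C. norm (space_grad \<phi> (fst p) (snd p)) \<le> B1" using bd test_derivatives_continuous[OF k] by blast
  obtain B2 where B2: "\<forall>p\<in>C. norm (time_deriv \<phi> (fst p) (snd p)) \<le> B2" using bd test_derivatives_continuous[OF k] by blast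
  obtain B3 where B3: "\<forall>p\<in>C. norm (\<phi> p) \<le> B3" using bd test_derivatives_continuous[OF k] by blast
  have out: "frechet_derivative \<phi> (at p) = (\<lambda>_. 0)" if "p \<notin> C" for p
  proof -
    have "(\<phi> has_derivative (\<lambda>_. 0)) (at p)"
      by (rule has_derivative_transform_within_open[OF has_derivative_const[of 0], where s = "- C"])
        (use C that compact_imp_closed in \<open>auto simp: open_Compl\<close>)
    then show ?thesis using frechet_derivative_at by metis
  qed
  define B where "B = max 0 (max B1 (max B2 B3))"
  have sg0: "space_grad \<phi> x t = 0" "time_deriv \<phi> x t = 0" if "(x, t) \<notin> C" for x t
    using out[OF that] by (simp_all add: space_grad_def time_deriv_def vec_eq_iff)
  show ?thesis
  proof (rule that[of B])
    show "\<bar>\<phi> (x, t)\<bar> \<le> B" for x t using C(2)[of "(x, t)"] B3 by (cases "(x, t) \<in> C") (force simp: B_def)+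
    show "norm (space_grad \<phi> x t) \<le> B" for x t using sg0[of x t] B1 by (cases "(x, t) \<in> C") (force simp: B_def)+
    show "\<bar>time_deriv \<phi> x t\<bar> \<le> B" for x t using sg0[of x t] B2 by (cases "(x, t) \<in> C") (force simp: B_def)+
  qed (simp add: B_def)
qed

text \<open>
  The support is compact and stays away from time \<open>T\<close>, so all time integrals end at some
  \<open>T' < T\<close> and nothing is required of the sheet as \<open>t\<close> tends to \<open>T\<close>.
\<close>

lemma test_function_vanishes_late:
  assumes "test_function T \<phi>" "T > 0"
  obtains T' where "0 < T'" "T' < T" "\<And>x t. t \<ge> T' \<Longrightarrow> \<phi> (x, t) = 0"
    "\<And>x t. t \<ge> T' \<Longrightarrow> space_grad \<phi> x t = 0" "\<And>x t. t \<ge> T' \<Longrightarrow> time_deriv \<phi> x t = 0"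
proof -
  obtain C where C: "compact C" "C \<subseteq> UNIV \<times> {..<T}" "\<And>p. p \<notin> C \<Longrightarrow> \<phi> p = 0"
    using assms by (auto simp: test_function_def)
  have "compact (insert 0 (snd ` C))" using C(1)
    by (intro compact_insert compact_continuous_image continuous_intros)
  then obtain m where m: "m \<in> insert 0 (snd ` C)" "\<And>u. u \<in> insert 0 (snd ` C) \<Longrightarrow> u \<le> m"
    using compact_attains_sup[of "insert 0 (snd ` C)"] by auto
  have mT: "0 \<le> m" "m < T" using m C(2) assms(2) by auto
  define T' where "T' = (m + T) / 2"
  have T': "m < T'" "T' < T" using mT by (auto simp: T'_def)
  have z: "\<phi> (x, t) = 0" if "t > m" for x t
    using C(3)[of "(x, t)"] m(2)[of t] that by force
  have out: "frechet_derivative \<phi> (at (x, t)) = (\<lambda>_. 0)" if "t > m" for x t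
  proof -
    have "(\<phi> has_derivative (\<lambda>_. 0)) (at (x, t))"
      by (rule has_derivative_transform_within_open[OF has_derivative_const[of 0], where s = "UNIV \<times> {m<..}"])
        (use z that in \<open>auto intro!: open_Times\<close>)
    then show ?thesis using frechet_derivative_at by metis
  qed
  show ?thesis
    by (rule that[of T']) (use T' mT z out in \<open>auto simp: space_grad_def time_deriv_def vec_eq_iff\<close>)
qed

section \<open>The parameter domain\<close>

lemma closed_Collect_le_on:
  fixes f g :: "'a::metric_space \<Rightarrow> 'b::linorder_topology"
  assumes "continuous_on S f" "continuous_on S g" "closed S"
  shows "closed {x \<in> S. f x \<le> g x}"
  unfolding closed_sequential_limits
proof (intro allI impI, elim conjE)
  fix x l assume x: "\<forall>n. x n \<in> {x \<in> S. f x \<le> g x}" "x \<longlonglongrightarrow> l"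
  then have "l \<in> S" using assms(3) unfolding closed_sequential_limits by blast
  moreover have "(\<lambda>n. f (x n)) \<longlonglongrightarrow> f l" "(\<lambda>n. g (x n)) \<longlonglongrightarrow> g l"
    using x(1) by (auto intro!: continuous_on_tendsto_compose[OF assms(1) x(2) \<open>l \<in> S\<close>]
        continuous_on_tendsto_compose[OF assms(2) x(2) \<open>l \<in> S\<close>])
  then have "f l \<le> g l" using x(1) by (intro LIMSEQ_le) auto
  ultimately show "l \<in> {x \<in> S. f x \<le> g x}" by simp
qed

text \<open>
  The endpoints are continuous into the extended reals.  This makes \<open>\<Omega>\<close> relatively closed and
  stabilizes its interior (\<open>interior_stable\<close>), although an endpoint may be infinite at some times
  and finite at others.
\<close>

locale sheet =
  fixes T :: real and s0 s1 :: "real \<Rightarrow> ereal"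
  assumes T_pos: "T > 0"
    and ordered: "t \<in> {0..<T} \<Longrightarrow> s0 t < s1 t"
    and s0_diff: "endpoint_differentiable T s0"
    and s1_diff: "endpoint_differentiable T s1"
begin

abbreviation "\<Omega> \<equiv> sheet_domain T s0 s1"
abbreviation "I t \<equiv> slice s0 s1 t"

lemma mem_domain: "(s, t) \<in> \<Omega> \<longleftrightarrow> t \<in> {0..<T} \<and> s0 t \<le> ereal s \<and> ereal s \<le> s1 t"
  by (auto simp: sheet_domain_def slice_def)

lemma mem_slice: "s \<in> I t \<longleftrightarrow> s0 t \<le> ereal s \<and> ereal s \<le> s1 t"
  by (auto simp: slice_def)

lemma s0_continuous: "continuous_on {0..<T} s0" and s1_continuous: "continuous_on {0..<T} s1"
  using s0_diff s1_diff by (auto simp: endpoint_differentiable_def)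

lemma slice_eq: "t \<in> {0..<T} \<Longrightarrow> {s. (s, t) \<in> \<Omega>} = I t"
  by (auto simp: mem_domain mem_slice)

lemma closed_slice: "closed (I t)"
  unfolding slice_def by (intro closed_Collect_conj closed_Collect_le continuous_intros)

lemma is_interval_slice: "is_interval (I t)"
  unfolding is_interval_1 by (auto simp: mem_slice) (meson ereal_less_eq(3) order_trans)+

lemma slice_ivl: "a \<in> I t \<Longrightarrow> b \<in> I t \<Longrightarrow> {a..b} \<subseteq> I t"
  using is_interval_slice[of t] unfolding is_interval_1 by (meson atLeastAtMost_iff subsetI)

lemma slice_borel: "I t \<in> sets borel" "I t \<in> sets lebesgue"
  using closed_slice by auto

lemma interior_point: "t \<in> {0..<T} \<Longrightarrow> \<exists>s. s0 t < ereal s \<and> ereal s < s1 t"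
  using ordered ereal_dense2 by blast

lemma two_points: "t \<in> {0..<T} \<Longrightarrow> s \<in> I t \<Longrightarrow> \<exists>s'\<in>I t. s' \<noteq> s"
proof -
  assume t: "t \<in> {0..<T}"
  obtain x where x: "s0 t < ereal x" "ereal x < s1 t" using interior_point[OF t] by blast
  obtain y where y: "ereal x < ereal y" "ereal y < s1 t" using ereal_dense2[OF x(2)] by blast
  have "x \<in> I t" "y \<in> I t" "x \<noteq> y" using x y by (auto simp: mem_slice less_imp_le order_trans[OF less_imp_le[OF x(1)]])
  then show ?thesis by metis
qed

lemma closed_domain_part: "{\<alpha>..\<beta>} \<subseteq> {0..<T} \<Longrightarrow> closed {p \<in> \<Omega>. snd p \<in> {\<alpha>..\<beta>}}"
proof -
  assume ab: "{\<alpha>..\<beta>} \<subseteq> {0..<T}"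
  have c: "closed ((UNIV :: real set) \<times> {\<alpha>..\<beta>})" by (intro closed_Times) auto
  have e: "continuous_on ((UNIV :: real set) \<times> {\<alpha>..\<beta>}) (\<lambda>p. ereal (fst p))" by (intro continuous_intros)
  have 0: "continuous_on ((UNIV :: real set) \<times> {\<alpha>..\<beta>}) (\<lambda>p. s0 (snd p))"
    and 1: "continuous_on ((UNIV :: real set) \<times> {\<alpha>..\<beta>}) (\<lambda>p. s1 (snd p))"
    using ab by (auto intro!: continuous_on_compose2[OF s0_continuous] continuous_on_compose2[OF s1_continuous] continuous_intros)
  have "closed ({p \<in> UNIV \<times> {\<alpha>..\<beta>}. s0 (snd p) \<le> ereal (fst p)} \<inter> {p \<in> UNIV \<times> {\<alpha>..\<beta>}. ereal (fst p) \<le> s1 (snd p)})"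
    by (intro closed_Int closed_Collect_le_on 0 1 e c)
  also have "({p \<in> UNIV \<times> {\<alpha>..\<beta>}. s0 (snd p) \<le> ereal (fst p)} \<inter> {p \<in> UNIV \<times> {\<alpha>..\<beta>}. ereal (fst p) \<le> s1 (snd p)})
     = {p \<in> \<Omega>. snd p \<in> {\<alpha>..\<beta>}}"
    using ab by (auto simp: mem_domain)
  finally show ?thesis .
qed

lemma compact_domain_part:
  assumes "{\<alpha>..\<beta>} \<subseteq> {0..<T}"
  shows "compact {p \<in> \<Omega>. snd p \<in> {\<alpha>..\<beta>} \<and> \<bar>fst p\<bar> \<le> R}"
proof -
  have "compact ({-R..R} \<times> {\<alpha>..\<beta>} \<inter> {p \<in> \<Omega>. snd p \<in> {\<alpha>..\<beta>}})"
    by (intro compact_Int_closed compact_Times closed_domain_part[OF assms]) auto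
  also have "{-R..R} \<times> {\<alpha>..\<beta>} \<inter> {p \<in> \<Omega>. snd p \<in> {\<alpha>..\<beta>}} = {p \<in> \<Omega>. snd p \<in> {\<alpha>..\<beta>} \<and> \<bar>fst p\<bar> \<le> R}"
    by auto
  finally show ?thesis .
qed

lemma domain_borel: "\<Omega> \<in> sets borel"
proof -
  have eq: "\<Omega> = (\<Union>n. {p \<in> \<Omega>. snd p \<in> {0..T - 1 / real (Suc n)}})"
  proof (intro equalityI subsetI)
    fix p assume p: "p \<in> \<Omega>"
    then have "0 \<le> snd p" "snd p < T" by (cases p, auto simp: mem_domain)+
    then obtain n where "inverse (real (Suc n)) < T - snd p" using reals_Archimedean[of "T - snd p"] by auto
    then show "p \<in> (\<Union>n. {p \<in> \<Omega>. snd p \<in> {0..T - 1 / real (Suc n)}})"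
      using p \<open>0 \<le> snd p\<close> by (auto simp: inverse_eq_divide intro!: exI[of _ n])
  qed auto
  have "{0..T - 1 / real (Suc n)} \<subseteq> {0..<T}" for n
  proof
    fix x assume "x \<in> {0..T - 1 / real (Suc n)}"
    moreover have "1 / real (Suc n) > 0" by simp
    ultimately show "x \<in> {0..<T}" unfolding atLeastAtMost_iff atLeastLessThan_iff by linarith
  qed
  then have "closed {p \<in> \<Omega>. snd p \<in> {0..T - 1 / real (Suc n)}}" for n
    using closed_domain_part by blast
  then show ?thesis by (subst eq) (intro sets.countable_UN, auto)
qed

lemma interior_stable:
  assumes "t \<in> {0..<T}" "s0 t < ereal s" "ereal s < s1 t"
  obtains \<delta> where "\<delta> > 0"
    "\<And>\<sigma> \<tau>. \<tau> \<in> {0..<T} \<Longrightarrow> \<bar>\<tau> - t\<bar> < \<delta> \<Longrightarrow> \<bar>\<sigma> - s\<bar> < \<delta> \<Longrightarrow> s0 \<tau> < ereal \<sigma> \<and> ereal \<sigma> < s1 \<tau>"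
proof -
  obtain l where l: "s0 t < ereal l" "l < s" using ereal_dense2[OF assms(2)] by auto
  obtain u where u: "s < u" "ereal u < s1 t" using ereal_dense2[OF assms(3)] by auto
  have t: "(s0 \<longlongrightarrow> s0 t) (at t within {0..<T})" "(s1 \<longlongrightarrow> s1 t) (at t within {0..<T})"
    using s0_continuous s1_continuous assms(1) by (auto simp: continuous_on_def)
  have "\<forall>\<^sub>F \<tau> in at t within {0..<T}. s0 \<tau> < ereal l \<and> ereal u < s1 \<tau>"
    using order_tendstoD(2)[OF t(1) l(1)] order_tendstoD(1)[OF t(2) u(2)] by (rule eventually_conj)
  then obtain d where d: "d > 0" "\<And>\<tau>. \<tau> \<in> {0..<T} \<Longrightarrow> \<tau> \<noteq> t \<Longrightarrow> dist \<tau> t < d \<Longrightarrow> s0 \<tau> < ereal l \<and> ereal u < s1 \<tau>"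
    unfolding eventually_at by blast
  define \<delta> where "\<delta> = Min {d, s - l, u - s}"
  have "\<delta> > 0" using d l u by (auto simp: \<delta>_def)
  moreover have "s0 \<tau> < ereal \<sigma> \<and> ereal \<sigma> < s1 \<tau>"
    if "\<tau> \<in> {0..<T}" "\<bar>\<tau> - t\<bar> < \<delta>" "\<bar>\<sigma> - s\<bar> < \<delta>" for \<sigma> \<tau>
  proof -
    have "s0 \<tau> < ereal l \<and> ereal u < s1 \<tau>"
      using d(2)[of \<tau>] l u that by (cases "\<tau> = t") (auto simp: \<delta>_def dist_real_def)
    moreover have "ereal l < ereal \<sigma>" "ereal \<sigma> < ereal u" using that by (auto simp: \<delta>_def)
    ultimately show ?thesis by (meson less_trans)
  qed
  ultimately show thesis using that by blast
qed

lemma slice_measurable: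
  fixes g :: "real \<times> real \<Rightarrow> 'b::{banach, second_countable_topology}"
  assumes "continuous_on \<Omega> g" "t \<in> {0..<T}"
  shows "(\<lambda>s. indicator (I t) s *\<^sub>R g (s, t)) \<in> borel_measurable lebesgue"
    and "continuous_on (I t) (\<lambda>s. g (s, t))"
proof -
  show "continuous_on (I t) (\<lambda>s. g (s, t))"
    using assms(2) by (auto intro!: continuous_on_compose2[OF assms(1)] continuous_intros simp: mem_domain mem_slice)
  then have "(\<lambda>s. indicator (I t) s *\<^sub>R g (s, t)) \<in> borel_measurable borel"
    using borel_measurable_continuous_on_indicator slice_borel by blast
  then show "(\<lambda>s. indicator (I t) s *\<^sub>R g (s, t)) \<in> borel_measurable lebesgue"
    by (intro measurable_completion) simp
qed

lemma slice_integrable_bound: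
  fixes g :: "real \<times> real \<Rightarrow> 'b::{banach, second_countable_topology}" and k :: "real \<times> real \<Rightarrow> real"
  assumes "continuous_on \<Omega> g" "t \<in> {0..<T}" "set_integrable lebesgue (I t) (\<lambda>s. k (s, t))"
    "\<And>s. s \<in> I t \<Longrightarrow> norm (g (s, t)) \<le> C * \<bar>k (s, t)\<bar>"
  shows "set_integrable lebesgue (I t) (\<lambda>s. g (s, t))"
    "norm (LINT s:I t|lebesgue. g (s, t)) \<le> C * (LINT s:I t|lebesgue. \<bar>k (s, t)\<bar>)"
    "(LINT s:I t|lebesgue. norm (g (s, t))) \<le> C * (LINT s:I t|lebesgue. \<bar>k (s, t)\<bar>)"
proof -
  have k: "set_integrable lebesgue (I t) (\<lambda>s. C * \<bar>k (s, t)\<bar>)"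
    using assms(3) by (intro set_integrable_mult_right set_integrable_abs)
  show g: "set_integrable lebesgue (I t) (\<lambda>s. g (s, t))"
    unfolding set_integrable_def
    by (rule Bochner_Integration.integrable_bound[OF k[unfolded set_integrable_def] slice_measurable(1)[OF assms(1,2)]])
      (use assms(4) in \<open>auto simp: indicator_def intro!: AE_I2 order_trans[OF _ abs_ge_self]\<close>)
  then have n: "set_integrable lebesgue (I t) (\<lambda>s. norm (g (s, t)))" by (rule set_integrable_norm)
  have "(LINT s:I t|lebesgue. norm (g (s, t))) \<le> (LINT s:I t|lebesgue. C * \<bar>k (s, t)\<bar>)"
    using n k assms(4) by (intro set_integral_mono) auto
  then show 1: "(LINT s:I t|lebesgue. norm (g (s, t))) \<le> C * (LINT s:I t|lebesgue. \<bar>k (s, t)\<bar>)" by simp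
  have "norm (LINT s:I t|lebesgue. g (s, t)) \<le> (LINT s:I t|lebesgue. norm (g (s, t)))"
    using set_integral_norm_bound[OF g] .
  with 1 show "norm (LINT s:I t|lebesgue. g (s, t)) \<le> C * (LINT s:I t|lebesgue. \<bar>k (s, t)\<bar>)" by linarith
qed

text \<open>
  The space \<open>L\<^sup>\<infinity>((0,T); L\<^sup>1(ds))\<close> controls almost every time only.  For continuous \<open>\<gamma>\<close> every
  time, including \<open>t = 0\<close>, is a limit of good times from the right, and Fatou's lemma transfers the
  bound: at interior parameters the integrands converge, and a slice has at most two other points.
\<close>

lemma slice_L1_bound:
  fixes \<gamma> :: "real \<times> real \<Rightarrow> real"
  assumes c: "continuous_on \<Omega> \<gamma>" and L: "Linf_L1 T s0 s1 \<gamma>"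
  obtains M where "M \<ge> 0"
    "\<And>t. t \<in> {0..<T} \<Longrightarrow> set_integrable lebesgue (I t) (\<lambda>s. \<gamma> (s, t))"
    "\<And>t. t \<in> {0..<T} \<Longrightarrow> (LINT s:I t|lebesgue. \<bar>\<gamma> (s, t)\<bar>) \<le> M"
proof -
  define good where "good M t \<longleftrightarrow> set_integrable lebesgue (I t) (\<lambda>s. \<gamma> (s, t)) \<and> (LINT s:I t|lebesgue. norm (\<gamma> (s, t))) \<le> M" for M t
  obtain M0 where M0: "AE t in lborel. 0 < t \<and> t < T \<longrightarrow> good M0 t"
    using L by (auto simp: Linf_L1_def good_def)
  define M where "M = max M0 0"
  have M: "AE t in lborel. 0 < t \<and> t < T \<longrightarrow> good M t"
    using M0 by eventually_elim (auto simp: good_def M_def)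
  have dense: "\<exists>t'. t < t' \<and> t' < t + e \<and> t' < T \<and> good M t'" if t: "t \<in> {0..<T}" and e: "e > 0" for t e
  proof (rule ccontr)
    assume no: "\<not> ?thesis"
    define b where "b = min (t + e) T"
    have "AE x in lborel. x \<notin> {t<..<b}"
      using M by eventually_elim (use no t in \<open>auto simp: b_def\<close>)
    then have "emeasure lborel {t<..<b} = 0" by (subst (asm) AE_iff_measurable[of "{t<..<b}"]) auto
    then show False using t e by (auto simp: b_def min_def split: if_splits)
  qed
  have bound: "(\<integral>\<^sup>+ s. ennreal (norm (indicator (I t) s *\<^sub>R \<gamma> (s, t))) \<partial>lebesgue) \<le> ennreal M" if t: "t \<in> {0..<T}" for t
  proof -
    have "\<exists>t'. t < t' \<and> t' < t + inverse (real (Suc n)) \<and> t' < T \<and> good M t'" for n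
      using dense[OF t] by simp
    then obtain r where r: "\<And>n. t < r n \<and> r n < t + inverse (real (Suc n)) \<and> r n < T \<and> good M (r n)" by metis
    have rT: "r n \<in> {0..<T}" for n using r[of n] t by auto
    have rlim: "r \<longlonglongrightarrow> t"
    proof (rule tendsto_sandwich[of "\<lambda>_. t" _ _ "\<lambda>n. t + inverse (real (Suc n))"])
      show "(\<lambda>n. t + inverse (real (Suc n))) \<longlonglongrightarrow> t"
        using tendsto_add[OF tendsto_const LIMSEQ_inverse_real_of_nat, of t] by simp
    qed (use r in \<open>auto intro!: always_eventually less_imp_le\<close>)
    define v where "v = (\<lambda>n s. norm (indicator (I (r n)) s *\<^sub>R \<gamma> (s, r n)))"
    have vm: "(\<lambda>s. ennreal (v n s)) \<in> borel_measurable lebesgue" for n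
      unfolding v_def using slice_measurable(1)[OF c rT] by measurable
    have vM: "(\<integral>\<^sup>+ s. ennreal (v n s) \<partial>lebesgue) \<le> ennreal M" for n
    proof -
      have "integrable lebesgue (\<lambda>s. indicator (I (r n)) s *\<^sub>R \<gamma> (s, r n))"
        using r[of n] by (simp add: good_def set_integrable_def)
      then have "(\<integral>\<^sup>+ s. ennreal (v n s) \<partial>lebesgue) = ennreal (\<integral> s. v n s \<partial>lebesgue)"
        unfolding v_def by (intro nn_integral_eq_integral integrable_norm) auto
      also have "(\<integral> s. v n s \<partial>lebesgue) = (LINT s:I (r n)|lebesgue. norm (\<gamma> (s, r n)))"
        unfolding set_lebesgue_integral_def v_def by (intro Bochner_Integration.integral_cong) (auto simp: abs_mult)
      finally show ?thesis using r[of n] by (simp add: good_def ennreal_leI)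
    qed
    have conv: "(\<lambda>n. v n s) \<longlonglongrightarrow> norm (\<gamma> (s, t))" if s: "s0 t < ereal s" "ereal s < s1 t" for s
    proof -
      obtain \<delta> where \<delta>: "\<delta> > 0"
        "\<And>\<sigma> \<tau>. \<tau> \<in> {0..<T} \<Longrightarrow> \<bar>\<tau> - t\<bar> < \<delta> \<Longrightarrow> \<bar>\<sigma> - s\<bar> < \<delta> \<Longrightarrow> s0 \<tau> < ereal \<sigma> \<and> ereal \<sigma> < s1 \<tau>"
        using interior_stable[OF t s] by blast
      have ev: "\<forall>\<^sub>F n in sequentially. (s, r n) \<in> \<Omega>"
        using tendstoD[OF rlim \<delta>(1)]
      proof eventually_elim
        case (elim n)
        then show ?case using \<delta>(2)[OF rT[of n], of s] rT[of n] \<delta>(1)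
          by (auto simp: mem_domain dist_real_def less_imp_le)
      qed
      have st: "(s, t) \<in> \<Omega>" using s t by (auto simp: mem_domain less_imp_le)
      have "(\<gamma> \<longlongrightarrow> \<gamma> (s, t)) (at (s, t) within \<Omega>)" using c st by (auto simp: continuous_on_def)
      moreover have "filterlim (\<lambda>n. (s, r n)) (at (s, t) within \<Omega>) sequentially"
        unfolding filterlim_at
        using ev r by (auto intro!: tendsto_intros rlim elim!: eventually_mono simp: less_imp_neq[symmetric])
      ultimately have "(\<lambda>n. \<gamma> (s, r n)) \<longlonglongrightarrow> \<gamma> (s, t)" by (rule filterlim_compose)
      then have "(\<lambda>n. norm (\<gamma> (s, r n))) \<longlonglongrightarrow> norm (\<gamma> (s, t))" by (rule tendsto_norm)
      moreover have "\<forall>\<^sub>F n in sequentially. norm (\<gamma> (s, r n)) = v n s"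
        using ev by eventually_elim (auto simp: v_def mem_domain mem_slice)
      ultimately show ?thesis by (rule Lim_transform_eventually)
    qed
    have ae: "AE s in lebesgue. s \<notin> {real_of_ereal (s0 t), real_of_ereal (s1 t)}"
      by (intro AE_not_in null_sets_completionI finite_imp_null_set_lborel) auto
    have "(\<integral>\<^sup>+ s. ennreal (norm (indicator (I t) s *\<^sub>R \<gamma> (s, t))) \<partial>lebesgue) \<le> (\<integral>\<^sup>+ s. liminf (\<lambda>n. ennreal (v n s)) \<partial>lebesgue)"
    proof (rule nn_integral_mono_AE, use ae in eventually_elim)
      case (elim s)
      show ?case
      proof (cases "s \<in> I t")
        case True
        moreover have "s0 t \<noteq> ereal s" "s1 t \<noteq> ereal s" using elim by auto
        ultimately have "s0 t < ereal s" "ereal s < s1 t" by (auto simp: mem_slice order.strict_iff_order)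
        then have "(\<lambda>n. ennreal (v n s)) \<longlonglongrightarrow> ennreal (norm (\<gamma> (s, t)))" using conv by (intro tendsto_ennrealI) auto
        then have "liminf (\<lambda>n. ennreal (v n s)) = ennreal (norm (\<gamma> (s, t)))" by (intro lim_imp_Liminf) auto
        with True show ?thesis by simp
      qed simp
    qed
    also have "\<dots> \<le> liminf (\<lambda>n. (\<integral>\<^sup>+ s. ennreal (v n s) \<partial>lebesgue))" by (intro nn_integral_liminf vm)
    also have "\<dots> \<le> liminf (\<lambda>n::nat. ennreal M)" using vM by (intro Liminf_mono always_eventually) auto
    also have "\<dots> = ennreal M" by (simp add: Liminf_const)
    finally show ?thesis .
  qed
  show thesis
  proof (rule that)
    show "M \<ge> 0" by (simp add: M_def)
    fix t assume t: "t \<in> {0..<T}"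
    show i: "set_integrable lebesgue (I t) (\<lambda>s. \<gamma> (s, t))"
      unfolding set_integrable_def
      using slice_measurable(1)[OF c t] bound[OF t] by (intro integrableI_bounded) (auto intro: order_le_less_trans)
    then have "(\<integral>\<^sup>+ s. ennreal (norm (indicator (I t) s *\<^sub>R \<gamma> (s, t))) \<partial>lebesgue) = ennreal (\<integral> s. norm (indicator (I t) s *\<^sub>R \<gamma> (s, t)) \<partial>lebesgue)"
      unfolding set_integrable_def by (intro nn_integral_eq_integral integrable_norm) auto
    also have "(\<integral> s. norm (indicator (I t) s *\<^sub>R \<gamma> (s, t)) \<partial>lebesgue) = (LINT s:I t|lebesgue. \<bar>\<gamma> (s, t)\<bar>)"
      unfolding set_lebesgue_integral_def by (intro Bochner_Integration.integral_cong) (auto simp: abs_mult)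
    finally show "(LINT s:I t|lebesgue. \<bar>\<gamma> (s, t)\<bar>) \<le> M" using bound[OF t] by (simp add: M_def)
  qed
qed

end

section \<open>Representing the endpoints near a given time\<close>

lemma endpoint_differentiable_uminus:
  assumes "endpoint_differentiable T \<sigma>"
  shows "endpoint_differentiable T (\<lambda>t. - \<sigma> t)"
  using assms unfolding endpoint_differentiable_def continuous_on_def
  by (auto intro!: differentiable_minus)

text \<open>
  Near a given time an extended-real endpoint is replaced by a real function: by itself where it is
  finite, and by the constant \<open>K\<close> where it is infinite, since it then exceeds \<open>K\<close> at nearby times.
  Integrands supported in \<open>s \<le> K\<close> do not notice the change.
\<close>

lemma endpoint_representative:
  fixes K :: real
  assumes d: "endpoint_differentiable T \<sigma>" and t: "t \<in> {0..<T}" and ninf: "\<sigma> t \<noteq> - \<infinity>"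
  obtains u u' \<delta> where "\<delta> > 0"
    "\<And>\<tau>. \<tau> \<in> {0..<T} \<Longrightarrow> \<bar>\<tau> - t\<bar> < \<delta> \<Longrightarrow> ereal (u \<tau>) \<le> \<sigma> \<tau>"
    "\<And>\<tau> s. \<tau> \<in> {0..<T} \<Longrightarrow> \<bar>\<tau> - t\<bar> < \<delta> \<Longrightarrow> ereal s \<le> \<sigma> \<tau> \<Longrightarrow> s \<le> K \<Longrightarrow> s \<le> u \<tau>"
    "continuous_on ({0..<T} \<inter> {\<tau>. \<bar>\<tau> - t\<bar> < \<delta>}) u"
    "(u has_real_derivative u') (at t within {0..<T})"
    "\<bar>\<sigma> t\<bar> \<noteq> \<infinity> \<Longrightarrow> u t = real_of_ereal (\<sigma> t) \<and>
       u' = vector_derivative (\<lambda>\<tau>. real_of_ereal (\<sigma> \<tau>)) (at t within {0..<T})"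
    "\<bar>\<sigma> t\<bar> = \<infinity> \<Longrightarrow> u t = K \<and> u' = 0"
proof (cases "\<bar>\<sigma> t\<bar> = \<infinity>")
  case True
  then have inf: "\<sigma> t = \<infinity>" using ninf by auto
  have c: "(\<sigma> \<longlongrightarrow> \<sigma> t) (at t within {0..<T})"
    using d t by (auto simp: endpoint_differentiable_def continuous_on_def)
  have "\<forall>\<^sub>F \<tau> in at t within {0..<T}. ereal K < \<sigma> \<tau>"
    by (rule order_tendstoD(1)[OF c]) (simp add: inf)
  then obtain \<delta> where \<delta>: "\<delta> > 0" "\<And>\<tau>. \<tau> \<in> {0..<T} \<Longrightarrow> \<tau> \<noteq> t \<Longrightarrow> dist \<tau> t < \<delta> \<Longrightarrow> ereal K < \<sigma> \<tau>"
    unfolding eventually_at by blast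
  have \<delta>2: "ereal K \<le> \<sigma> \<tau>" if "\<tau> \<in> {0..<T}" "\<bar>\<tau> - t\<bar> < \<delta>" for \<tau>
    using \<delta>(2)[of \<tau>] that inf by (cases "\<tau> = t") (auto simp: dist_real_def)
  show thesis
    by (rule that[of \<delta> "\<lambda>_. K" 0]) (use \<delta>(1) \<delta>2 True in auto)
next
  case False
  then obtain r where r: "\<sigma> t = ereal r" by auto
  have c: "(\<sigma> \<longlongrightarrow> \<sigma> \<tau>) (at \<tau> within {0..<T})" if "\<tau> \<in> {0..<T}" for \<tau>
    using d that by (auto simp: endpoint_differentiable_def continuous_on_def)
  have "\<forall>\<^sub>F \<tau> in at t within {0..<T}. ereal (r - 1) < \<sigma> \<tau> \<and> \<sigma> \<tau> < ereal (r + 1)"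
    by (intro eventually_conj order_tendstoD[OF c[OF t]]) (auto simp: r)
  then obtain \<delta> where \<delta>: "\<delta> > 0" "\<And>\<tau>. \<tau> \<in> {0..<T} \<Longrightarrow> \<tau> \<noteq> t \<Longrightarrow> dist \<tau> t < \<delta> \<Longrightarrow> ereal (r - 1) < \<sigma> \<tau> \<and> \<sigma> \<tau> < ereal (r + 1)"
    unfolding eventually_at by blast
  have fin: "\<sigma> \<tau> = ereal (real_of_ereal (\<sigma> \<tau>))" if "\<tau> \<in> {0..<T}" "\<bar>\<tau> - t\<bar> < \<delta>" for \<tau>
  proof (cases "\<tau> = t")
    case False
    then have "ereal (r - 1) < \<sigma> \<tau>" "\<sigma> \<tau> < ereal (r + 1)" using \<delta>(2)[of \<tau>] that by (auto simp: dist_real_def)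
    then show ?thesis by (cases "\<sigma> \<tau>") auto
  qed (simp add: r)
  show thesis
  proof (rule that[of \<delta> "\<lambda>\<tau>. real_of_ereal (\<sigma> \<tau>)" "vector_derivative (\<lambda>\<tau>. real_of_ereal (\<sigma> \<tau>)) (at t within {0..<T})"])
    show "\<delta> > 0" by fact
    fix \<tau> assume \<tau>: "\<tau> \<in> {0..<T}" "\<bar>\<tau> - t\<bar> < \<delta>"
    show "ereal (real_of_ereal (\<sigma> \<tau>)) \<le> \<sigma> \<tau>" using fin[OF \<tau>] by simp
    show "s \<le> real_of_ereal (\<sigma> \<tau>)" if "ereal s \<le> \<sigma> \<tau>" for s
      using fin[OF \<tau>] that by (metis ereal_less_eq(3))
  next
    show "continuous_on ({0..<T} \<inter> {\<tau>. \<bar>\<tau> - t\<bar> < \<delta>}) (\<lambda>\<tau>. real_of_ereal (\<sigma> \<tau>))"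
      unfolding continuous_on_def
    proof
      fix \<tau> assume \<tau>: "\<tau> \<in> {0..<T} \<inter> {\<tau>. \<bar>\<tau> - t\<bar> < \<delta>}"
      have "(\<sigma> \<longlongrightarrow> ereal (real_of_ereal (\<sigma> \<tau>))) (at \<tau> within {0..<T})"
        using c[of \<tau>] fin[of \<tau>] \<tau> by simp
      from lim_real_of_ereal[OF this]
      show "((\<lambda>\<tau>. real_of_ereal (\<sigma> \<tau>)) \<longlongrightarrow> real_of_ereal (\<sigma> \<tau>)) (at \<tau> within {0..<T} \<inter> {\<tau>. \<bar>\<tau> - t\<bar> < \<delta>})"
        by (rule tendsto_within_subset) auto
    qed
    have "(\<lambda>\<tau>. real_of_ereal (\<sigma> \<tau>)) differentiable (at t within {0..<T})"
      using d t False by (auto simp: endpoint_differentiable_def)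
    then show "((\<lambda>\<tau>. real_of_ereal (\<sigma> \<tau>)) has_real_derivative
        vector_derivative (\<lambda>\<tau>. real_of_ereal (\<sigma> \<tau>)) (at t within {0..<T})) (at t within {0..<T})"
      by (simp add: vector_derivative_works[symmetric] has_real_derivative_iff_has_vector_derivative)
  qed (use False in auto)
qed

lemma at_within_half_open_nontrivial:
  fixes T :: real assumes "t \<in> {0..<T}" shows "at t within {0..<T} \<noteq> bot"
proof -
  have "t islimpt {0..<T}"
    unfolding islimpt_approachable
  proof (intro allI impI)
    fix e :: real assume "e > 0"
    then show "\<exists>x'\<in>{0..<T}. x' \<noteq> t \<and> dist x' t < e"
      using assms by (intro bexI[of _ "t + min (e / 2) ((T - t) / 2)"]) (auto simp: dist_real_def min_def field_simps)
  qed
  then show ?thesis by (simp add: trivial_limit_within)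
qed

context sheet
begin

lemma local_endpoints:
  fixes R :: real
  assumes t: "t \<in> {0..<T}" and R: "R > 0"
  obtains \<alpha> \<beta> l u m l' u' where "{\<alpha>..\<beta>} \<subseteq> {0..<T}" "t \<in> {\<alpha>..\<beta>}" "at t within {\<alpha>..\<beta>} = at t within {0..<T}"
    "continuous_on {\<alpha>..\<beta>} l" "continuous_on {\<alpha>..\<beta>} u" "\<And>\<tau>. \<tau> \<in> {\<alpha>..\<beta>} \<Longrightarrow> l \<tau> < m \<and> m < u \<tau>"
    "(l has_real_derivative l') (at t within {\<alpha>..\<beta>})" "(u has_real_derivative u') (at t within {\<alpha>..\<beta>})"
    "\<And>\<tau>. \<tau> \<in> {\<alpha>..\<beta>} \<Longrightarrow> {l \<tau>..u \<tau>} \<subseteq> I \<tau>"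
    "\<And>\<tau> s. \<tau> \<in> {\<alpha>..\<beta>} \<Longrightarrow> s \<in> I \<tau> \<Longrightarrow> \<bar>s\<bar> \<le> R \<Longrightarrow> s \<in> {l \<tau>..u \<tau>}"
    "\<bar>s1 t\<bar> \<noteq> \<infinity> \<Longrightarrow> u t = real_of_ereal (s1 t) \<and> u' = vector_derivative (\<lambda>\<tau>. real_of_ereal (s1 \<tau>)) (at t within {0..<T})"
    "\<bar>s1 t\<bar> = \<infinity> \<Longrightarrow> u t \<ge> R \<and> u' = 0"
    "\<bar>s0 t\<bar> \<noteq> \<infinity> \<Longrightarrow> l t = real_of_ereal (s0 t) \<and> l' = vector_derivative (\<lambda>\<tau>. real_of_ereal (s0 \<tau>)) (at t within {0..<T})"
    "\<bar>s0 t\<bar> = \<infinity> \<Longrightarrow> l t \<le> - R \<and> l' = 0"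
proof -
  define K where "K = R + \<bar>real_of_ereal (s0 t)\<bar> + \<bar>real_of_ereal (s1 t)\<bar> + 1"
  have KR: "R \<le> K"
    unfolding K_def using abs_ge_zero[of "real_of_ereal (s0 t)"] abs_ge_zero[of "real_of_ereal (s1 t)"] by linarith
  have n1: "s1 t \<noteq> - \<infinity>" and n0: "- s0 t \<noteq> - \<infinity>" using ordered[OF t] by auto
  obtain u u' \<delta>1 where u: "\<delta>1 > 0"
    "\<And>\<tau>. \<tau> \<in> {0..<T} \<Longrightarrow> \<bar>\<tau> - t\<bar> < \<delta>1 \<Longrightarrow> ereal (u \<tau>) \<le> s1 \<tau>"
    "\<And>\<tau> s. \<tau> \<in> {0..<T} \<Longrightarrow> \<bar>\<tau> - t\<bar> < \<delta>1 \<Longrightarrow> ereal s \<le> s1 \<tau> \<Longrightarrow> s \<le> K \<Longrightarrow> s \<le> u \<tau>"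
    "continuous_on ({0..<T} \<inter> {\<tau>. \<bar>\<tau> - t\<bar> < \<delta>1}) u"
    "(u has_real_derivative u') (at t within {0..<T})"
    "\<bar>s1 t\<bar> \<noteq> \<infinity> \<Longrightarrow> u t = real_of_ereal (s1 t) \<and>
       u' = vector_derivative (\<lambda>\<tau>. real_of_ereal (s1 \<tau>)) (at t within {0..<T})"
    "\<bar>s1 t\<bar> = \<infinity> \<Longrightarrow> u t = K \<and> u' = 0"
    by (rule endpoint_representative[OF s1_diff t n1, of K]) (rule that)
  obtain v v' \<delta>0 where v: "\<delta>0 > 0"
    "\<And>\<tau>. \<tau> \<in> {0..<T} \<Longrightarrow> \<bar>\<tau> - t\<bar> < \<delta>0 \<Longrightarrow> ereal (v \<tau>) \<le> - s0 \<tau>"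
    "\<And>\<tau> s. \<tau> \<in> {0..<T} \<Longrightarrow> \<bar>\<tau> - t\<bar> < \<delta>0 \<Longrightarrow> ereal s \<le> - s0 \<tau> \<Longrightarrow> s \<le> K \<Longrightarrow> s \<le> v \<tau>"
    "continuous_on ({0..<T} \<inter> {\<tau>. \<bar>\<tau> - t\<bar> < \<delta>0}) v"
    "(v has_real_derivative v') (at t within {0..<T})"
    "\<bar>- s0 t\<bar> \<noteq> \<infinity> \<Longrightarrow> v t = real_of_ereal (- s0 t) \<and>
       v' = vector_derivative (\<lambda>\<tau>. real_of_ereal (- s0 \<tau>)) (at t within {0..<T})"
    "\<bar>- s0 t\<bar> = \<infinity> \<Longrightarrow> v t = K \<and> v' = 0"
    by (rule endpoint_representative[OF endpoint_differentiable_uminus[OF s0_diff] t n0, of K]) (rule that)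
  define l where "l = (\<lambda>\<tau>. - v \<tau>)"
  have lt: "l t = real_of_ereal (s0 t)" if "\<bar>s0 t\<bar> \<noteq> \<infinity>" using v(6) that by (simp add: l_def)
  have l't: "- v' = vector_derivative (\<lambda>\<tau>. real_of_ereal (s0 \<tau>)) (at t within {0..<T})" if "\<bar>s0 t\<bar> \<noteq> \<infinity>"
  proof -
    have "((\<lambda>\<tau>. real_of_ereal (- s0 \<tau>)) has_vector_derivative v') (at t within {0..<T})"
      using v(6) that endpoint_differentiable_uminus[OF s0_diff] t
      by (auto simp: endpoint_differentiable_def vector_derivative_works[symmetric])
    then have "((\<lambda>\<tau>. - real_of_ereal (- s0 \<tau>)) has_vector_derivative - v') (at t within {0..<T})"
      by (rule has_vector_derivative_minus)
    then have "((\<lambda>\<tau>. real_of_ereal (s0 \<tau>)) has_vector_derivative - v') (at t within {0..<T})" by simp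
    then show ?thesis
      using vector_derivative_within[OF at_within_half_open_nontrivial[OF t]] by metis
  qed
  have lu: "l t < u t"
  proof -
    have fin: "real_of_ereal (s0 t) < real_of_ereal (s1 t)" if "\<bar>s0 t\<bar> \<noteq> \<infinity>" "\<bar>s1 t\<bar> \<noteq> \<infinity>"
      using ordered[OF t] that by (cases "s0 t"; cases "s1 t") auto
    show ?thesis
      using fin lt u(6,7) v(7) R
      by (cases "\<bar>s0 t\<bar> = \<infinity>"; cases "\<bar>s1 t\<bar> = \<infinity>") (auto simp: K_def l_def)
  qed
  define m where "m = (l t + u t) / 2"
  define S where "S = {0..<T} \<inter> {\<tau>. \<bar>\<tau> - t\<bar> < min \<delta>0 \<delta>1}"
  have tS: "t \<in> S" using t u(1) v(1) by (auto simp: S_def)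
  have cS: "continuous_on S l" "continuous_on S u"
    unfolding l_def using u(4) v(4) by (auto simp: S_def intro!: continuous_on_minus elim: continuous_on_subset)
  obtain \<eta>0 where \<eta>0: "\<eta>0 > 0" "\<And>\<tau>. \<tau> \<in> S \<Longrightarrow> \<bar>\<tau> - t\<bar> < \<eta>0 \<Longrightarrow> \<bar>l \<tau> - l t\<bar> < (u t - l t) / 2"
    using cS(1) tS lu unfolding continuous_on_iff dist_real_def by (metis diff_gt_0_iff_gt half_gt_zero)
  obtain \<eta>1 where \<eta>1: "\<eta>1 > 0" "\<And>\<tau>. \<tau> \<in> S \<Longrightarrow> \<bar>\<tau> - t\<bar> < \<eta>1 \<Longrightarrow> \<bar>u \<tau> - u t\<bar> < (u t - l t) / 2"
    using cS(2) tS lu unfolding continuous_on_iff dist_real_def by (metis diff_gt_0_iff_gt half_gt_zero)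
  define \<eta> where "\<eta> = Min {\<delta>0, \<delta>1, \<eta>0, \<eta>1, T - t} / 2"
  have \<eta>: "\<eta> > 0" "\<eta> < \<delta>0" "\<eta> < \<delta>1" "\<eta> < \<eta>0" "\<eta> < \<eta>1" "\<eta> < T - t"
  proof -
    have p: "Min {\<delta>0, \<delta>1, \<eta>0, \<eta>1, T - t} > 0" using u(1) v(1) \<eta>0(1) \<eta>1(1) t by simp
    have "Min {\<delta>0, \<delta>1, \<eta>0, \<eta>1, T - t} \<le> x" if "x \<in> {\<delta>0, \<delta>1, \<eta>0, \<eta>1, T - t}" for x using that by (intro Min_le) auto
    with p show "\<eta> > 0" "\<eta> < \<delta>0" "\<eta> < \<delta>1" "\<eta> < \<eta>0" "\<eta> < \<eta>1" "\<eta> < T - t"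
      unfolding \<eta>_def by (smt (verit, best) field_sum_of_halves insertCI)+
  qed
  define \<alpha> \<beta> where "\<alpha> = max 0 (t - \<eta>)" and "\<beta> = t + \<eta>"
  have ab: "{\<alpha>..\<beta>} \<subseteq> {0..<T}" "t \<in> {\<alpha>..\<beta>}" using \<eta> t by (auto simp: \<alpha>_def \<beta>_def)
  have abS: "\<tau> \<in> S \<and> \<bar>\<tau> - t\<bar> \<le> \<eta>" if "\<tau> \<in> {\<alpha>..\<beta>}" for \<tau>
    using that \<eta> ab by (auto simp: \<alpha>_def \<beta>_def S_def abs_le_iff)
  have nhd: "at t within {\<alpha>..\<beta>} = at t within {0..<T}"
    by (rule at_within_nhd[of _ "{t - \<eta><..<t + \<eta>}"]) (use \<eta> t in \<open>auto simp: \<alpha>_def \<beta>_def\<close>)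
  show thesis
  proof (rule that[OF ab nhd, of l u m "- v'" u'])
    show "continuous_on {\<alpha>..\<beta>} l" "continuous_on {\<alpha>..\<beta>} u"
      using cS abS by (auto elim!: continuous_on_subset)
    show "l \<tau> < m \<and> m < u \<tau>" if "\<tau> \<in> {\<alpha>..\<beta>}" for \<tau>
    proof -
      have "\<bar>l \<tau> - l t\<bar> < (u t - l t) / 2" "\<bar>u \<tau> - u t\<bar> < (u t - l t) / 2"
        using \<eta>0(2)[of \<tau>] \<eta>1(2)[of \<tau>] abS[OF that] \<eta> by auto
      then show ?thesis unfolding m_def abs_less_iff by (simp add: field_simps)
    qed
    show "(l has_real_derivative - v') (at t within {\<alpha>..\<beta>})"
      unfolding nhd l_def using v(5) by (rule DERIV_minus)
    show "(u has_real_derivative u') (at t within {\<alpha>..\<beta>})" unfolding nhd by fact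
    fix \<tau> assume \<tau>: "\<tau> \<in> {\<alpha>..\<beta>}"
    have \<tau>2: "\<tau> \<in> {0..<T}" "\<bar>\<tau> - t\<bar> < \<delta>0" "\<bar>\<tau> - t\<bar> < \<delta>1" using abS[OF \<tau>] \<eta> by (auto simp: S_def)
    have "s0 \<tau> \<le> ereal (l \<tau>)" using v(2)[OF \<tau>2(1,2)] by (simp add: l_def ereal_uminus_le_reorder flip: uminus_ereal.simps(1)) (metis ereal_minus_le_minus ereal_uminus_uminus uminus_ereal.simps(1))
    moreover have "ereal (u \<tau>) \<le> s1 \<tau>" using u(2)[OF \<tau>2(1,3)] .
    ultimately show "{l \<tau>..u \<tau>} \<subseteq> I \<tau>"
      by (auto simp: mem_slice) (meson ereal_less_eq(3) order_trans)+
    fix s assume s: "s \<in> I \<tau>" "\<bar>s\<bar> \<le> R"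
    have "s \<le> u \<tau>" using u(3)[OF \<tau>2(1,3)] s KR by (auto simp: mem_slice)
    moreover have "ereal (- s) \<le> - s0 \<tau>" using s by (simp add: mem_slice flip: uminus_ereal.simps(1))
    then have "- s \<le> v \<tau>" using v(3)[OF \<tau>2(1,2), of "- s"] s KR by auto
    ultimately show "s \<in> {l \<tau>..u \<tau>}" by (auto simp: l_def)
  qed (use u(6,7) v(7) lt l't KR in \<open>auto simp: l_def\<close>)
qed

end

section \<open>The transport identity\<close>

text \<open>
  What the two directions of the theorem share: a density \<open>\<gamma>\<close> carried along the sheet with tangential
  speed \<open>a\<close>, which is only continuous, and a velocity \<open>U\<close> that agrees with the motion of the
  sheet wherever \<open>\<gamma>\<close> does not vanish.
\<close>

locale transported_sheet = sheet +
  fixes \<gamma> a :: "real \<times> real \<Rightarrow> real" and \<xi> U :: "real \<times> real \<Rightarrow> real^2"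
  assumes \<gamma>: "Ckb_on 1 (sheet_domain T s0 s1) \<gamma>" and \<xi>: "Ckb_on 1 (sheet_domain T s0 s1) \<xi>"
    and a: "continuous_on (sheet_domain T s0 s1) a" "bounded (a ` sheet_domain T s0 s1)"
    and conservation: "BR_conservation T s0 s1 \<gamma> a"
    and motion: "\<And>p. p \<in> sheet_domain T s0 s1 \<Longrightarrow>
      \<gamma> p *\<^sub>R (pd_t (sheet_domain T s0 s1) \<xi> p + a p *\<^sub>R pd_s (sheet_domain T s0 s1) \<xi> p) = \<gamma> p *\<^sub>R U p"
    and L1: "Linf_L1 T s0 s1 \<gamma>"

locale transported_sheet_test = transported_sheet +
  fixes \<phi> :: "(real^2) \<times> real \<Rightarrow> real"
  assumes test: "test_function T \<phi>"
begin

text \<open>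
  The test function and its partial derivatives along the sheet; \<open>h\<close> is the integrand of the weak
  formulation rewritten in these terms (\<open>h_eq\<close>).
\<close>

definition f where "f p = \<phi> (\<xi> p, snd p)"
definition fs where "fs p = space_grad \<phi> (\<xi> p) (snd p) \<bullet> pd_s \<Omega> \<xi> p"
definition ft where "ft p = space_grad \<phi> (\<xi> p) (snd p) \<bullet> pd_t \<Omega> \<xi> p + time_deriv \<phi> (\<xi> p) (snd p)"
definition h where "h p = \<gamma> p * (ft p + a p * fs p)"

lemma Ck1: "Ck 1 \<phi>"
  using test by (auto simp: test_function_def simp del: Ck.simps)

lemma h_eq:
  assumes "p \<in> \<Omega>"
  shows "\<gamma> p * (time_deriv \<phi> (\<xi> p) (snd p) + U p \<bullet> space_grad \<phi> (\<xi> p) (snd p)) = h p"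
proof -
  let ?g = "space_grad \<phi> (\<xi> p) (snd p)"
  have "\<gamma> p * (U p \<bullet> ?g) = (\<gamma> p *\<^sub>R U p) \<bullet> ?g" by simp
  also have "\<dots> = \<gamma> p * ((pd_t \<Omega> \<xi> p + a p *\<^sub>R pd_s \<Omega> \<xi> p) \<bullet> ?g)" unfolding motion[OF assms, symmetric] by simp
  finally show ?thesis by (simp add: h_def ft_def fs_def inner_add_left inner_commute algebra_simps)
qed

lemma f_s_derivative:
  assumes "(s, t) \<in> \<Omega>"
  shows "((\<lambda>\<sigma>. f (\<sigma>, t)) has_real_derivative fs (s, t)) (at s within {\<sigma>. (\<sigma>, t) \<in> \<Omega>})"
proof -
  have "((\<lambda>\<sigma>. (\<xi> (\<sigma>, t), t)) has_derivative (\<lambda>h. (h *\<^sub>R pd_s \<Omega> \<xi> (s, t), 0))) (at s within {\<sigma>. (\<sigma>, t) \<in> \<Omega>})"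
    using Ckb_on_1_has_vector_derivative(1)[OF \<xi> assms]
    by (auto simp: has_vector_derivative_def intro!: derivative_eq_intros)
  from has_derivative_compose[OF this has_derivative_test[OF Ck1]]
  show ?thesis unfolding f_def fs_def has_field_derivative_def fst_conv snd_conv
    by (rule has_derivative_eq_rhs) (simp add: fun_eq_iff)
qed

lemma f_t_derivative:
  assumes "(s, t) \<in> \<Omega>"
  shows "((\<lambda>\<tau>. f (s, \<tau>)) has_real_derivative ft (s, t)) (at t within {\<tau>. (s, \<tau>) \<in> \<Omega>})"
proof -
  have "((\<lambda>\<tau>. (\<xi> (s, \<tau>), \<tau>)) has_derivative (\<lambda>h. (h *\<^sub>R pd_t \<Omega> \<xi> (s, t), h))) (at t within {\<tau>. (s, \<tau>) \<in> \<Omega>})"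
    using Ckb_on_1_has_vector_derivative(2)[OF \<xi> assms]
    by (auto simp: has_vector_derivative_def intro!: derivative_eq_intros)
  from has_derivative_compose[OF this has_derivative_test[OF Ck1]]
  show ?thesis unfolding f_def ft_def has_field_derivative_def fst_conv snd_conv
    by (rule has_derivative_eq_rhs) (simp add: fun_eq_iff algebra_simps)
qed

lemma continuous_f: "continuous_on \<Omega> f" "continuous_on \<Omega> fs" "continuous_on \<Omega> ft" "continuous_on \<Omega> h"
proof -
  note c = Ckb_on_1D(1,3,5)[OF \<xi>] Ckb_on_1D(1,3,5)[OF \<gamma>]
  have pr: "continuous_on \<Omega> (\<lambda>p. (\<xi> p, snd p))" by (intro continuous_intros c)
  have g: "continuous_on \<Omega> (\<lambda>p. space_grad \<phi> (\<xi> p) (snd p))"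
    using continuous_on_compose2[OF test_derivatives_continuous(1)[OF Ck1] pr] by simp
  have tt: "continuous_on \<Omega> (\<lambda>p. time_deriv \<phi> (\<xi> p) (snd p))"
    using continuous_on_compose2[OF test_derivatives_continuous(2)[OF Ck1] pr] by simp
  show f: "continuous_on \<Omega> f" unfolding f_def
    using continuous_on_compose2[OF test_derivatives_continuous(3)[OF Ck1] pr] by simp
  show fs: "continuous_on \<Omega> fs" unfolding fs_def by (intro continuous_intros g c)
  show ft: "continuous_on \<Omega> ft" unfolding ft_def by (intro continuous_intros g tt c)
  show "continuous_on \<Omega> h" unfolding h_def by (intro continuous_intros fs ft c a)
qed

lemma bounds:
  obtains C where "C \<ge> 0" "\<And>p. p \<in> \<Omega> \<Longrightarrow> \<bar>f p\<bar> \<le> C" "\<And>p. p \<in> \<Omega> \<Longrightarrow> \<bar>h p\<bar> \<le> C * \<bar>\<gamma> p\<bar>"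
    "\<And>p. p \<in> \<Omega> \<Longrightarrow> \<bar>a p\<bar> \<le> C"
proof -
  obtain B where B: "B \<ge> 0" "\<And>x t. \<bar>\<phi> (x, t)\<bar> \<le> B" "\<And>x t. norm (space_grad \<phi> x t) \<le> B" "\<And>x t. \<bar>time_deriv \<phi> x t\<bar> \<le> B"
    using test_function_bounds[OF test] by blast
  have bd: "\<exists>B\<ge>0. \<forall>p\<in>\<Omega>. norm (g p) \<le> B" if "bounded (g ` \<Omega>)" for g :: "real \<times> real \<Rightarrow> 'c::real_normed_vector"
  proof -
    obtain b where "\<forall>p\<in>\<Omega>. norm (g p) \<le> b" using \<open>bounded (g ` \<Omega>)\<close> by (auto simp: bounded_iff)
    then show ?thesis by (intro exI[of _ "max b 0"]) auto
  qed
  obtain A where A: "A \<ge> 0" "\<forall>p\<in>\<Omega>. norm (a p) \<le> A" using bd[OF a(2)] by blast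
  obtain S where S: "S \<ge> 0" "\<forall>p\<in>\<Omega>. norm (pd_s \<Omega> \<xi> p) \<le> S" using bd[OF Ckb_on_1D(4)[OF \<xi>]] by blast
  obtain N where N: "N \<ge> 0" "\<forall>p\<in>\<Omega>. norm (pd_t \<Omega> \<xi> p) \<le> N" using bd[OF Ckb_on_1D(6)[OF \<xi>]] by blast
  have fsb: "\<bar>fs p\<bar> \<le> B * S" if "p \<in> \<Omega>" for p
    unfolding fs_def using B S that Cauchy_Schwarz_ineq2[of "space_grad \<phi> (\<xi> p) (snd p)" "pd_s \<Omega> \<xi> p"]
    by (meson mult_mono norm_ge_zero order_trans)
  have ftb: "\<bar>ft p\<bar> \<le> B * N + B" if "p \<in> \<Omega>" for p
  proof -
    have "\<bar>space_grad \<phi> (\<xi> p) (snd p) \<bullet> pd_t \<Omega> \<xi> p\<bar> \<le> B * N"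
      using B N that Cauchy_Schwarz_ineq2[of "space_grad \<phi> (\<xi> p) (snd p)" "pd_t \<Omega> \<xi> p"]
      by (meson mult_mono norm_ge_zero order_trans)
    then show ?thesis unfolding ft_def using B(4)[of "\<xi> p" "snd p"] by linarith
  qed
  define D where "D = B * N + B + A * (B * S)"
  have D: "D \<ge> 0" using A B S N by (auto simp: D_def)
  have hb: "\<bar>h p\<bar> \<le> D * \<bar>\<gamma> p\<bar>" if "p \<in> \<Omega>" for p
  proof -
    have "\<bar>a p * fs p\<bar> \<le> A * (B * S)"
      unfolding abs_mult using A(2) fsb[OF that] that A(1) by (intro mult_mono) auto
    then have "\<bar>ft p + a p * fs p\<bar> \<le> D" using ftb[OF that] unfolding D_def by linarith
    then show ?thesis unfolding h_def abs_mult by (metis mult.commute mult_left_mono abs_ge_zero)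
  qed
  show thesis
  proof (rule that[of "max B (max D A)"])
    show "\<bar>h p\<bar> \<le> max B (max D A) * \<bar>\<gamma> p\<bar>" if "p \<in> \<Omega>" for p
      using hb[OF that] by (rule order_trans) (auto intro!: mult_right_mono)
    show "\<bar>f p\<bar> \<le> max B (max D A)" for p using B(2)[of "\<xi> p" "snd p"] by (auto simp: f_def)
    show "\<bar>a p\<bar> \<le> max B (max D A)" if "p \<in> \<Omega>" for p using A(2) that by force
  qed (use B in auto)
qed

text \<open>
  An infinite endpoint contributes nothing; \<open>weak_identity\<close> shows that this is the right convention.
\<close>

definition boundary_term where
  "boundary_term \<sigma> t = (if \<bar>\<sigma> t\<bar> = \<infinity> then 0
     else endpoint_flux T \<gamma> a \<sigma> t * \<phi> (\<xi> (real_of_ereal (\<sigma> t), t), t))"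

text \<open>
  The pairing of \<open>\<gamma>\<close> with the test function under a cutoff in arclength, and the part of its time
  derivative that comes from the interior of the sheet.
\<close>

definition G where "G R t = (LINT s:I t|lebesgue. \<gamma> (s, t) * f (s, t) * cutoff R s)"
definition H where "H R t = (LINT s:I t|lebesgue. h (s, t) * cutoff R s + a (s, t) * \<gamma> (s, t) * f (s, t) * dcutoff R s)"

text \<open>
  The Leibniz rule produces \<open>\<gamma> f s\<^sub>j'\<close> at the endpoints.  The fundamental theorem of calculus in
  \<open>s\<close>, applied to \<open>a \<gamma> f \<chi>\<^sub>R\<close> and combined with conservation, produces \<open>- a \<gamma> f\<close> there;
  together they form the flux \<open>\<gamma> (s\<^sub>j' - a) f\<close>.
\<close>

lemma G_derivative:
  assumes t: "t \<in> {0..<T}" and R: "R > 0"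
  shows "(G R has_real_derivative H R t + boundary_term s1 t * cutoff R (real_of_ereal (s1 t))
     - boundary_term s0 t * cutoff R (real_of_ereal (s0 t))) (at t within {0..<T})"
proof -
  obtain \<alpha> \<beta> l u m l' u' where ab: "{\<alpha>..\<beta>} \<subseteq> {0..<T}" "t \<in> {\<alpha>..\<beta>}" "at t within {\<alpha>..\<beta>} = at t within {0..<T}"
    and lu: "continuous_on {\<alpha>..\<beta>} l" "continuous_on {\<alpha>..\<beta>} u" "\<And>\<tau>. \<tau> \<in> {\<alpha>..\<beta>} \<Longrightarrow> l \<tau> < m \<and> m < u \<tau>"
    and dl: "(l has_real_derivative l') (at t within {\<alpha>..\<beta>})" and du: "(u has_real_derivative u') (at t within {\<alpha>..\<beta>})"
    and sub: "\<And>\<tau>. \<tau> \<in> {\<alpha>..\<beta>} \<Longrightarrow> {l \<tau>..u \<tau>} \<subseteq> I \<tau>"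
    and sup: "\<And>\<tau> s. \<tau> \<in> {\<alpha>..\<beta>} \<Longrightarrow> s \<in> I \<tau> \<Longrightarrow> \<bar>s\<bar> \<le> R \<Longrightarrow> s \<in> {l \<tau>..u \<tau>}"
    and u1: "\<bar>s1 t\<bar> \<noteq> \<infinity> \<Longrightarrow> u t = real_of_ereal (s1 t) \<and> u' = vector_derivative (\<lambda>\<tau>. real_of_ereal (s1 \<tau>)) (at t within {0..<T})"
    and u2: "\<bar>s1 t\<bar> = \<infinity> \<Longrightarrow> u t \<ge> R \<and> u' = 0"
    and l1: "\<bar>s0 t\<bar> \<noteq> \<infinity> \<Longrightarrow> l t = real_of_ereal (s0 t) \<and> l' = vector_derivative (\<lambda>\<tau>. real_of_ereal (s0 \<tau>)) (at t within {0..<T})"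
    and l2: "\<bar>s0 t\<bar> = \<infinity> \<Longrightarrow> l t \<le> - R \<and> l' = 0"
    by (rule local_endpoints[OF t R]) (rule that)
  define D where "D = {(s, \<tau>). \<tau> \<in> {\<alpha>..\<beta>} \<and> l \<tau> \<le> s \<and> s \<le> u \<tau>}"
  have D\<Omega>: "D \<subseteq> \<Omega>"
    using sub ab(1) by (force simp: D_def mem_domain mem_slice)
  define F where "F = (\<lambda>p. \<gamma> p * f p * cutoff R (fst p))"
  define Ft where "Ft = (\<lambda>p. (pd_t \<Omega> \<gamma> p * f p + \<gamma> p * ft p) * cutoff R (fst p))"
  define Hp where "Hp = (\<lambda>p. h p * cutoff R (fst p) + a p * \<gamma> p * f p * dcutoff R (fst p))"
  have cc: "continuous_on \<Omega> (\<lambda>p. cutoff R (fst p))" "continuous_on \<Omega> (\<lambda>p. dcutoff R (fst p))"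
    using continuous_on_compose2[OF continuous_cutoff(1)[OF R, of UNIV], of \<Omega> fst]
      continuous_on_compose2[OF continuous_cutoff(2)[of UNIV R], of \<Omega> fst]
      continuous_on_fst[OF continuous_on_id, of \<Omega>] by auto
  note c = Ckb_on_1D(1,3,5)[OF \<gamma>] continuous_f a(1) cc
  have cF: "continuous_on \<Omega> F" "continuous_on \<Omega> Ft" "continuous_on \<Omega> Hp"
    unfolding F_def Ft_def Hp_def by (intro continuous_intros c)+
  have G': "((\<lambda>\<tau>. integral {l \<tau>..u \<tau>} (\<lambda>s. F (s, \<tau>))) has_real_derivative
      integral {l t..u t} (\<lambda>s. Ft (s, t)) + F (u t, t) * u' - F (l t, t) * l') (at t within {\<alpha>..\<beta>})"
  proof (rule leibniz_moving_endpoints[OF ab(2) lu dl du, folded D_def])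
    show "continuous_on D F" "continuous_on D Ft" using cF D\<Omega> continuous_on_subset by blast+
    fix s \<tau> assume "(s, \<tau>) \<in> D"
    then have st: "(s, \<tau>) \<in> \<Omega>" using D\<Omega> by blast
    have "((\<lambda>\<tau>. F (s, \<tau>)) has_real_derivative Ft (s, \<tau>)) (at \<tau> within {\<tau>. (s, \<tau>) \<in> \<Omega>})"
      using Ckb_on_1_has_vector_derivative(2)[OF \<gamma> st, folded has_real_derivative_iff_has_vector_derivative] f_t_derivative[OF st]
      unfolding F_def Ft_def by (auto intro!: derivative_eq_intros)
    then show "((\<lambda>\<tau>. F (s, \<tau>)) has_real_derivative Ft (s, \<tau>)) (at \<tau> within {\<tau>. (s, \<tau>) \<in> D})"
      by (rule DERIV_subset) (use D\<Omega> in auto)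
  qed
  have contl: "continuous_on {l \<tau>..u \<tau>} (\<lambda>s. g (s, \<tau>))" if "continuous_on \<Omega> g" "\<tau> \<in> {\<alpha>..\<beta>}" for g :: "real \<times> real \<Rightarrow> real" and \<tau>
    using continuous_on_subset[OF slice_measurable(2)[OF that(1)] sub[OF that(2)]] that(2) ab(1) by blast
  have far: "\<bar>s\<bar> \<ge> R" if "\<tau> \<in> {\<alpha>..\<beta>}" "s \<in> I \<tau>" "s \<notin> {l \<tau>..u \<tau>}" for s \<tau>
    using sup[OF that(1,2)] that(3) by (meson linear)
  have G_eq: "G R \<tau> = integral {l \<tau>..u \<tau>} (\<lambda>s. F (s, \<tau>))" if \<tau>: "\<tau> \<in> {\<alpha>..\<beta>}" for \<tau>
  proof -
    have "(LINT s:I \<tau>|lebesgue. F (s, \<tau>)) = integral {l \<tau>..u \<tau>} (\<lambda>s. F (s, \<tau>))"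
      by (rule set_integral_eq_on_subinterval[OF contl[OF cF(1) \<tau>] sub[OF \<tau>]])
        (use far[OF \<tau>] in \<open>simp add: F_def cutoff_outside R\<close>)
    then show ?thesis by (simp add: G_def F_def)
  qed
  have H_eq: "H R t = integral {l t..u t} (\<lambda>s. Hp (s, t))"
  proof -
    have "(LINT s:I t|lebesgue. Hp (s, t)) = integral {l t..u t} (\<lambda>s. Hp (s, t))"
      by (rule set_integral_eq_on_subinterval[OF contl[OF cF(3) ab(2)] sub[OF ab(2)]])
        (use far[OF ab(2)] in \<open>simp add: Hp_def cutoff_outside R\<close>)
    then show ?thesis by (simp add: H_def Hp_def)
  qed
  define m where "m = (\<lambda>s. a (s, t) * \<gamma> (s, t) * f (s, t) * cutoff R s)"
  have FTC: "((\<lambda>s. Hp (s, t) - Ft (s, t)) has_integral m (u t) - m (l t)) {l t..u t}"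
  proof (rule fundamental_theorem_of_calculus)
    show "l t \<le> u t" using lu(3)[OF ab(2)] by simp
    fix s assume s: "s \<in> {l t..u t}"
    then have st: "(s, t) \<in> \<Omega>" using sub[OF ab(2)] t by (auto simp: mem_domain mem_slice)
    obtain Dm where Dm: "((\<lambda>s'. a (s', t) * \<gamma> (s', t)) has_real_derivative Dm) (at s within I t)" "pd_t \<Omega> \<gamma> (s, t) + Dm = 0"
      using conservation st unfolding BR_conservation_def Let_def by auto
    have "(m has_real_derivative (Dm * f (s, t) + a (s, t) * \<gamma> (s, t) * fs (s, t)) * cutoff R s + a (s, t) * \<gamma> (s, t) * f (s, t) * dcutoff R s) (at s within I t)"
      unfolding m_def
      by (rule DERIV_cong[OF DERIV_mult[OF DERIV_mult[OF Dm(1) f_s_derivative[OF st, unfolded slice_eq[OF t]]]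
              has_field_derivative_at_within[OF DERIV_cutoff[OF R, of s]]]])
        (simp add: algebra_simps)
    moreover have "(Dm * f (s, t) + a (s, t) * \<gamma> (s, t) * fs (s, t)) * cutoff R s + a (s, t) * \<gamma> (s, t) * f (s, t) * dcutoff R s
        = Hp (s, t) - Ft (s, t)"
    proof -
      have "Dm = - pd_t \<Omega> \<gamma> (s, t)" using Dm(2) by simp
      then show ?thesis by (simp add: Hp_def Ft_def h_def algebra_simps)
    qed
    ultimately have "(m has_real_derivative Hp (s, t) - Ft (s, t)) (at s within {l t..u t})"
      using sub[OF ab(2)] by (metis DERIV_subset)
    then show "(m has_vector_derivative Hp (s, t) - Ft (s, t)) (at s within {l t..u t})"
      by (simp add: has_real_derivative_iff_has_vector_derivative)
  qed
  have "integral {l t..u t} (\<lambda>s. Hp (s, t)) - integral {l t..u t} (\<lambda>s. Ft (s, t)) = m (u t) - m (l t)"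
    using integral_unique[OF FTC] integrable_continuous_real[OF contl[OF cF(3) ab(2)]] integrable_continuous_real[OF contl[OF cF(2) ab(2)]]
    by (simp add: Henstock_Kurzweil_Integration.integral_diff)
  moreover have "F (u t, t) * u' - m (u t) = boundary_term s1 t * cutoff R (real_of_ereal (s1 t))"
    using u1 u2 R by (cases "\<bar>s1 t\<bar> = \<infinity>")
      (auto simp: F_def m_def boundary_term_def endpoint_flux_def f_def cutoff_outside algebra_simps)
  moreover have "F (l t, t) * l' - m (l t) = boundary_term s0 t * cutoff R (real_of_ereal (s0 t))"
    using l1 l2 R by (cases "\<bar>s0 t\<bar> = \<infinity>")
      (auto simp: F_def m_def boundary_term_def endpoint_flux_def f_def cutoff_outside algebra_simps)
  ultimately have eq: "integral {l t..u t} (\<lambda>s. Ft (s, t)) + F (u t, t) * u' - F (l t, t) * l'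
      = H R t + boundary_term s1 t * cutoff R (real_of_ereal (s1 t)) - boundary_term s0 t * cutoff R (real_of_ereal (s0 t))"
    by (simp add: H_eq)
  show ?thesis
    using has_field_derivative_transform_within[OF G' zero_less_one ab(2)] G_eq unfolding eq ab(3) by metis
qed

lemma slice_dominated_convergence:
  fixes g :: "nat \<Rightarrow> real \<times> real \<Rightarrow> real"
  assumes t: "t \<in> {0..<T}" and g: "\<And>k. continuous_on \<Omega> (g k)" "continuous_on \<Omega> g'"
    and k: "set_integrable lebesgue (I t) (\<lambda>s. \<gamma> (s, t))"
    and bd: "\<And>k s. s \<in> I t \<Longrightarrow> \<bar>g k (s, t)\<bar> \<le> C * \<bar>\<gamma> (s, t)\<bar>"
    and lim: "\<And>s. s \<in> I t \<Longrightarrow> (\<lambda>k. g k (s, t)) \<longlonglongrightarrow> g' (s, t)"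
  shows "(\<lambda>k. LINT s:I t|lebesgue. g k (s, t)) \<longlonglongrightarrow> (LINT s:I t|lebesgue. g' (s, t))"
  unfolding set_lebesgue_integral_def
proof (rule integral_dominated_convergence[where w = "\<lambda>s. indicator (I t) s *\<^sub>R (C * \<bar>\<gamma> (s, t)\<bar>)"])
  show "integrable lebesgue (\<lambda>s. indicator (I t) s *\<^sub>R (C * \<bar>\<gamma> (s, t)\<bar>))"
    using set_integrable_mult_right[OF set_integrable_abs[OF k], of C] by (simp add: set_integrable_def)
  show "AE s in lebesgue. (\<lambda>k. indicator (I t) s *\<^sub>R g k (s, t)) \<longlonglongrightarrow> indicator (I t) s *\<^sub>R g' (s, t)"
    using lim by (auto simp: indicator_def intro!: AE_I2)
  show "AE s in lebesgue. norm (indicator (I t) s *\<^sub>R g k (s, t)) \<le> indicator (I t) s *\<^sub>R (C * \<bar>\<gamma> (s, t)\<bar>)" for k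
    using bd by (auto simp: indicator_def intro!: AE_I2)
qed (use slice_measurable(1) t g in blast)+

lemma dcutoff_tendsto_0: "(\<lambda>k. dcutoff (real (Suc k)) s) \<longlonglongrightarrow> 0"
proof (rule tendsto_0_le[where K = 4])
  show "(\<lambda>k. inverse (real (Suc k))) \<longlonglongrightarrow> 0" by (rule LIMSEQ_inverse_real_of_nat)
  show "\<forall>\<^sub>F k in sequentially. norm (dcutoff (real (Suc k)) s) \<le> norm (inverse (real (Suc k))) * 4"
    using dcutoff_bound[of "real (Suc k)" s for k]
    by (intro always_eventually allI) (simp add: divide_inverse mult.commute)
qed

lemma cutoff_Suc_tendsto_1: "(\<lambda>k. cutoff (real (Suc k)) s) \<longlonglongrightarrow> 1"
  by (rule filterlim_compose[OF cutoff_tendsto_1])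
    (rule filterlim_compose[OF filterlim_real_sequentially filterlim_Suc])

text \<open>
  Integrate \<open>G_derivative\<close> in time and let \<open>R \<rightarrow> \<infinity>\<close>.  The derivative of \<open>G R\<close> is
  integrable as a derivative, without any knowledge of how it depends on \<open>t\<close>, and is bounded
  uniformly in \<open>R\<close>, so dominated convergence for the Henstock-Kurzweil integral applies and also
  yields integrability of the limit.
\<close>

lemma weak_identity:
  assumes b: "continuous_on {0..<T} (boundary_term s1)" "continuous_on {0..<T} (boundary_term s0)"
  shows "\<exists>T'. 0 < T' \<and> T' < T \<and> (\<forall>t\<ge>T'. boundary_term s1 t = 0 \<and> boundary_term s0 t = 0) \<and>
    (LINT t:{0<..<T}|lebesgue. LINT s:I t|lebesgue.
      \<gamma> (s, t) * (time_deriv \<phi> (\<xi> (s, t)) t + U (s, t) \<bullet> space_grad \<phi> (\<xi> (s, t)) t))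
    + integral {0..T'} (\<lambda>t. boundary_term s1 t - boundary_term s0 t)
    + (LINT s:I 0|lebesgue. \<gamma> (s, 0) * \<phi> (\<xi> (s, 0), 0)) = 0"
proof -
  obtain T' where T': "0 < T'" "T' < T" and z: "\<And>x t. t \<ge> T' \<Longrightarrow> \<phi> (x, t) = 0"
    "\<And>x t. t \<ge> T' \<Longrightarrow> space_grad \<phi> x t = 0" "\<And>x t. t \<ge> T' \<Longrightarrow> time_deriv \<phi> x t = 0"
    using test_function_vanishes_late[OF test T_pos] by metis
  have sub: "{0..T'} \<subseteq> {0..<T}" using T' by auto
  have T0: "0 \<in> {0..<T}" using T_pos by simp
  have bz: "boundary_term s1 t = 0" "boundary_term s0 t = 0" if "t \<ge> T'" for t
    using z(1) that by (auto simp: boundary_term_def)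
  obtain M where M: "M \<ge> 0" "\<And>t. t \<in> {0..<T} \<Longrightarrow> set_integrable lebesgue (I t) (\<lambda>s. \<gamma> (s, t))"
    "\<And>t. t \<in> {0..<T} \<Longrightarrow> (LINT s:I t|lebesgue. \<bar>\<gamma> (s, t)\<bar>) \<le> M"
    using slice_L1_bound[OF Ckb_on_1D(1)[OF \<gamma>] L1] by metis
  obtain C where C: "C \<ge> 0" "\<And>p. p \<in> \<Omega> \<Longrightarrow> \<bar>f p\<bar> \<le> C" "\<And>p. p \<in> \<Omega> \<Longrightarrow> \<bar>h p\<bar> \<le> C * \<bar>\<gamma> p\<bar>"
    "\<And>p. p \<in> \<Omega> \<Longrightarrow> \<bar>a p\<bar> \<le> C"
    using bounds by blast
  \<comment> \<open>bounds the integrand of \<open>H\<close> relative to \<open>|\<gamma>|\<close>; \<open>R \<ge> 1\<close> gives \<open>|\<chi>\<^sub>R'| \<le> 4\<close>\<close>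
  define E where "E = C + 4 * (C * C)"
  have E: "E \<ge> 0" using C(1) by (simp add: E_def)
  define r where "r k = real (Suc k)" for k
  have r: "r k \<ge> 1" for k by (simp add: r_def)
  have r0: "r k > 0" for k by (simp add: r_def)
  define Hp where "Hp = (\<lambda>k p. h p * cutoff (r k) (fst p) + a p * \<gamma> p * f p * dcutoff (r k) (fst p))"
  define Gp where "Gp = (\<lambda>k p. \<gamma> p * f p * cutoff (r k) (fst p))"
  have cc: "continuous_on \<Omega> (\<lambda>p. cutoff (r k) (fst p))" "continuous_on \<Omega> (\<lambda>p. dcutoff (r k) (fst p))" for k
    using continuous_on_compose2[OF continuous_cutoff(1)[OF r0, of UNIV], of \<Omega> fst]
      continuous_on_compose2[OF continuous_cutoff(2)[of UNIV "r k"], of \<Omega> fst]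
      continuous_on_fst[OF continuous_on_id, of \<Omega>] by auto
  note c = Ckb_on_1D(1,3,5)[OF \<gamma>] continuous_f a(1) cc
  have cHp: "continuous_on \<Omega> (Hp k)" and cGp: "continuous_on \<Omega> (Gp k)" and cGf: "continuous_on \<Omega> (\<lambda>p. \<gamma> p * f p)" for k
    unfolding Hp_def Gp_def by (intro continuous_intros c)+
  have Hpb: "\<bar>Hp k (s, t)\<bar> \<le> E * \<bar>\<gamma> (s, t)\<bar>" if t: "t \<in> {0..<T}" and s: "s \<in> I t" for k s t
  proof -
    have st: "(s, t) \<in> \<Omega>" using s t by (simp add: mem_domain mem_slice)
    have "\<bar>h (s, t) * cutoff (r k) s\<bar> \<le> C * \<bar>\<gamma> (s, t)\<bar> * 1"
      unfolding abs_mult using C(1) C(3)[OF st] cutoff_bounds[of "r k" s] by (intro mult_mono) auto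
    moreover have "\<bar>a (s, t) * \<gamma> (s, t) * f (s, t) * dcutoff (r k) s\<bar> \<le> C * \<bar>\<gamma> (s, t)\<bar> * C * 4"
    proof -
      have "\<bar>dcutoff (r k) s\<bar> \<le> 4 / r k" by (rule dcutoff_bound[OF r0])
      also have "\<dots> \<le> 4" using r[of k] by (simp add: field_simps)
      finally show ?thesis
        unfolding abs_mult using C(1,2,4) st by (intro mult_mono) auto
    qed
    ultimately have "\<bar>Hp k (s, t)\<bar> \<le> C * \<bar>\<gamma> (s, t)\<bar> * 1 + C * \<bar>\<gamma> (s, t)\<bar> * C * 4"
      unfolding Hp_def fst_conv by (intro order_trans[OF abs_triangle_ineq] add_mono)
    then show ?thesis by (simp add: E_def algebra_simps)
  qed
  have Gpb: "\<bar>Gp k (s, t)\<bar> \<le> C * \<bar>\<gamma> (s, t)\<bar>" if t: "t \<in> {0..<T}" and s: "s \<in> I t" for k s t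
  proof -
    have st: "(s, t) \<in> \<Omega>" using s t by (simp add: mem_domain mem_slice)
    have "\<bar>Gp k (s, t)\<bar> \<le> \<bar>\<gamma> (s, t)\<bar> * C * 1"
      unfolding abs_mult Gp_def fst_conv using C(1) C(2)[OF st] cutoff_bounds[of "r k" s] by (intro mult_mono) auto
    then show ?thesis by (simp add: mult.commute)
  qed
  have HHp: "H (r k) t = (LINT s:I t|lebesgue. Hp k (s, t))" for k t by (simp add: H_def Hp_def)
  have GGp: "G (r k) t = (LINT s:I t|lebesgue. Gp k (s, t))" for k t by (simp add: G_def Gp_def)
  have Hb: "\<bar>H (r k) t\<bar> \<le> E * M" if t: "t \<in> {0..<T}" for k t
  proof -
    have "\<bar>H (r k) t\<bar> \<le> E * (LINT s:I t|lebesgue. \<bar>\<gamma> (s, t)\<bar>)"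
      using slice_integrable_bound(2)[OF cHp[of k] t M(2)[OF t], of E] Hpb[OF t] by (simp add: HHp)
    also have "\<dots> \<le> E * M" using mult_left_mono[OF M(3)[OF t] E] .
    finally show ?thesis .
  qed
  define Hi where "Hi t = (LINT s:I t|lebesgue. h (s, t))" for t
  have Hib: "\<bar>Hi t\<bar> \<le> C * M" if t: "t \<in> {0..<T}" for t
  proof -
    have "\<bar>h (s, t)\<bar> \<le> C * \<bar>\<gamma> (s, t)\<bar>" if "s \<in> I t" for s
      using C(3)[of "(s, t)"] t that by (simp add: mem_domain mem_slice)
    then show ?thesis
      using slice_integrable_bound(2)[OF continuous_f(4) t M(2)[OF t], where C = C] mult_left_mono[OF M(3)[OF t] C(1)]
      by (simp add: Hi_def)
  qed
  have Hlim: "(\<lambda>k. H (r k) t) \<longlonglongrightarrow> Hi t" if t: "t \<in> {0..<T}" for t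
    unfolding HHp Hi_def
  proof (rule slice_dominated_convergence[OF t cHp continuous_f(4) M(2)[OF t]])
    show "\<bar>Hp k (s, t)\<bar> \<le> E * \<bar>\<gamma> (s, t)\<bar>" if "s \<in> I t" for k s using Hpb[OF t that] .
    show "(\<lambda>k. Hp k (s, t)) \<longlonglongrightarrow> h (s, t)" for s
      using tendsto_add[OF tendsto_mult[OF tendsto_const cutoff_Suc_tendsto_1] tendsto_mult[OF tendsto_const dcutoff_tendsto_0],
          of "h (s, t)" s "a (s, t) * \<gamma> (s, t) * f (s, t)" s]
      by (simp add: Hp_def r_def)
  qed
  have Glim: "(\<lambda>k. G (r k) 0) \<longlonglongrightarrow> (LINT s:I 0|lebesgue. \<gamma> (s, 0) * f (s, 0))"
    unfolding GGp
  proof (rule slice_dominated_convergence[OF T0 cGp cGf M(2)[OF T0]])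
    show "\<bar>Gp k (s, 0)\<bar> \<le> C * \<bar>\<gamma> (s, 0)\<bar>" if "s \<in> I 0" for k s using Gpb[OF T0 that] .
    show "(\<lambda>k. Gp k (s, 0)) \<longlonglongrightarrow> \<gamma> (s, 0) * f (s, 0)" for s
      using tendsto_mult[OF tendsto_const cutoff_Suc_tendsto_1, of "\<gamma> (s, 0) * f (s, 0)" s]
      by (simp add: Gp_def r_def)
  qed
  have bT: "continuous_on {0..T'} (boundary_term s1)" "continuous_on {0..T'} (boundary_term s0)"
    using b sub continuous_on_subset by blast+
  have bb: "\<exists>B. \<forall>t\<in>{0..T'}. \<bar>g t\<bar> \<le> B" if "continuous_on {0..T'} g" for g :: "real \<Rightarrow> real"
    using compact_imp_bounded[OF compact_continuous_image[OF that]] by (auto simp: bounded_iff)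
  obtain B1 where B1: "\<forall>t\<in>{0..T'}. \<bar>boundary_term s1 t\<bar> \<le> B1" using bb[OF bT(1)] by blast
  obtain B0 where B0: "\<forall>t\<in>{0..T'}. \<bar>boundary_term s0 t\<bar> \<le> B0" using bb[OF bT(2)] by blast
  define D where "D = (\<lambda>k t. H (r k) t + boundary_term s1 t * cutoff (r k) (real_of_ereal (s1 t))
       - boundary_term s0 t * cutoff (r k) (real_of_ereal (s0 t)))"
  have GT: "G (r k) T' = 0" for k using z(1)[of T'] by (simp add: G_def f_def)
  have Dint: "(D k has_integral - G (r k) 0) {0..T'}" for k
  proof -
    have "(D k has_integral G (r k) T' - G (r k) 0) {0..T'}"
    proof (rule fundamental_theorem_of_calculus)
      fix t assume "t \<in> {0..T'}"
      then have "(G (r k) has_real_derivative D k t) (at t within {0..<T})"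
        unfolding D_def using G_derivative[OF _ r0, of t k] sub by auto
      then show "(G (r k) has_vector_derivative D k t) (at t within {0..T'})"
        unfolding has_real_derivative_iff_has_vector_derivative[symmetric] by (rule DERIV_subset) (rule sub)
    qed (use T' in simp)
    then show ?thesis by (simp add: GT)
  qed
  have Db: "norm (D k t) \<le> E * M + B1 + B0" if t: "t \<in> {0..T'}" for k t
  proof -
    have "\<bar>b * cutoff (r k) x\<bar> \<le> B * 1" if "\<bar>b\<bar> \<le> B" for b B x
      unfolding abs_mult using that cutoff_bounds[of "r k" x] by (intro mult_mono) auto
    then have "\<bar>boundary_term s1 t * cutoff (r k) x\<bar> \<le> B1 * 1" "\<bar>boundary_term s0 t * cutoff (r k) x\<bar> \<le> B0 * 1" for x
      using B1 B0 t by blast+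
    moreover have "\<bar>H (r k) t\<bar> \<le> E * M" using Hb t sub by auto
    ultimately show ?thesis
      unfolding D_def real_norm_def mult_1_right by (intro order_trans[OF abs_triangle_ineq4] add_mono order_trans[OF abs_triangle_ineq])
  qed
  have Dlim: "(\<lambda>k. D k t) \<longlonglongrightarrow> Hi t + boundary_term s1 t - boundary_term s0 t" if t: "t \<in> {0..T'}" for t
  proof -
    have "(\<lambda>k. D k t) \<longlonglongrightarrow> Hi t + boundary_term s1 t * 1 - boundary_term s0 t * 1"
      unfolding D_def r_def using t sub Hlim[unfolded r_def, of t]
      by (intro tendsto_intros cutoff_Suc_tendsto_1) auto
    then show ?thesis by simp
  qed
  have ci: "(\<lambda>t. E * M + B1 + B0) integrable_on {0..T'}" by (intro integrable_continuous_real continuous_intros)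
  have Dk: "D k integrable_on {0..T'}" for k using Dint by blast
  note dc = dominated_convergence[OF Dk ci Db Dlim]
  have "(\<lambda>k. - G (r k) 0) \<longlonglongrightarrow> integral {0..T'} (\<lambda>t. Hi t + boundary_term s1 t - boundary_term s0 t)"
    using dc(2) integral_unique[OF Dint] by simp
  then have e1: "integral {0..T'} (\<lambda>t. Hi t + boundary_term s1 t - boundary_term s0 t) = - (LINT s:I 0|lebesgue. \<gamma> (s, 0) * f (s, 0))"
    using LIMSEQ_unique tendsto_minus[OF Glim] by blast
  have bi: "(\<lambda>t. boundary_term s1 t - boundary_term s0 t) integrable_on {0..T'}"
    by (intro integrable_continuous_real continuous_intros bT)
  have Hii: "Hi integrable_on {0..T'}"
    using Henstock_Kurzweil_Integration.integrable_diff[OF dc(1) bi] by simp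
  have e2: "integral {0..T'} (\<lambda>t. Hi t + boundary_term s1 t - boundary_term s0 t)
      = integral {0..T'} Hi + integral {0..T'} (\<lambda>t. boundary_term s1 t - boundary_term s0 t)"
    using Henstock_Kurzweil_Integration.integral_add[OF Hii bi] by (simp add: algebra_simps)
  have Hia: "Hi absolutely_integrable_on {0..T'}"
    by (rule absolutely_integrable_integrable_bound[OF _ Hii, of "\<lambda>_. C * M"])
      (use Hib sub in \<open>auto intro!: integrable_continuous_real\<close>)
  have inner: "(LINT s:I t|lebesgue. \<gamma> (s, t) * (time_deriv \<phi> (\<xi> (s, t)) t + U (s, t) \<bullet> space_grad \<phi> (\<xi> (s, t)) t)) = Hi t"
    if t: "t \<in> {0..<T}" for t
    unfolding Hi_def set_lebesgue_integral_def
  proof (rule Bochner_Integration.integral_cong[OF refl])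
    fix s show "indicator (I t) s *\<^sub>R (\<gamma> (s, t) * (time_deriv \<phi> (\<xi> (s, t)) t + U (s, t) \<bullet> space_grad \<phi> (\<xi> (s, t)) t)) = indicator (I t) s *\<^sub>R h (s, t)"
      using h_eq[of "(s, t)"] t by (cases "s \<in> I t") (auto simp: mem_domain mem_slice)
  qed
  have Hi0: "Hi t = 0" if "t \<ge> T'" for t
    using z that by (simp add: Hi_def h_def ft_def fs_def set_lebesgue_integral_def)
  have "(LINT t:{0<..<T}|lebesgue. LINT s:I t|lebesgue.
      \<gamma> (s, t) * (time_deriv \<phi> (\<xi> (s, t)) t + U (s, t) \<bullet> space_grad \<phi> (\<xi> (s, t)) t))
     = (\<integral>t. indicator (- {0}) t * (indicator {0..T'} t *\<^sub>R Hi t) \<partial>lebesgue)"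
    unfolding set_lebesgue_integral_def[of _ "{0<..<T}"]
  proof (rule Bochner_Integration.integral_cong[OF refl])
    fix t :: real
    show "indicator {0<..<T} t *\<^sub>R (LINT s:I t|lebesgue. \<gamma> (s, t) * (time_deriv \<phi> (\<xi> (s, t)) t + U (s, t) \<bullet> space_grad \<phi> (\<xi> (s, t)) t))
      = indicator (- {0}) t * (indicator {0..T'} t *\<^sub>R Hi t)"
      using inner[of t] Hi0[of t] T' by (auto simp: indicator_def)
  qed
  also have "\<dots> = (\<integral>t. indicator {0..T'} t *\<^sub>R Hi t \<partial>lebesgue)"
  proof (rule integral_cong_AE)
    have m: "(\<lambda>t. indicator {0..T'} t *\<^sub>R Hi t) \<in> borel_measurable lebesgue"
      using Hia unfolding set_integrable_def by (rule borel_measurable_integrable)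
    show "(\<lambda>t. indicator {0..T'} t *\<^sub>R Hi t) \<in> borel_measurable lebesgue" by (rule m)
    show "(\<lambda>t. indicator (- {0}) t * (indicator {0..T'} t *\<^sub>R Hi t)) \<in> borel_measurable lebesgue"
      by (intro borel_measurable_times m borel_measurable_indicator sets_completionI_sets) auto
    have "AE t in lebesgue. t \<notin> {0::real}"
      by (intro AE_not_in null_sets_completionI finite_imp_null_set_lborel) auto
    then show "AE t in lebesgue. indicator (- {0}) t * (indicator {0..T'} t *\<^sub>R Hi t) = indicator {0..T'} t *\<^sub>R Hi t"
      by eventually_elim auto
  qed
  also have "\<dots> = integral {0..T'} Hi"
    using set_lebesgue_integral_eq_integral(2)[OF Hia] by (simp add: set_lebesgue_integral_def)
  finally have e3: "(LINT t:{0<..<T}|lebesgue. LINT s:I t|lebesgue.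
      \<gamma> (s, t) * (time_deriv \<phi> (\<xi> (s, t)) t + U (s, t) \<bullet> space_grad \<phi> (\<xi> (s, t)) t)) = integral {0..T'} Hi" .
  have e4: "(LINT s:I 0|lebesgue. \<gamma> (s, 0) * \<phi> (\<xi> (s, 0), 0)) = (LINT s:I 0|lebesgue. \<gamma> (s, 0) * f (s, 0))"
    by (simp add: f_def)
  show ?thesis
    using T' bz e1 e2 unfolding e3 e4 by (intro exI[of _ T']) auto
qed

end

section \<open>Classical solutions are weak solutions\<close>

context sheet
begin

lemma domain_measurable:
  fixes g :: "real \<times> real \<Rightarrow> 'b::{banach, second_countable_topology}"
  assumes "continuous_on \<Omega> g"
  shows "set_borel_measurable lebesgue \<Omega> g"
proof -
  have "(\<lambda>x. indicator \<Omega> x *\<^sub>R g x) \<in> borel_measurable borel"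
    using borel_measurable_continuous_on_indicator[OF domain_borel assms] .
  then show ?thesis unfolding set_borel_measurable_def by (intro measurable_completion) simp
qed

text \<open>
  On \<open>\<Omega>\<close> the velocity equals \<open>\<xi>\<^sub>t + a \<xi>\<^sub>s\<close>, hence is bounded and continuous; this settles all
  integrability requirements, and with vanishing fluxes \<open>weak_identity\<close> is the weak formulation.
\<close>

theorem classical_solution_is_weak:
  assumes \<xi>: "Ckb_on 1 \<Omega> \<xi>" and \<gamma>: "Ckb_on 1 \<Omega> \<gamma>" and a_C1: "Ckb_on 1 \<Omega> a"
    and motion: "\<And>p. p \<in> \<Omega> \<Longrightarrow> BR_motion_at T s0 s1 \<xi> \<gamma> a p"
    and conservation: "BR_conservation T s0 s1 \<gamma> a"
    and speed: "BR_unit_speed T s0 s1 \<xi>"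
    and L1: "Linf_L1 T s0 s1 \<gamma>"
    and flux: "\<And>\<sigma> t. \<sigma> \<in> {s0, s1} \<Longrightarrow> t \<in> {0..<T} \<Longrightarrow> \<bar>\<sigma> t\<bar> \<noteq> \<infinity> \<Longrightarrow> endpoint_flux T \<gamma> a \<sigma> t = 0"
  shows "weak_BR_solution T s0 s1 \<gamma> \<xi> (\<lambda>s. \<gamma> (s, 0)) (\<lambda>s. \<xi> (s, 0))"
proof -
  let ?V = "velocity s0 s1 \<xi> \<gamma>"
  define W where "W p = pd_t \<Omega> \<xi> p + a p *\<^sub>R pd_s \<Omega> \<xi> p" for p
  have VW: "?V p = W p" and Vdef: "velocity_defined s0 s1 \<xi> \<gamma> p" if "p \<in> \<Omega>" for p
    using motion[OF that] by (auto simp: BR_motion_at_def Let_def W_def)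
  interpret transported_sheet T s0 s1 \<gamma> a \<xi> ?V
  proof
    show "\<gamma> p *\<^sub>R (pd_t \<Omega> \<xi> p + a p *\<^sub>R pd_s \<Omega> \<xi> p) = \<gamma> p *\<^sub>R ?V p" if "p \<in> \<Omega>" for p
      using VW[OF that] by (simp add: W_def)
  qed (use \<gamma> \<xi> Ckb_on_1D[OF a_C1] conservation L1 in auto)
  have T0: "0 \<in> {0..<T}" using T_pos by simp
  obtain M where M: "M \<ge> 0" "\<And>t. t \<in> {0..<T} \<Longrightarrow> set_integrable lebesgue (I t) (\<lambda>s. \<gamma> (s, t))"
    "\<And>t. t \<in> {0..<T} \<Longrightarrow> (LINT s:I t|lebesgue. \<bar>\<gamma> (s, t)\<bar>) \<le> M"
    using slice_L1_bound[OF Ckb_on_1D(1)[OF \<gamma>] L1] by metis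
  show ?thesis
    unfolding weak_BR_solution_def
  proof (intro conjI allI impI)
    show "arclength_parametrized T s0 s1 \<xi>"
      unfolding arclength_parametrized_def
    proof (intro ballI impI)
      fix t x y assume t: "t \<in> {0..<T}" and xy: "x \<in> I t" "y \<in> I t" "x \<le> y"
      have sub: "{x..y} \<subseteq> I t" using slice_ivl xy by blast
      show "curve_length (\<lambda>s. \<xi> (s, t)) x y = ennreal (y - x)"
      proof (rule curve_length_unit_speed[OF xy(3), of _ "\<lambda>s. pd_s \<Omega> \<xi> (s, t)"])
        show "continuous_on {x..y} (\<lambda>s. pd_s \<Omega> \<xi> (s, t))"
          using continuous_on_subset[OF slice_measurable(2)[OF Ckb_on_1D(3)[OF \<xi>] t] sub] .
        fix s assume "s \<in> {x..y}"
        then have st: "(s, t) \<in> \<Omega>" using sub t by (auto simp: mem_domain mem_slice)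
        show "((\<lambda>s. \<xi> (s, t)) has_vector_derivative pd_s \<Omega> \<xi> (s, t)) (at s within {x..y})"
          by (rule has_vector_derivative_within_subset[OF Ckb_on_1_has_vector_derivative(1)[OF \<xi> st]])
            (use sub slice_eq[OF t] in auto)
        show "norm (pd_s \<Omega> \<xi> (s, t)) = 1" using speed st by (auto simp: BR_unit_speed_def Let_def)
      qed
    qed
    show "set_borel_measurable lebesgue \<Omega> \<xi>" using domain_measurable Ckb_on_1D(1)[OF \<xi>] by blast
    show "Linf_L1 T s0 s1 \<gamma>" by (rule L1)
    show "\<forall>p\<in>\<Omega>. velocity_defined s0 s1 \<xi> \<gamma> p" using Vdef by blast
    show "Linf_L1 T s0 s1 (\<lambda>p. \<gamma> p *\<^sub>R ?V p)"
    proof -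
      have cW: "continuous_on \<Omega> (\<lambda>p. \<gamma> p *\<^sub>R W p)"
        unfolding W_def by (intro continuous_intros Ckb_on_1D[OF \<xi>] Ckb_on_1D[OF \<gamma>] Ckb_on_1D[OF a_C1])
      have eq: "(\<lambda>p. indicator \<Omega> p *\<^sub>R (\<gamma> p *\<^sub>R ?V p)) = (\<lambda>p. indicator \<Omega> p *\<^sub>R (\<gamma> p *\<^sub>R W p))"
        using VW by (auto simp: indicator_def)
      have m: "set_borel_measurable lebesgue \<Omega> (\<lambda>p. \<gamma> p *\<^sub>R ?V p)"
        using domain_measurable[OF cW] unfolding set_borel_measurable_def eq .
      obtain C1 C2 C3 where C: "\<forall>p\<in>\<Omega>. norm (pd_t \<Omega> \<xi> p) \<le> C1" "\<forall>p\<in>\<Omega>. norm (a p) \<le> C2" "\<forall>p\<in>\<Omega>. norm (pd_s \<Omega> \<xi> p) \<le> C3"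
        using Ckb_on_1D(6)[OF \<xi>] Ckb_on_1D(2)[OF a_C1] Ckb_on_1D(4)[OF \<xi>] by (auto simp: bounded_iff)
      define C where "C = \<bar>C1\<bar> + \<bar>C2\<bar> * \<bar>C3\<bar>"
      have Wb: "norm (W p) \<le> C" if "p \<in> \<Omega>" for p
      proof -
        have "norm (a p *\<^sub>R pd_s \<Omega> \<xi> p) \<le> \<bar>C2\<bar> * \<bar>C3\<bar>"
          unfolding norm_scaleR using C(2,3) that by (intro mult_mono) force+
        moreover have "norm (pd_t \<Omega> \<xi> p) \<le> \<bar>C1\<bar>" using C(1) that by force
        ultimately show ?thesis unfolding W_def C_def by (intro norm_triangle_le add_mono)
      qed
      have C0: "C \<ge> 0" by (simp add: C_def)
      have b: "set_integrable lebesgue (I t) (\<lambda>s. \<gamma> (s, t) *\<^sub>R ?V (s, t)) \<and>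
          (LINT s:I t|lebesgue. norm (\<gamma> (s, t) *\<^sub>R ?V (s, t))) \<le> C * M" if t: "0 < t \<and> t < T" for t
      proof -
        have t': "t \<in> {0..<T}" using t by simp
        have mem: "(s, t) \<in> \<Omega>" if "s \<in> I t" for s using that t' by (simp add: mem_domain mem_slice)
        have bd: "norm (\<gamma> (s, t) *\<^sub>R W (s, t)) \<le> C * \<bar>\<gamma> (s, t)\<bar>" if "s \<in> I t" for s
          using mult_left_mono[OF Wb[OF mem[OF that]] abs_ge_zero[of "\<gamma> (s, t)"]] by (simp add: mult.commute)
        have e1: "indicator (I t) s *\<^sub>R (\<gamma> (s, t) *\<^sub>R ?V (s, t)) = indicator (I t) s *\<^sub>R (\<gamma> (s, t) *\<^sub>R W (s, t))"
          and e2: "indicator (I t) s *\<^sub>R norm (\<gamma> (s, t) *\<^sub>R ?V (s, t)) = indicator (I t) s *\<^sub>R norm (\<gamma> (s, t) *\<^sub>R W (s, t))" for s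
          using VW[OF mem] by (auto simp: indicator_def)
        have "C * (LINT s:I t|lebesgue. \<bar>\<gamma> (s, t)\<bar>) \<le> C * M" using M(3)[OF t'] C0 by (rule mult_left_mono)
        then show ?thesis
          using slice_integrable_bound(1,3)[OF cW t' M(2)[OF t'] bd]
          unfolding set_integrable_def set_lebesgue_integral_def e1 e2 by auto
      qed
      show ?thesis unfolding Linf_L1_def using m b by (intro conjI exI[of _ "C * M"] AE_I2) auto
    qed
    show "set_integrable lebesgue (I 0) (\<lambda>s. \<gamma> (s, 0))" by (rule M(2)[OF T0])
    show "set_borel_measurable lebesgue (I 0) (\<lambda>s. \<xi> (s, 0))"
      using slice_measurable(1)[OF Ckb_on_1D(1)[OF \<xi>] T0] by (simp add: set_borel_measurable_def)
    fix \<phi> :: "(real^2) \<times> real \<Rightarrow> real" assume \<phi>: "test_function T \<phi>"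
    interpret transported_sheet_test T s0 s1 \<gamma> a \<xi> ?V \<phi> by unfold_locales (rule \<phi>)
    have b0: "boundary_term \<sigma> t = 0" if "\<sigma> \<in> {s0, s1}" "t \<in> {0..<T}" for \<sigma> t
      using flux[OF that] by (simp add: boundary_term_def)
    have "continuous_on {0..<T} (boundary_term \<sigma>)" if "\<sigma> \<in> {s0, s1}" for \<sigma>
      by (rule continuous_on_eq[OF continuous_on_const[of _ 0]]) (simp add: b0[OF that])
    then obtain T' where T': "0 < T'" "T' < T" and eq: "(LINT t:{0<..<T}|lebesgue. LINT s:I t|lebesgue.
      \<gamma> (s, t) * (time_deriv \<phi> (\<xi> (s, t)) t + ?V (s, t) \<bullet> space_grad \<phi> (\<xi> (s, t)) t))
      + integral {0..T'} (\<lambda>t. boundary_term s1 t - boundary_term s0 t)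
      + (LINT s:I 0|lebesgue. \<gamma> (s, 0) * \<phi> (\<xi> (s, 0), 0)) = 0"
      using weak_identity by blast
    have "integral {0..T'} (\<lambda>t. boundary_term s1 t - boundary_term s0 t) = integral {0..T'} (\<lambda>t. 0)"
      using T' b0 by (intro Henstock_Kurzweil_Integration.integral_cong) auto
    with eq show "(LINT t:{0<..<T}|lebesgue. LINT s:I t|lebesgue.
      \<gamma> (s, t) * (time_deriv \<phi> (\<xi> (s, t)) t + ?V (s, t) \<bullet> space_grad \<phi> (\<xi> (s, t)) t))
      + (LINT s:I 0|lebesgue. \<gamma> (s, 0) * \<phi> (\<xi> (s, 0), 0)) = 0" by simp
  qed
qed

end

section \<open>Vector measures with measure divergence on an arc\<close>

lemma inner_perp_self: "perp x \<bullet> x = 0" "x \<bullet> perp x = 0"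
  by (auto simp: perp_def inner_vec_def sum_2)

lemma norm_perp: "norm (perp x) = norm x"
  by (simp add: perp_def norm_eq_sqrt_inner inner_vec_def sum_2 add.commute)

lemma unit_frame_decomposition:
  assumes "norm (x :: real^2) = 1"
  shows "v = (v \<bullet> x) *\<^sub>R x + (v \<bullet> perp x) *\<^sub>R perp x"
proof -
  have "x \<bullet> x = 1" using assms by (simp add: dot_square_norm)
  then have n: "x $ 1 * x $ 1 + x $ 2 * x $ 2 = 1" by (simp add: inner_vec_def sum_2)
  have "v $ 1 = v $ 1 * (x $ 1 * x $ 1 + x $ 2 * x $ 2)" "v $ 2 = v $ 2 * (x $ 1 * x $ 1 + x $ 2 * x $ 2)"
    by (simp_all add: n)
  then show ?thesis
    by (simp add: vec_eq_iff forall_2 perp_def inner_vec_def sum_2 algebra_simps)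
qed

lemma norm_le_frame:
  assumes "norm (x :: real^2) = 1"
  shows "norm v \<le> \<bar>v \<bullet> x\<bar> + \<bar>v \<bullet> perp x\<bar>"
proof -
  have "norm ((v \<bullet> x) *\<^sub>R x + (v \<bullet> perp x) *\<^sub>R perp x) \<le> \<bar>v \<bullet> x\<bar> + \<bar>v \<bullet> perp x\<bar>"
    by (rule norm_triangle_le) (simp add: assms norm_perp)
  then show ?thesis using unit_frame_decomposition[OF assms, of v] by simp
qed

lemma continuous_Icc_bounded:
  fixes f :: "real \<Rightarrow> 'b::real_normed_vector"
  assumes "continuous_on {a..b} f"
  shows "\<exists>B. \<forall>x\<in>{a..b}. norm (f x) \<le> B"
  using compact_imp_bounded[OF compact_continuous_image[OF assms compact_Icc]] by (simp add: bounded_iff)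

abbreviation dderiv :: "((real^2) \<Rightarrow> real) \<Rightarrow> real^2 \<Rightarrow> real^2 \<Rightarrow> real" where
  "dderiv \<psi> y v \<equiv> frechet_derivative \<psi> (at y) v"

text \<open>
  At a fixed time: the vector measure \<open>w ds\<close> on the \<open>C\<^sup>1\<close> arc \<open>c\<close> has distributional
  divergence \<open>- q ds\<close> in the \<open>\<delta>\<close>-ball around \<open>c s\<close>.  The arc is so short that its direction
  stays within 60 degrees of the tangent at \<open>s\<close>; therefore the tangential coordinate \<open>X\<close> is a
  parameter of the arc.
\<close>

locale weak_curve =
  fixes c c' w :: "real \<Rightarrow> real^2" and q :: "real \<Rightarrow> real" and l s u \<delta> :: real
  assumes lsu: "l < s" "s < u"
    and c: "\<And>\<sigma>. \<sigma> \<in> {l..u} \<Longrightarrow> (c has_vector_derivative c' \<sigma>) (at \<sigma> within {l..u})"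
    and c'_cont: "continuous_on {l..u} c'"
    and c'_unit: "\<And>\<sigma>. \<sigma> \<in> {l..u} \<Longrightarrow> norm (c' \<sigma>) = 1"
    and c'_turn: "\<And>\<sigma>. \<sigma> \<in> {l..u} \<Longrightarrow> c' \<sigma> \<bullet> c' s \<ge> 1 / 2"
    and w_cont: "continuous_on {l..u} w" and q_cont: "continuous_on {l..u} q"
    and \<delta>: "\<delta> > 0"
    and weak: "\<And>\<psi>. smooth_alg \<psi> \<Longrightarrow> (\<And>y. norm (y - c s) \<ge> \<delta> \<Longrightarrow> \<psi> y = 0) \<Longrightarrow>
        integral {l..u} (\<lambda>\<sigma>. dderiv \<psi> (c \<sigma>) (w \<sigma>) - q \<sigma> * \<psi> (c \<sigma>)) = 0"
begin

abbreviation "tang \<equiv> c' s"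
abbreviation "nrml \<equiv> perp (c' s)"

definition X where "X \<sigma> = (c \<sigma> - c s) \<bullet> tang"
definition Y where "Y \<sigma> = (c \<sigma> - c s) \<bullet> nrml"

lemma s_mem: "s \<in> {l..u}" using lsu by auto
lemma unit: "norm tang = 1" using c'_unit s_mem by blast

lemma X_deriv: "\<sigma> \<in> {l..u} \<Longrightarrow> (X has_real_derivative c' \<sigma> \<bullet> tang) (at \<sigma> within {l..u})"
  and Y_deriv: "\<sigma> \<in> {l..u} \<Longrightarrow> (Y has_real_derivative c' \<sigma> \<bullet> nrml) (at \<sigma> within {l..u})"
  using c[of \<sigma>] unfolding X_def Y_def has_vector_derivative_def has_field_derivative_def
  by (auto intro!: derivative_eq_intros simp: inner_commute mult.commute)

lemma c_cont: "continuous_on {l..u} c"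
  using c continuous_on_vector_derivative by blast

lemma X_cont: "continuous_on {l..u} X" and Y_cont: "continuous_on {l..u} Y"
  unfolding X_def Y_def by (intro continuous_intros c_cont)+

lemma X_s: "X s = 0" "Y s = 0" by (simp_all add: X_def Y_def)

text \<open>
  With \<open>X_up\<close> this compares \<open>|X \<sigma>|\<close> with \<open>|\<sigma> - s|\<close> from both sides, which turns conditions
  on the position in the plane into conditions on the parameter.
\<close>

lemma X_increase: "a \<in> {l..u} \<Longrightarrow> b \<in> {l..u} \<Longrightarrow> a \<le> b \<Longrightarrow> X b - X a \<ge> (b - a) / 2"
proof -
  assume ab: "a \<in> {l..u}" "b \<in> {l..u}" "a \<le> b"
  have "((\<lambda>\<sigma>. c' \<sigma> \<bullet> tang) has_integral X b - X a) {a..b}"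
  proof (rule fundamental_theorem_of_calculus[OF ab(3)])
    show "(X has_vector_derivative c' x \<bullet> tang) (at x within {a..b})" if "x \<in> {a..b}" for x
      using DERIV_subset[OF X_deriv[of x], of "{a..b}"] that ab
      by (auto simp: has_real_derivative_iff_has_vector_derivative)
  qed
  then have "((\<lambda>\<sigma>. 1 / 2) has_integral (b - a) / 2) {a..b} \<Longrightarrow> (b - a) / 2 \<le> X b - X a"
    by (rule has_integral_le[rotated]) (use c'_turn ab in auto)
  moreover have "((\<lambda>\<sigma>. 1 / 2 :: real) has_integral (b - a) / 2) {a..b}"
    using has_integral_const_real[of "1/2 :: real" a b] ab(3) by simp
  ultimately show ?thesis by blast
qed

lemma X_low: "a \<in> {l..u} \<Longrightarrow> b \<in> {l..u} \<Longrightarrow> \<bar>b - a\<bar> \<le> 2 * \<bar>X b - X a\<bar>"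
  using X_increase[of a b] X_increase[of b a] by (cases "a \<le> b") auto

lemma X_up: "\<sigma> \<in> {l..u} \<Longrightarrow> \<bar>X \<sigma>\<bar> \<le> \<bar>\<sigma> - s\<bar>"
proof -
  assume s: "\<sigma> \<in> {l..u}"
  have "\<bar>X \<sigma>\<bar> \<le> norm (c \<sigma> - c s) * norm tang" unfolding X_def by (rule Cauchy_Schwarz_ineq2)
  also have "\<dots> \<le> 1 * \<bar>\<sigma> - s\<bar> * 1"
    using vector_derivative_lipschitz[of "{l..u}" c c' 1 \<sigma> s] c c'_unit s s_mem unit by auto
  finally show ?thesis by simp
qed

text \<open>
  The arc is tangent to the first axis of the frame, so its normal coordinate is \<open>o(|\<sigma> - s|)\<close>.
\<close>

lemma Y_small:
  assumes "\<kappa> > 0"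
  obtains r where "r > 0" "s - r \<ge> l" "s + r \<le> u" "\<And>\<sigma>. \<bar>\<sigma> - s\<bar> \<le> r \<Longrightarrow> \<bar>Y \<sigma>\<bar> \<le> \<kappa> * \<bar>\<sigma> - s\<bar>"
proof -
  have "(Y has_real_derivative 0) (at s within {l..u})"
    using Y_deriv[OF s_mem] by (simp add: inner_perp_self)
  then have "\<exists>d>0. \<forall>y\<in>{l..u}. norm (y - s) < d \<longrightarrow> norm (Y y - Y s - 0 * (y - s)) \<le> \<kappa> * norm (y - s)"
    unfolding has_field_derivative_def has_derivative_within_alt using assms by blast
  then obtain d where d: "d > 0" "\<And>y. y \<in> {l..u} \<Longrightarrow> \<bar>y - s\<bar> < d \<Longrightarrow> \<bar>Y y\<bar> \<le> \<kappa> * \<bar>y - s\<bar>"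
    by (auto simp: X_s)
  define r where "r = min (d / 2) (min (s - l) (u - s))"
  show thesis
    by (rule that[of r]) (use d lsu in \<open>auto simp: r_def intro!: d(2)\<close>)
qed

lemma smooth_coord: "smooth_alg (\<lambda>y. bump ((y - c s) \<bullet> v / \<rho>))" "smooth_alg (\<lambda>y. (y - c s) \<bullet> v)"
  "smooth_alg (\<lambda>y. step (((y - c s) \<bullet> v - k) / \<rho>))"
proof -
  have e: "(y - c s) \<bullet> v / \<rho> = y \<bullet> (inverse \<rho> *\<^sub>R v) + (- (c s \<bullet> v) / \<rho>)"
    "(y - c s) \<bullet> v = y \<bullet> v + (- (c s \<bullet> v))"
    "((y - c s) \<bullet> v - k) / \<rho> = y \<bullet> (inverse \<rho> *\<^sub>R v) + (- (c s \<bullet> v + k) / \<rho>)" for y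
    by (simp_all add: inner_diff_left divide_inverse algebra_simps)
  show "smooth_alg (\<lambda>y. bump ((y - c s) \<bullet> v / \<rho>))" unfolding e(1) by (rule smooth_alg_bump)
  show "smooth_alg (\<lambda>y. (y - c s) \<bullet> v)" unfolding e(2) by (rule smooth_alg.affine)
  show "smooth_alg (\<lambda>y. step (((y - c s) \<bullet> v - k) / \<rho>))" unfolding e(3) by (rule smooth_alg_step)
qed

lemma small_in_frame: "\<bar>(y - c s) \<bullet> tang\<bar> < \<rho> \<Longrightarrow> \<bar>(y - c s) \<bullet> nrml\<bar> < \<rho> \<Longrightarrow> 2 * \<rho> \<le> \<delta> \<Longrightarrow> norm (y - c s) < \<delta>"
  using norm_le_frame[OF unit, of "y - c s"] by linarith

text \<open>
  Test with \<open>Y\<close> times a bump of size \<open>\<epsilon>\<close>.  On the arc this function is of order \<open>\<kappa> \<epsilon>\<close>,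
  but its normal derivative is \<open>1\<close> near \<open>s\<close>.  So the normal component of \<open>w\<close> contributes
  \<open>g0 \<epsilon>\<close> at least, while all other terms are \<open>O(\<kappa> \<epsilon>)\<close>: a derivative of the bump costs
  \<open>1/\<epsilon>\<close>, is multiplied by \<open>\<kappa> \<epsilon>\<close>, and acts on a set of length \<open>4 \<epsilon>\<close>.
\<close>

lemma normal_estimate:
  assumes \<kappa>: "\<kappa> > 0" "\<kappa> \<le> 1 / 4"
    and W: "\<And>\<sigma>. \<sigma> \<in> {l..u} \<Longrightarrow> norm (w \<sigma>) \<le> W" and Q: "\<And>\<sigma>. \<sigma> \<in> {l..u} \<Longrightarrow> \<bar>q \<sigma>\<bar> \<le> Q"
    and B: "\<And>x. \<bar>dbump x\<bar> \<le> B"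
    and g0: "\<And>\<sigma>. \<sigma> \<in> {l..u} \<Longrightarrow> \<bar>\<sigma> - s\<bar> < d \<Longrightarrow> w \<sigma> \<bullet> nrml \<ge> g0" "d > 0" "g0 > 0"
  shows "g0 \<le> \<kappa> * (8 * (W * B + Q))"
proof -
  obtain r where r: "r > 0" "s - r \<ge> l" "s + r \<le> u" "\<And>\<sigma>. \<bar>\<sigma> - s\<bar> \<le> r \<Longrightarrow> \<bar>Y \<sigma>\<bar> \<le> \<kappa> * \<bar>\<sigma> - s\<bar>"
    by (rule Y_small[OF \<kappa>(1)]) (rule that)
  \<comment> \<open>the arc over \<open>|X| < \<epsilon>\<close> lies in \<open>|\<sigma> - s| < 2 \<epsilon>\<close>, where \<open>r\<close> and \<open>d\<close> control \<open>Y\<close> and \<open>w\<close>\<close>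
  define \<epsilon> where "\<epsilon> = Min {r, d, \<delta>, 1} / 4"
  have \<epsilon>: "\<epsilon> > 0" "2 * \<epsilon> \<le> r" "2 * \<epsilon> < d" "2 * \<epsilon> \<le> \<delta>" "\<epsilon> \<le> 1"
  proof -
    have p: "Min {r, d, \<delta>, 1} > 0" using r(1) g0(2) \<delta> by simp
    have "Min {r, d, \<delta>, 1} \<le> x" if "x \<in> {r, d, \<delta>, 1}" for x using that by (intro Min_le) auto
    then have "Min {r, d, \<delta>, 1} \<le> r" "Min {r, d, \<delta>, 1} \<le> d" "Min {r, d, \<delta>, 1} \<le> \<delta>" "Min {r, d, \<delta>, 1} \<le> 1" by auto
    with p show "\<epsilon> > 0" "2 * \<epsilon> \<le> r" "2 * \<epsilon> < d" "2 * \<epsilon> \<le> \<delta>" "\<epsilon> \<le> 1" unfolding \<epsilon>_def by linarith+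
  qed
  define \<psi> where "\<psi> = (\<lambda>y. (y - c s) \<bullet> nrml * (bump ((y - c s) \<bullet> tang / \<epsilon>) * bump ((y - c s) \<bullet> nrml / \<epsilon>)))"
  have sm: "smooth_alg \<psi>" unfolding \<psi>_def by (intro smooth_alg.mult smooth_coord)
  have supp: "\<psi> y = 0" if "norm (y - c s) \<ge> \<delta>" for y
  proof -
    have "\<bar>(y - c s) \<bullet> tang\<bar> \<ge> \<epsilon> \<or> \<bar>(y - c s) \<bullet> nrml\<bar> \<ge> \<epsilon>"
      using small_in_frame[of y \<epsilon>] \<epsilon>(4) that by linarith
    then have "bump ((y - c s) \<bullet> tang / \<epsilon>) = 0 \<or> bump ((y - c s) \<bullet> nrml / \<epsilon>) = 0"
      using \<epsilon>(1) by (auto intro!: bump_0)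
    then show ?thesis by (auto simp: \<psi>_def)
  qed
  have dd: "dderiv \<psi> y v = (v \<bullet> nrml) * (bump ((y - c s) \<bullet> tang / \<epsilon>) * bump ((y - c s) \<bullet> nrml / \<epsilon>))
      + (y - c s) \<bullet> nrml * (dbump ((y - c s) \<bullet> tang / \<epsilon>) * (v \<bullet> tang / \<epsilon>) * bump ((y - c s) \<bullet> nrml / \<epsilon>)
      + bump ((y - c s) \<bullet> tang / \<epsilon>) * (dbump ((y - c s) \<bullet> nrml / \<epsilon>) * (v \<bullet> nrml / \<epsilon>)))" (is "_ = ?D v") for y v
  proof -
    have b: "((\<lambda>y. bump ((y - c s) \<bullet> e / \<epsilon>)) has_derivative (\<lambda>v. dbump ((y - c s) \<bullet> e / \<epsilon>) * (v \<bullet> e / \<epsilon>))) (at y)" for e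
      by (rule has_derivative_compose[OF _ DERIV_bump[unfolded has_field_derivative_def], of "\<lambda>y. (y - c s) \<bullet> e / \<epsilon>" "\<lambda>v. v \<bullet> e / \<epsilon>"])
        (auto intro!: derivative_eq_intros simp: divide_inverse)
    have "(\<psi> has_derivative ?D) (at y)"
      unfolding \<psi>_def
      by (rule has_derivative_eq_rhs, rule has_derivative_mult, rule has_derivative_inner_left,
          rule has_derivative_diff, rule has_derivative_ident, rule has_derivative_const,
          rule has_derivative_mult, rule b, rule b) (simp add: fun_eq_iff algebra_simps)
    from fun_cong[OF frechet_derivative_at[OF this], symmetric] show ?thesis .
  qed
  define g where "g = (\<lambda>\<sigma>. (w \<sigma> \<bullet> nrml) * bump (X \<sigma> / \<epsilon>) + Y \<sigma> * (dbump (X \<sigma> / \<epsilon>) * (w \<sigma> \<bullet> tang / \<epsilon>)) - q \<sigma> * (Y \<sigma> * bump (X \<sigma> / \<epsilon>)))"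
  have integrand: "dderiv \<psi> (c \<sigma>) (w \<sigma>) - q \<sigma> * \<psi> (c \<sigma>) = g \<sigma>" if s: "\<sigma> \<in> {l..u}" for \<sigma>
  proof (cases "\<bar>X \<sigma>\<bar> < \<epsilon>")
    case True
    then have "\<bar>\<sigma> - s\<bar> < 2 * \<epsilon>" using X_low[OF s_mem s] by (simp add: X_s)
    then have "\<bar>Y \<sigma>\<bar> \<le> \<kappa> * \<bar>\<sigma> - s\<bar>" "\<bar>\<sigma> - s\<bar> \<le> 2 * \<epsilon>" using r(4)[of \<sigma>] \<epsilon>(2) by auto
    moreover have "\<kappa> * \<bar>\<sigma> - s\<bar> \<le> (1 / 4) * (2 * \<epsilon>)" using \<kappa> calculation(2) by (intro mult_mono) auto
    ultimately have "\<bar>Y \<sigma>\<bar> \<le> \<epsilon> / 2" by linarith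
    then have "\<bar>Y \<sigma> / \<epsilon>\<bar> \<le> 1 / 2" using \<epsilon>(1) by (simp add: field_simps)
    then have "bump (Y \<sigma> / \<epsilon>) = 1" "dbump (Y \<sigma> / \<epsilon>) = 0" by (auto intro: bump_1 dbump_0)
    then show ?thesis unfolding dd unfolding \<psi>_def g_def X_def[symmetric] Y_def[symmetric] by simp
  next
    case False
    then have "\<bar>X \<sigma> / \<epsilon>\<bar> \<ge> 1" using \<epsilon>(1) by simp
    then have "bump (X \<sigma> / \<epsilon>) = 0" "dbump (X \<sigma> / \<epsilon>) = 0" by (auto intro: bump_0 dbump_0)
    then show ?thesis unfolding dd unfolding \<psi>_def g_def X_def[symmetric] Y_def[symmetric] by simp
  qed
  let ?J = "{s - 2 * \<epsilon>..s + 2 * \<epsilon>}"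
  have JI: "?J \<subseteq> {l..u}" using r \<epsilon> by auto
  have cg: "continuous_on {l..u} g"
    unfolding g_def using \<epsilon>(1)
    by (intro continuous_intros w_cont q_cont X_cont Y_cont continuous_on_compose2[OF continuous_bump[of UNIV]]
        continuous_on_compose2[OF continuous_dbump[of UNIV]]) auto
  have far: "g \<sigma> = 0" if "\<sigma> \<in> {l..u}" "\<sigma> \<notin> ?J" for \<sigma>
  proof -
    have "\<bar>X \<sigma>\<bar> \<ge> \<epsilon>" using X_low[OF s_mem that(1)] that(2) by (auto simp: X_s abs_if split: if_splits)
    then have "\<bar>X \<sigma> / \<epsilon>\<bar> \<ge> 1" using \<epsilon>(1) by simp
    then have "bump (X \<sigma> / \<epsilon>) = 0" "dbump (X \<sigma> / \<epsilon>) = 0" by (auto intro: bump_0 dbump_0)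
    then show ?thesis by (simp add: g_def)
  qed
  have "integral {l..u} g = 0"
    using weak[OF sm supp] Henstock_Kurzweil_Integration.integral_cong[of "{l..u}", OF integrand] by simp
  then have J0: "integral ?J g = 0" using integral_eq_on_subinterval[OF cg JI far] by simp
  define E where "E = 2 * \<kappa> * (W * B + Q)"
  have W0: "W \<ge> 0" using W[OF s_mem] norm_ge_zero order_trans by blast
  have Q0: "Q \<ge> 0" using Q[OF s_mem] abs_ge_zero order_trans by blast
  have B0: "B \<ge> 0" using B abs_ge_zero order_trans by blast
  have low: "g0 * (if \<bar>\<sigma> - s\<bar> \<le> \<epsilon> / 2 then 1 else 0) - E \<le> g \<sigma>" if J: "\<sigma> \<in> ?J" for \<sigma>
  proof -
    have s: "\<sigma> \<in> {l..u}" using J JI by blast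
    have s2: "\<bar>\<sigma> - s\<bar> \<le> 2 * \<epsilon>" using J by auto
    have "\<bar>Y \<sigma>\<bar> \<le> \<kappa> * \<bar>\<sigma> - s\<bar>" using r(4)[of \<sigma>] s2 \<epsilon>(2) by auto
    also have "\<dots> \<le> \<kappa> * (2 * \<epsilon>)" using s2 \<kappa> by (intro mult_left_mono) auto
    finally have Yb: "\<bar>Y \<sigma>\<bar> \<le> \<kappa> * (2 * \<epsilon>)" .
    have "\<bar>w \<sigma> \<bullet> tang\<bar> \<le> W" using Cauchy_Schwarz_ineq2[of "w \<sigma>" tang] unit W[OF s] by simp
    then have "\<bar>w \<sigma> \<bullet> tang / \<epsilon>\<bar> \<le> W / \<epsilon>" using \<epsilon>(1) by (simp add: divide_right_mono)
    then have "\<bar>Y \<sigma> * (dbump (X \<sigma> / \<epsilon>) * (w \<sigma> \<bullet> tang / \<epsilon>))\<bar> \<le> (\<kappa> * (2 * \<epsilon>)) * (B * (W / \<epsilon>))"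
      unfolding abs_mult using Yb B[of "X \<sigma> / \<epsilon>"] B0 W0 \<epsilon>(1) \<kappa>(1) by (intro mult_mono) auto
    also have "\<dots> = 2 * \<kappa> * (W * B)" using \<epsilon>(1) by simp
    finally have t1: "\<bar>Y \<sigma> * (dbump (X \<sigma> / \<epsilon>) * (w \<sigma> \<bullet> tang / \<epsilon>))\<bar> \<le> 2 * \<kappa> * (W * B)" .
    have "\<bar>q \<sigma> * (Y \<sigma> * bump (X \<sigma> / \<epsilon>))\<bar> \<le> Q * ((\<kappa> * (2 * \<epsilon>)) * 1)"
      unfolding abs_mult using Yb Q[OF s] Q0 bump_bounds[of "X \<sigma> / \<epsilon>"] \<kappa> \<epsilon>(1) by (intro mult_mono) auto
    also have "\<dots> \<le> Q * ((\<kappa> * (2 * 1)) * 1)" using Q0 \<kappa> \<epsilon>(1,5) by (intro mult_mono) auto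
    finally have t2: "\<bar>q \<sigma> * (Y \<sigma> * bump (X \<sigma> / \<epsilon>))\<bar> \<le> 2 * \<kappa> * Q" by (simp add: mult_ac)
    have t3: "g0 * (if \<bar>\<sigma> - s\<bar> \<le> \<epsilon> / 2 then 1 else 0) \<le> (w \<sigma> \<bullet> nrml) * bump (X \<sigma> / \<epsilon>)"
    proof (rule mult_mono)
      show "g0 \<le> w \<sigma> \<bullet> nrml" using g0(1)[OF s] s2 \<epsilon>(3) by simp
      then show "0 \<le> w \<sigma> \<bullet> nrml" using g0(3) by simp
      show "(if \<bar>\<sigma> - s\<bar> \<le> \<epsilon> / 2 then 1 else 0) \<le> bump (X \<sigma> / \<epsilon>)"
      proof (cases "\<bar>\<sigma> - s\<bar> \<le> \<epsilon> / 2")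
        case True
        then have "\<bar>X \<sigma>\<bar> \<le> \<epsilon> / 2" using X_up[OF s] by linarith
        then have "\<bar>X \<sigma> / \<epsilon>\<bar> \<le> 1 / 2" using \<epsilon>(1) by (simp add: field_simps)
        then show ?thesis by (simp add: bump_1)
      qed (simp add: bump_bounds)
    qed auto
    have "E = 2 * \<kappa> * (W * B) + 2 * \<kappa> * Q" by (simp add: E_def algebra_simps)
    then show ?thesis unfolding g_def using t1 t2 t3 by linarith
  qed
  let ?k = "\<lambda>\<sigma>. if \<sigma> \<in> {s - \<epsilon> / 2..s + \<epsilon> / 2} then g0 else 0"
  have "(?k has_integral g0 * \<epsilon>) ?J"
  proof (subst has_integral_restrict)
    show "{s - \<epsilon> / 2..s + \<epsilon> / 2} \<subseteq> ?J" using \<epsilon>(1) by auto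
    show "((\<lambda>\<sigma>. g0) has_integral g0 * \<epsilon>) {s - \<epsilon> / 2..s + \<epsilon> / 2}"
      using has_integral_const_real[of g0 "s - \<epsilon> / 2" "s + \<epsilon> / 2"] \<epsilon>(1) by (simp add: mult.commute)
  qed
  moreover have "((\<lambda>\<sigma>. E) has_integral E * (4 * \<epsilon>)) ?J"
    using has_integral_const_real[of E "s - 2 * \<epsilon>" "s + 2 * \<epsilon>"] \<epsilon>(1) by (simp add: mult.commute)
  ultimately have k: "((\<lambda>\<sigma>. ?k \<sigma> - E) has_integral g0 * \<epsilon> - E * (4 * \<epsilon>)) ?J" by (rule has_integral_diff)
  have "(g has_integral 0) ?J"
    using integrable_integral[OF integrable_continuous_real[OF continuous_on_subset[OF cg JI]]] J0 by simp
  moreover have "?k \<sigma> - E \<le> g \<sigma>" if "\<sigma> \<in> ?J" for \<sigma>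
  proof -
    have "?k \<sigma> = g0 * (if \<bar>\<sigma> - s\<bar> \<le> \<epsilon> / 2 then 1 else 0)" by (auto simp: abs_if)
    then show ?thesis using low[OF that] by simp
  qed
  ultimately have "g0 * \<epsilon> - E * (4 * \<epsilon>) \<le> 0" using has_integral_le[OF k] by blast
  then have "g0 * \<epsilon> \<le> (4 * E) * \<epsilon>" by (simp add: mult_ac)
  then have "g0 \<le> 4 * E" using \<epsilon>(1) by simp
  then show ?thesis by (simp add: E_def algebra_simps)
qed

end

lemma dbump_bounded: obtains B where "\<And>x. \<bar>dbump x\<bar> \<le> B"
proof -
  obtain B where B: "\<forall>x\<in>{-1..1}. norm (dbump x) \<le> B" using continuous_Icc_bounded[OF continuous_dbump] by blast
  show thesis
  proof (rule that[of "max B 0"])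
    show "\<bar>dbump x\<bar> \<le> max B 0" for x
      using B[rule_format, of x] dbump_0[of x] by (cases "\<bar>x\<bar> \<le> 1") (auto simp: abs_le_iff)
  qed
qed

lemma (in weak_curve) weak_curve_uminus: "weak_curve c c' (\<lambda>\<sigma>. - w \<sigma>) (\<lambda>\<sigma>. - q \<sigma>) l s u \<delta>"
proof
  fix \<psi> :: "real^2 \<Rightarrow> real" assume \<psi>: "smooth_alg \<psi>" "\<And>y. \<delta> \<le> norm (y - c s) \<Longrightarrow> \<psi> y = 0"
  have lin: "dderiv \<psi> y (- v) = - dderiv \<psi> y v" for y v
    using linear_neg[OF linear_frechet_derivative[OF smooth_alg_differentiable[OF \<psi>(1)]]] .
  have e: "(\<lambda>\<sigma>. dderiv \<psi> (c \<sigma>) (- w \<sigma>) - (- q \<sigma>) * \<psi> (c \<sigma>)) = (\<lambda>\<sigma>. - (dderiv \<psi> (c \<sigma>) (w \<sigma>) - q \<sigma> * \<psi> (c \<sigma>)))"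
    by (simp add: lin)
  show "integral {l..u} (\<lambda>\<sigma>. dderiv \<psi> (c \<sigma>) (- w \<sigma>) - (- q \<sigma>) * \<psi> (c \<sigma>)) = 0"
    unfolding e Henstock_Kurzweil_Integration.integral_neg by (simp add: weak[OF \<psi>])
qed (use lsu c c'_cont c'_unit c'_turn w_cont q_cont \<delta> in \<open>auto intro!: continuous_intros\<close>)

text \<open>
  \<open>normal_estimate\<close> holds for every \<open>\<kappa>\<close> with constants that do not depend on it.
\<close>

lemma (in weak_curve) normal_le_0: "w s \<bullet> nrml \<le> 0"
proof (rule ccontr)
  assume "\<not> w s \<bullet> nrml \<le> 0"
  then have pos: "w s \<bullet> nrml > 0" by simp
  define g0 where "g0 = (w s \<bullet> nrml) / 2"
  have g0: "g0 > 0" using pos by (simp add: g0_def)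
  have cw: "continuous_on {l..u} (\<lambda>\<sigma>. w \<sigma> \<bullet> nrml)" by (intro continuous_intros w_cont)
  obtain d where d: "d > 0" "\<And>\<sigma>. \<sigma> \<in> {l..u} \<Longrightarrow> \<bar>\<sigma> - s\<bar> < d \<Longrightarrow> \<bar>w \<sigma> \<bullet> nrml - w s \<bullet> nrml\<bar> < g0"
    using cw g0 s_mem unfolding continuous_on_iff dist_real_def by meson
  have dg: "w \<sigma> \<bullet> nrml \<ge> g0" if "\<sigma> \<in> {l..u}" "\<bar>\<sigma> - s\<bar> < d" for \<sigma>
    using d(2)[OF that] unfolding g0_def by linarith
  obtain B where B: "\<And>x. \<bar>dbump x\<bar> \<le> B" using dbump_bounded by blast
  obtain W where W: "norm (w \<sigma>) \<le> W" if "\<sigma> \<in> {l..u}" for \<sigma>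
    using continuous_Icc_bounded[OF w_cont] by blast
  obtain Q where Q: "\<bar>q \<sigma>\<bar> \<le> Q" if "\<sigma> \<in> {l..u}" for \<sigma>
    using continuous_Icc_bounded[OF q_cont] unfolding real_norm_def by blast
  define Z where "Z = \<bar>8 * (W * B + Q)\<bar> + 1"
  define \<kappa> where "\<kappa> = min (1 / 4) (g0 / (2 * Z))"
  have Z: "Z > 0" by (simp add: Z_def)
  have \<kappa>: "\<kappa> > 0" "\<kappa> \<le> 1 / 4" using g0 Z by (auto simp: \<kappa>_def)
  have "g0 \<le> \<kappa> * (8 * (W * B + Q))" by (rule normal_estimate[OF \<kappa> W Q B dg d(1) g0])
  also have "\<dots> \<le> \<kappa> * Z" using \<kappa> by (intro mult_left_mono) (auto simp: Z_def)
  also have "\<dots> \<le> (g0 / (2 * Z)) * Z" using Z by (intro mult_right_mono) (auto simp: \<kappa>_def)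
  also have "\<dots> < g0" using Z g0 by simp
  finally show False by simp
qed

lemma (in weak_curve) normal_eq_0: "w s \<bullet> nrml = 0"
  using normal_le_0 weak_curve.normal_le_0[OF weak_curve_uminus] by simp

context weak_curve
begin

lemma vector_derivative_of_pullback:
  assumes "smooth_alg \<psi>" "\<sigma> \<in> {l..u}"
  shows "((\<lambda>\<sigma>. \<psi> (c \<sigma>)) has_real_derivative dderiv \<psi> (c \<sigma>) (c' \<sigma>)) (at \<sigma> within {l..u})"
proof -
  have D: "(\<psi> has_derivative frechet_derivative \<psi> (at (c \<sigma>))) (at (c \<sigma>))"
    using smooth_alg_differentiable[OF assms(1)] frechet_derivative_works by blast
  have lin: "linear (frechet_derivative \<psi> (at (c \<sigma>)))"
    using linear_frechet_derivative[OF smooth_alg_differentiable[OF assms(1)]] .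
  show ?thesis
    using has_derivative_compose[OF c[OF assms(2), unfolded has_vector_derivative_def] D]
    unfolding has_field_derivative_def linear_scale[OF lin] by (simp add: mult.commute[of _ "dderiv _ _ _"])
qed

text \<open>
  Differentiating a steep step in the coordinate \<open>X\<close> gives an approximate identity on the arc: the
  kernel is nonnegative because \<open>X\<close> increases, it has integral exactly \<open>1\<close>, and it lives within
  \<open>2 \<epsilon>\<close> of \<open>s1\<close>.
\<close>

lemma step_kernel:
  assumes s1: "s1 \<in> {l..u}" and e: "\<epsilon> > 0" and ends: "X l \<le> X s1" "X s1 + \<epsilon> \<le> X u"
    and E: "continuous_on {l..u} E" and \<eta>: "\<And>\<sigma>. \<sigma> \<in> {l..u} \<Longrightarrow> \<bar>\<sigma> - s1\<bar> \<le> 2 * \<epsilon> \<Longrightarrow> \<bar>E \<sigma> - E s1\<bar> \<le> \<eta>"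
  defines "k \<equiv> (\<lambda>\<sigma>. dstep ((X \<sigma> - X s1) / \<epsilon>) * ((c' \<sigma> \<bullet> tang) / \<epsilon>))"
  shows "continuous_on {l..u} k"
    and "\<And>\<sigma>. \<sigma> \<in> {l..u} \<Longrightarrow> ((\<lambda>\<sigma>. step ((X \<sigma> - X s1) / \<epsilon>)) has_real_derivative k \<sigma>) (at \<sigma> within {l..u})"
    and "\<bar>integral {l..u} (\<lambda>\<sigma>. E \<sigma> * k \<sigma>) - E s1\<bar> \<le> \<eta>"
proof -
  show ck: "continuous_on {l..u} k"
    unfolding k_def by (intro continuous_intros c'_cont X_cont continuous_on_compose2[OF continuous_dstep[of UNIV]]) (use e in auto)
  show der: "((\<lambda>\<sigma>. step ((X \<sigma> - X s1) / \<epsilon>)) has_real_derivative k \<sigma>) (at \<sigma> within {l..u})" if "\<sigma> \<in> {l..u}" for \<sigma>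
  proof -
    have "((\<lambda>\<sigma>. (X \<sigma> - X s1) / \<epsilon>) has_real_derivative (c' \<sigma> \<bullet> tang) / \<epsilon>) (at \<sigma> within {l..u})"
      using X_deriv[OF that] e by (auto intro!: derivative_eq_intros)
    from DERIV_chain2[OF DERIV_step this] show ?thesis unfolding k_def .
  qed
  have k0: "k \<sigma> \<ge> 0" if "\<sigma> \<in> {l..u}" for \<sigma>
    unfolding k_def using dstep_nonneg c'_turn[OF that] e by (intro mult_nonneg_nonneg divide_nonneg_pos) auto
  have "(k has_integral step ((X u - X s1) / \<epsilon>) - step ((X l - X s1) / \<epsilon>)) {l..u}"
    using lsu der by (intro fundamental_theorem_of_calculus) (auto simp: has_real_derivative_iff_has_vector_derivative)
  moreover have "step ((X u - X s1) / \<epsilon>) = 1" using ends(2) e by (intro step_1) (simp add: field_simps)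
  moreover have "step ((X l - X s1) / \<epsilon>) = 0" using ends(1) e by (intro step_0) (simp add: divide_nonpos_pos)
  ultimately have k1: "(k has_integral 1) {l..u}" by simp
  have iE: "(\<lambda>\<sigma>. E \<sigma> * k \<sigma>) integrable_on {l..u}"
    by (intro integrable_continuous_real continuous_intros E ck)
  have "((\<lambda>\<sigma>. E \<sigma> * k \<sigma> - E s1 * k \<sigma>) has_integral integral {l..u} (\<lambda>\<sigma>. E \<sigma> * k \<sigma>) - E s1 * 1) {l..u}"
    by (intro has_integral_diff integrable_integral[OF iE] has_integral_mult_right k1)
  then have iv: "integral {l..u} (\<lambda>\<sigma>. E \<sigma> * k \<sigma> - E s1 * k \<sigma>) = integral {l..u} (\<lambda>\<sigma>. E \<sigma> * k \<sigma>) - E s1"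
    by (simp add: integral_unique)
  have "norm (integral {l..u} (\<lambda>\<sigma>. E \<sigma> * k \<sigma> - E s1 * k \<sigma>)) \<le> integral {l..u} (\<lambda>\<sigma>. \<eta> * k \<sigma>)"
  proof (rule integral_norm_bound_integral)
    show "(\<lambda>\<sigma>. E \<sigma> * k \<sigma> - E s1 * k \<sigma>) integrable_on {l..u}" "(\<lambda>\<sigma>. \<eta> * k \<sigma>) integrable_on {l..u}"
      by (intro integrable_continuous_real continuous_intros E ck)+
    fix \<sigma> assume s: "\<sigma> \<in> {l..u}"
    show "norm (E \<sigma> * k \<sigma> - E s1 * k \<sigma>) \<le> \<eta> * k \<sigma>"
    proof (cases "\<bar>\<sigma> - s1\<bar> \<le> 2 * \<epsilon>")
      case True
      have "norm (E \<sigma> * k \<sigma> - E s1 * k \<sigma>) = \<bar>E \<sigma> - E s1\<bar> * k \<sigma>"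
        using k0[OF s] by (simp add: abs_mult flip: left_diff_distrib)
      also have "\<dots> \<le> \<eta> * k \<sigma>" using \<eta>[OF s True] k0[OF s] by (rule mult_right_mono)
      finally show ?thesis .
    next
      case False
      then have "\<bar>X \<sigma> - X s1\<bar> \<ge> \<epsilon>" using X_low[OF s1 s] by simp
      then have "(X \<sigma> - X s1) / \<epsilon> \<le> 0 \<or> (X \<sigma> - X s1) / \<epsilon> \<ge> 1"
        using e by (auto simp: abs_if divide_le_0_iff field_simps split: if_splits)
      then have "k \<sigma> = 0" by (auto simp: k_def dstep_eq_0)
      then show ?thesis by simp
    qed
  qed
  also have "integral {l..u} (\<lambda>\<sigma>. \<eta> * k \<sigma>) = \<eta>"
    using integral_unique[OF has_integral_mult_right[OF k1, of \<eta>]] by simp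
  finally show "\<bar>integral {l..u} (\<lambda>\<sigma>. E \<sigma> * k \<sigma>) - E s1\<bar> \<le> \<eta>" by (simp add: iv)
qed

text \<open>
  Put \<open>E = m + \<integral>q\<close>; it has to be locally constant.  Test with a function that jumps from \<open>0\<close>
  to \<open>1\<close> at the tangential coordinate of \<open>s1\<close>, back at that of \<open>s2\<close>, and is cut off in the
  normal direction by a bump that equals \<open>1\<close> on the arc.  After an integration by parts the identity
  compares the averages of \<open>E\<close> near \<open>s1\<close> and near \<open>s2\<close>.
\<close>

lemma tangential_derivative:
  assumes m: "continuous_on {l..u} m" and wm: "\<And>\<sigma>. \<sigma> \<in> {l..u} \<Longrightarrow> w \<sigma> = m \<sigma> *\<^sub>R c' \<sigma>"
  shows "(m has_real_derivative - q s) (at s)"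
proof -
  obtain r where r: "r > 0" "s - r \<ge> l" "s + r \<le> u" "\<And>\<sigma>. \<bar>\<sigma> - s\<bar> \<le> r \<Longrightarrow> \<bar>Y \<sigma>\<bar> \<le> (1 / 4) * \<bar>\<sigma> - s\<bar>"
    by (rule Y_small[of "1 / 4"]) (simp, rule that)
  define \<rho> where "\<rho> = min r \<delta> / 2"
  have \<rho>: "\<rho> > 0" "2 * \<rho> \<le> r" "2 * \<rho> \<le> \<delta>" using r(1) \<delta> by (auto simp: \<rho>_def min_def)
  define Q where "Q = (\<lambda>\<sigma>. integral {l..\<sigma>} q)"
  have Qd: "(Q has_real_derivative q \<sigma>) (at \<sigma> within {l..u})" if "\<sigma> \<in> {l..u}" for \<sigma>
    unfolding Q_def has_real_derivative_iff_has_vector_derivative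
    using integral_has_vector_derivative[OF q_cont that] .
  have Qc: "continuous_on {l..u} Q" by (rule DERIV_continuous_on[OF Qd])
  define E where "E = (\<lambda>\<sigma>. m \<sigma> + Q \<sigma>)"
  have Ec: "continuous_on {l..u} E" unfolding E_def by (intro continuous_intros m Qc)
  have Xl: "X l \<le> - \<rho>" and Xu: "X u \<ge> \<rho>"
    using X_increase[of l s] X_increase[of s u] lsu r(2,3) \<rho>(2) by (auto simp: X_s)
  have same: "\<bar>E s1 - E s2\<bar> \<le> 2 * \<eta>" if s12: "\<bar>s1 - s\<bar> < \<rho> / 2" "\<bar>s2 - s\<bar> < \<rho> / 2" and \<eta>: "\<eta> > 0" for s1 s2 \<eta>
  proof -
    have "\<bar>s1 - s\<bar> \<le> r" "\<bar>s2 - s\<bar> \<le> r" using s12 \<rho> by auto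
    then have mem: "s1 \<in> {l..u}" "s2 \<in> {l..u}" using r(2,3) by (auto simp: abs_le_iff)
    have X12: "\<bar>X s1\<bar> < \<rho> / 2" "\<bar>X s2\<bar> < \<rho> / 2" using X_up[OF mem(1)] X_up[OF mem(2)] s12 by auto
    obtain d1 where d1: "d1 > 0" "\<And>\<sigma>. \<sigma> \<in> {l..u} \<Longrightarrow> \<bar>\<sigma> - s1\<bar> < d1 \<Longrightarrow> \<bar>E \<sigma> - E s1\<bar> < \<eta>"
      using Ec \<eta> mem unfolding continuous_on_iff dist_real_def by meson
    obtain d2 where d2: "d2 > 0" "\<And>\<sigma>. \<sigma> \<in> {l..u} \<Longrightarrow> \<bar>\<sigma> - s2\<bar> < d2 \<Longrightarrow> \<bar>E \<sigma> - E s2\<bar> < \<eta>"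
      using Ec \<eta> mem unfolding continuous_on_iff dist_real_def by meson
    define \<epsilon> where "\<epsilon> = min (\<rho> / 2) (min d1 d2 / 4)"
    have \<epsilon>: "\<epsilon> > 0" "\<epsilon> \<le> \<rho> / 2" "2 * \<epsilon> < d1" "2 * \<epsilon> < d2" using \<rho>(1) d1(1) d2(1) by (auto simp: \<epsilon>_def min_def)
    have pre1: "X l \<le> X s1" "X s1 + \<epsilon> \<le> X u" and pre2: "X l \<le> X s2" "X s2 + \<epsilon> \<le> X u"
      using X12 Xl Xu \<epsilon>(2) \<rho>(1) by (simp_all add: abs_less_iff)
    have c1: "\<bar>E \<sigma> - E s1\<bar> \<le> \<eta>" if "\<sigma> \<in> {l..u}" "\<bar>\<sigma> - s1\<bar> \<le> 2 * \<epsilon>" for \<sigma>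
      using d1(2)[OF that(1)] that(2) \<epsilon>(3) by simp
    have c2: "\<bar>E \<sigma> - E s2\<bar> \<le> \<eta>" if "\<sigma> \<in> {l..u}" "\<bar>\<sigma> - s2\<bar> \<le> 2 * \<epsilon>" for \<sigma>
      using d2(2)[OF that(1)] that(2) \<epsilon>(4) by simp
    define k where "k = (\<lambda>a \<sigma>. dstep ((X \<sigma> - X a) / \<epsilon>) * ((c' \<sigma> \<bullet> tang) / \<epsilon>))"
    have K1: "continuous_on {l..u} (k s1)" "\<And>\<sigma>. \<sigma> \<in> {l..u} \<Longrightarrow> ((\<lambda>\<sigma>. step ((X \<sigma> - X s1) / \<epsilon>)) has_real_derivative k s1 \<sigma>) (at \<sigma> within {l..u})"
      "\<bar>integral {l..u} (\<lambda>\<sigma>. E \<sigma> * k s1 \<sigma>) - E s1\<bar> \<le> \<eta>"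
      unfolding k_def by (rule step_kernel[OF mem(1) \<epsilon>(1) pre1 Ec c1]; assumption)+
    have K2: "continuous_on {l..u} (k s2)" "\<And>\<sigma>. \<sigma> \<in> {l..u} \<Longrightarrow> ((\<lambda>\<sigma>. step ((X \<sigma> - X s2) / \<epsilon>)) has_real_derivative k s2 \<sigma>) (at \<sigma> within {l..u})"
      "\<bar>integral {l..u} (\<lambda>\<sigma>. E \<sigma> * k s2 \<sigma>) - E s2\<bar> \<le> \<eta>"
      unfolding k_def by (rule step_kernel[OF mem(2) \<epsilon>(1) pre2 Ec c2]; assumption)+
    define p where "p = (\<lambda>x. step ((x - X s1) / \<epsilon>) - step ((x - X s2) / \<epsilon>))"
    have p0: "p x = 0" if "\<bar>x\<bar> \<ge> \<rho>" for x
    proof (cases "x \<ge> 0")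
      case True
      then have "x - X s1 \<ge> \<epsilon>" "x - X s2 \<ge> \<epsilon>" using that X12 \<epsilon>(2) by auto
      then have "step ((x - X s1) / \<epsilon>) = 1" "step ((x - X s2) / \<epsilon>) = 1" using \<epsilon>(1) by (auto intro!: step_1)
      then show ?thesis by (simp add: p_def)
    next
      case False
      then have "x - X s1 \<le> 0" "x - X s2 \<le> 0" using that X12 by auto
      then have "step ((x - X s1) / \<epsilon>) = 0" "step ((x - X s2) / \<epsilon>) = 0" using \<epsilon>(1) by (auto intro!: step_0 divide_nonpos_pos)
      then show ?thesis by (simp add: p_def)
    qed
    define \<psi> where "\<psi> = (\<lambda>y. (step (((y - c s) \<bullet> tang - X s1) / \<epsilon>) + (- 1) * step (((y - c s) \<bullet> tang - X s2) / \<epsilon>)) * bump ((y - c s) \<bullet> nrml / \<rho>))"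
    have \<psi>p: "\<psi> y = p ((y - c s) \<bullet> tang) * bump ((y - c s) \<bullet> nrml / \<rho>)" for y by (simp add: \<psi>_def p_def)
    have sm: "smooth_alg \<psi>" unfolding \<psi>_def by (intro smooth_alg.mult smooth_alg.add smooth_alg.const smooth_coord)
    have supp: "\<psi> y = 0" if "norm (y - c s) \<ge> \<delta>" for y
    proof -
      have "\<bar>(y - c s) \<bullet> tang\<bar> \<ge> \<rho> \<or> \<bar>(y - c s) \<bullet> nrml\<bar> \<ge> \<rho>"
        using small_in_frame[of y \<rho>] \<rho>(3) that by linarith
      then show ?thesis unfolding \<psi>p using p0 \<rho>(1) by (auto intro!: bump_0)
    qed
    have pull: "\<psi> (c \<sigma>) = p (X \<sigma>)" if s: "\<sigma> \<in> {l..u}" for \<sigma>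
    proof (cases "\<bar>X \<sigma>\<bar> < \<rho>")
      case True
      then have "\<bar>\<sigma> - s\<bar> < 2 * \<rho>" using X_low[OF s_mem s] by (simp add: X_s)
      then have "\<bar>Y \<sigma>\<bar> \<le> \<rho> / 2" using r(4)[of \<sigma>] \<rho>(2) by simp
      then have "\<bar>Y \<sigma> / \<rho>\<bar> \<le> 1 / 2" using \<rho>(1) by (simp add: field_simps)
      then show ?thesis by (simp add: \<psi>p bump_1 flip: X_def Y_def)
    qed (use p0 in \<open>simp add: \<psi>p flip: X_def\<close>)
    have pd: "((\<lambda>\<sigma>. p (X \<sigma>)) has_real_derivative k s1 \<sigma> - k s2 \<sigma>) (at \<sigma> within {l..u})" if "\<sigma> \<in> {l..u}" for \<sigma>
      unfolding p_def using K1(2)[OF that] K2(2)[OF that] by (rule DERIV_diff)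
    have dd: "dderiv \<psi> (c \<sigma>) (c' \<sigma>) = k s1 \<sigma> - k s2 \<sigma>" if s: "\<sigma> \<in> {l..u}" for \<sigma>
    proof -
      have "((\<lambda>\<sigma>. p (X \<sigma>)) has_real_derivative dderiv \<psi> (c \<sigma>) (c' \<sigma>)) (at \<sigma> within {l..u})"
        by (rule has_field_derivative_transform_within[OF vector_derivative_of_pullback[OF sm s] zero_less_one s]) (rule pull)
      then show ?thesis
        using vector_derivative_unique_within_closed_interval[of l u \<sigma> "\<lambda>\<sigma>. p (X \<sigma>)"] pd[OF s] s lsu
        by (simp add: has_real_derivative_iff_has_vector_derivative)
    qed
    have "integral {l..u} (\<lambda>\<sigma>. m \<sigma> * (k s1 \<sigma> - k s2 \<sigma>) - q \<sigma> * p (X \<sigma>)) = integral {l..u} (\<lambda>\<sigma>. dderiv \<psi> (c \<sigma>) (w \<sigma>) - q \<sigma> * \<psi> (c \<sigma>))"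
    proof (rule Henstock_Kurzweil_Integration.integral_cong)
      fix \<sigma> assume s: "\<sigma> \<in> {l..u}"
      have "dderiv \<psi> (c \<sigma>) (m \<sigma> *\<^sub>R c' \<sigma>) = m \<sigma> *\<^sub>R dderiv \<psi> (c \<sigma>) (c' \<sigma>)"
        using linear_scale[OF linear_frechet_derivative[OF smooth_alg_differentiable[OF sm]]] .
      then show "m \<sigma> * (k s1 \<sigma> - k s2 \<sigma>) - q \<sigma> * p (X \<sigma>) = dderiv \<psi> (c \<sigma>) (w \<sigma>) - q \<sigma> * \<psi> (c \<sigma>)"
        by (simp add: wm[OF s] dd[OF s] pull[OF s])
    qed
    also have "\<dots> = 0" by (rule weak[OF sm supp])
    finally have A: "integral {l..u} (\<lambda>\<sigma>. m \<sigma> * (k s1 \<sigma> - k s2 \<sigma>) - q \<sigma> * p (X \<sigma>)) = 0" .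
    have pc: "continuous_on {l..u} (\<lambda>\<sigma>. p (X \<sigma>))" by (rule DERIV_continuous_on[OF pd])
    have "((\<lambda>\<sigma>. q \<sigma> * p (X \<sigma>) + Q \<sigma> * (k s1 \<sigma> - k s2 \<sigma>)) has_integral Q u * p (X u) - Q l * p (X l)) {l..u}"
    proof (rule fundamental_theorem_of_calculus)
      show "l \<le> u" using lsu by simp
      show "((\<lambda>\<sigma>. Q \<sigma> * p (X \<sigma>)) has_vector_derivative q \<sigma> * p (X \<sigma>) + Q \<sigma> * (k s1 \<sigma> - k s2 \<sigma>)) (at \<sigma> within {l..u})"
        if "\<sigma> \<in> {l..u}" for \<sigma>
        using DERIV_mult[OF Qd[OF that] pd[OF that]]
        by (simp add: has_real_derivative_iff_has_vector_derivative algebra_simps)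
    qed
    moreover have "p (X u) = 0" "p (X l) = 0" using p0 Xl Xu by auto
    ultimately have B: "((\<lambda>\<sigma>. q \<sigma> * p (X \<sigma>) + Q \<sigma> * (k s1 \<sigma> - k s2 \<sigma>)) has_integral 0) {l..u}" by simp
    have Aint: "((\<lambda>\<sigma>. m \<sigma> * (k s1 \<sigma> - k s2 \<sigma>) - q \<sigma> * p (X \<sigma>)) has_integral 0) {l..u}"
    proof -
      have "(\<lambda>\<sigma>. m \<sigma> * (k s1 \<sigma> - k s2 \<sigma>) - q \<sigma> * p (X \<sigma>)) integrable_on {l..u}"
        by (intro integrable_continuous_real continuous_intros m K1(1) K2(1) q_cont pc)
      from integrable_integral[OF this] show ?thesis by (simp add: A)
    qed
    have C: "((\<lambda>\<sigma>. E \<sigma> * k s1 \<sigma> - E \<sigma> * k s2 \<sigma>) has_integral 0 + 0) {l..u}"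
      by (rule has_integral_eq[OF _ has_integral_add[OF Aint B]]) (simp add: E_def algebra_simps)
    have "integral {l..u} (\<lambda>\<sigma>. E \<sigma> * k s1 \<sigma>) - integral {l..u} (\<lambda>\<sigma>. E \<sigma> * k s2 \<sigma>) = 0"
      using integral_unique[OF C] integrable_continuous_real[OF continuous_on_mult[OF Ec K1(1)]]
        integrable_continuous_real[OF continuous_on_mult[OF Ec K2(1)]]
      by (simp add: Henstock_Kurzweil_Integration.integral_diff)
    then show ?thesis using K1(3) K2(3) by linarith
  qed
  have const: "E \<sigma> = E s" if "\<bar>\<sigma> - s\<bar> < \<rho> / 2" for \<sigma>
  proof -
    have "\<bar>E \<sigma> - E s\<bar> \<le> 0 + e" if e: "e > 0" for e
      using same[of \<sigma> s "e / 2"] \<open>\<bar>\<sigma> - s\<bar> < \<rho> / 2\<close> \<rho>(1) e by simp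
    then have "\<bar>E \<sigma> - E s\<bar> \<le> 0" by (rule field_le_epsilon)
    then show ?thesis by simp
  qed
  have "(Q has_real_derivative q s) (at s)"
    using Qd[OF s_mem] at_within_interior[of s "{l..u}"] lsu by (simp add: interior_atLeastAtMost_real)
  then have EQ: "((\<lambda>\<sigma>. E s - Q \<sigma>) has_real_derivative - q s) (at s)" by (auto intro!: derivative_eq_intros)
  have m_eq: "E s - Q \<sigma> = m \<sigma>" if "dist \<sigma> s < \<rho> / 2" for \<sigma>
    using const[of \<sigma>] that by (simp add: dist_real_def E_def)
  have "0 < \<rho> / 2" using \<rho>(1) by simp
  from has_field_derivative_transform_within[OF EQ this UNIV_I m_eq] show ?thesis .
qed

end

section \<open>Product test functions and regular endpoints\<close>

lemma dderiv_linear: "smooth_alg \<psi> \<Longrightarrow> linear (frechet_derivative \<psi> (at y))"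
  by (rule linear_frechet_derivative[OF smooth_alg_differentiable])

lemma continuous_on_dderiv:
  assumes \<psi>: "smooth_alg \<psi>" and fg: "continuous_on S f" "continuous_on S g"
  shows "continuous_on S (\<lambda>p. dderiv \<psi> (f p) (g p))"
proof -
  have eq: "dderiv \<psi> y v = v $ 1 * dderiv \<psi> y (axis 1 1) + v $ 2 * dderiv \<psi> y (axis 2 1)" for y v
  proof -
    have "v = v $ 1 *\<^sub>R axis 1 1 + v $ 2 *\<^sub>R axis 2 1"
      by (simp add: vec_eq_iff forall_2 axis_def)
    then have "dderiv \<psi> y v = dderiv \<psi> y (v $ 1 *\<^sub>R axis 1 1 + v $ 2 *\<^sub>R axis 2 1)" by simp
    then show ?thesis
      by (simp only: linear_add[OF dderiv_linear[OF \<psi>]] linear_scale[OF dderiv_linear[OF \<psi>]] real_scaleR_def)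
  qed
  have c: "continuous_on S (\<lambda>p. dderiv \<psi> (f p) v)" for v
    using continuous_on_compose2[OF smooth_alg_continuous[OF smooth_alg_frechet[OF \<psi>], of UNIV] fg(1)] by simp
  have "continuous_on S (\<lambda>p. g p $ 1 * dderiv \<psi> (f p) (axis 1 1) + g p $ 2 * dderiv \<psi> (f p) (axis 2 1))"
    by (intro continuous_intros c fg(2))
  then show ?thesis by (simp only: eq[symmetric])
qed

lemma dderiv_outside_support:
  assumes "\<And>y. norm (y - x) \<ge> \<delta> \<Longrightarrow> \<psi> y = 0" "norm (z - x) > \<delta>"
  shows "dderiv \<psi> z = (\<lambda>v. 0)"
proof -
  have "(\<psi> has_derivative (\<lambda>v. 0)) (at z)"
    by (rule has_derivative_transform_within_open[OF has_derivative_const[of 0], where s = "- cball x \<delta>"])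
      (use assms in \<open>auto simp: dist_norm norm_minus_commute open_Compl\<close>)
  then show ?thesis using frechet_derivative_at by metis
qed

lemma product_test_function:
  fixes \<psi> :: "real^2 \<Rightarrow> real"
  assumes \<psi>: "smooth_alg \<psi>" "\<forall>y. norm (y - x) \<ge> \<delta> \<longrightarrow> \<psi> y = 0" and \<epsilon>: "\<epsilon> > 0" "t + \<epsilon> < T"
  defines "\<phi> \<equiv> (\<lambda>p. \<psi> (fst p) * bump ((snd p - t) / \<epsilon>))"
  shows "test_function T \<phi>"
    and "time_deriv \<phi> y \<tau> = \<psi> y * (dbump ((\<tau> - t) / \<epsilon>) / \<epsilon>)"
    and "v \<bullet> space_grad \<phi> y \<tau> = dderiv \<psi> y v * bump ((\<tau> - t) / \<epsilon>)"
proof -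
  have b: "(\<lambda>\<tau>. bump ((\<tau> - t) / \<epsilon>)) = (\<lambda>\<tau>. bump (\<tau> \<bullet> (1 / \<epsilon>) + (- t / \<epsilon>)))"
    by (simp add: fun_eq_iff diff_divide_distrib)
  have "smooth_alg (\<lambda>\<tau>. bump ((\<tau> - t) / \<epsilon>))" unfolding b by (rule smooth_alg_bump)
  then have sm: "smooth_alg \<phi>" unfolding \<phi>_def by (intro smooth_alg.mult smooth_alg_fst \<psi>(1) smooth_alg_snd)
  show "test_function T \<phi>"
    unfolding test_function_def
  proof (intro conjI allI exI)
    show "Ck k \<phi>" for k by (rule smooth_alg_Ck[OF sm])
    show "compact (cball x \<delta> \<times> {t - \<epsilon>..t + \<epsilon>})" by (intro compact_Times) auto
    show "cball x \<delta> \<times> {t - \<epsilon>..t + \<epsilon>} \<subseteq> UNIV \<times> {..<T}" using \<epsilon> by auto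
    show "p \<notin> cball x \<delta> \<times> {t - \<epsilon>..t + \<epsilon>} \<longrightarrow> \<phi> p = 0" for p
    proof
      assume p: "p \<notin> cball x \<delta> \<times> {t - \<epsilon>..t + \<epsilon>}"
      show "\<phi> p = 0"
      proof (cases "fst p \<in> cball x \<delta>")
        case False
        then show ?thesis using \<psi>(2)[rule_format, of "fst p"] by (simp add: \<phi>_def dist_norm norm_minus_commute)
      next
        case True
        with p have "snd p \<notin> {t - \<epsilon>..t + \<epsilon>}" by (cases p) auto
        then have "\<bar>snd p - t\<bar> \<ge> \<epsilon>" by auto
        then have "\<bar>(snd p - t) / \<epsilon>\<bar> \<ge> 1" using \<epsilon>(1) by simp
        then show ?thesis by (simp add: \<phi>_def bump_0)
      qed
    qed
  qed
  have \<psi>d: "(\<psi> has_derivative frechet_derivative \<psi> (at y)) (at y)"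
    using smooth_alg_differentiable[OF \<psi>(1)] frechet_derivative_works by blast
  have f1: "((\<lambda>p. \<psi> (fst p)) has_derivative (\<lambda>h. dderiv \<psi> y (fst h))) (at (y, \<tau>))"
    using has_derivative_compose[of fst fst "(y, \<tau>)" UNIV \<psi>, OF has_derivative_fst[OF has_derivative_ident]] \<psi>d by simp
  have f2: "((\<lambda>p. bump ((snd p - t) / \<epsilon>)) has_derivative (\<lambda>h. dbump ((\<tau> - t) / \<epsilon>) * (snd h / \<epsilon>))) (at (y, \<tau>))"
  proof -
    have "((\<lambda>p::(real^2) \<times> real. (snd p - t) / \<epsilon>) has_derivative (\<lambda>h. snd h / \<epsilon>)) (at (y, \<tau>))"
      unfolding divide_inverse by (auto intro!: derivative_eq_intros)
    from has_derivative_compose[OF this DERIV_bump[unfolded has_field_derivative_def]] show ?thesis by simp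
  qed
  have D1: "(\<phi> has_derivative (\<lambda>h. \<psi> y * (dbump ((\<tau> - t) / \<epsilon>) * (snd h / \<epsilon>)) + dderiv \<psi> y (fst h) * bump ((\<tau> - t) / \<epsilon>))) (at (y, \<tau>))"
    using has_derivative_mult[OF f1 f2] by (simp add: \<phi>_def)
  have "(\<phi> has_derivative (\<lambda>h. space_grad \<phi> y \<tau> \<bullet> fst h + time_deriv \<phi> y \<tau> * snd h)) (at (y, \<tau>))"
    by (rule has_derivative_test[OF smooth_alg_Ck[OF sm]])
  from has_derivative_unique[OF this D1]
  have eq: "space_grad \<phi> y \<tau> \<bullet> fst h + time_deriv \<phi> y \<tau> * snd h
      = \<psi> y * (dbump ((\<tau> - t) / \<epsilon>) * (snd h / \<epsilon>)) + dderiv \<psi> y (fst h) * bump ((\<tau> - t) / \<epsilon>)" for h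
    by (rule fun_cong)
  show "time_deriv \<phi> y \<tau> = \<psi> y * (dbump ((\<tau> - t) / \<epsilon>) / \<epsilon>)"
    using eq[of "(0, 1)"] linear_0[OF dderiv_linear[OF \<psi>(1)]] by simp
  show "v \<bullet> space_grad \<phi> y \<tau> = dderiv \<psi> y v * bump ((\<tau> - t) / \<epsilon>)"
    using eq[of "(v, 0)"] by (simp add: inner_commute)
qed

lemma eventually_away:
  fixes g :: "real \<Rightarrow> real^2"
  assumes "(\<exists>y. y \<noteq> x \<and> (g \<longlongrightarrow> y) F) \<or> filterlim g at_infinity F"
  shows "\<exists>\<mu>>0. \<forall>\<^sub>F r in F. 2 * \<mu> \<le> norm (g r - x)"
  using assms
proof (elim disjE exE conjE)
  fix y assume y: "y \<noteq> x" "(g \<longlongrightarrow> y) F"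
  have n: "norm (y - x) / 2 > 0" using y by simp
  have "\<forall>\<^sub>F r in F. 2 * (norm (y - x) / 4) \<le> norm (g r - x)"
    using tendstoD[OF y(2) n]
  proof eventually_elim
    case (elim r)
    have "norm (y - x) \<le> norm (g r - x) + norm (g r - y)"
      using norm_triangle_sub[of "y - x" "g r - x"] norm_minus_commute[of y "g r"] by simp
    with elim show ?case by (simp add: dist_norm)
  qed
  moreover have "norm (y - x) / 4 > 0" using y(1) by simp
  ultimately show ?thesis by blast
next
  assume "filterlim g at_infinity F"
  then have "filterlim (\<lambda>r. norm (g r)) at_top F" by (rule filterlim_at_infinity_imp_norm_at_top)
  then have "\<forall>\<^sub>F r in F. norm x + 2 \<le> norm (g r)" by (simp add: filterlim_at_top)
  then have "\<forall>\<^sub>F r in F. 2 * 1 \<le> norm (g r - x)"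
  proof eventually_elim
    case (elim r)
    then show ?case using norm_triangle_sub[of "g r" x] by simp
  qed
  then show ?thesis by (intro exI[of _ 1]) simp
qed

text \<open>
  Equations obtained for positive times only, where the initial data do not interfere, extend to
  \<open>t = 0\<close> by continuity.
\<close>

lemma zero_at_left_end:
  fixes D :: "real \<Rightarrow> real"
  assumes e: "\<eta> > 0" and c: "continuous_on {0..\<eta>} D" and z: "\<And>\<tau>. 0 < \<tau> \<Longrightarrow> \<tau> \<le> \<eta> \<Longrightarrow> D \<tau> = 0"
  shows "D 0 = 0"
proof (rule ccontr)
  assume "D 0 \<noteq> 0"
  then have "\<bar>D 0\<bar> > 0" by simp
  moreover have "0 \<in> {0..\<eta>}" using e by simp
  ultimately have "\<exists>d>0. \<forall>\<tau>\<in>{0..\<eta>}. \<bar>\<tau> - 0\<bar> < d \<longrightarrow> \<bar>D \<tau> - D 0\<bar> < \<bar>D 0\<bar>"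
    by (intro c[unfolded continuous_on_iff dist_real_def, THEN bspec, THEN spec, THEN mp])
  then obtain d where d: "d > 0" "\<And>\<tau>. \<tau> \<in> {0..\<eta>} \<Longrightarrow> \<bar>\<tau> - 0\<bar> < d \<Longrightarrow> \<bar>D \<tau> - D 0\<bar> < \<bar>D 0\<bar>"
    by blast
  define \<tau> where "\<tau> = min (d / 2) \<eta>"
  have "0 < \<tau>" "\<tau> \<le> \<eta>" "\<tau> < d" using d(1) e by (auto simp: \<tau>_def)
  then show False using d(2)[of \<tau>] z[of \<tau>] by simp
qed

lemma Ckb_on_1_real:
  fixes g :: "real \<Rightarrow> real"
  assumes g: "Ckb_on 1 {0..<T} g"
  shows "continuous_on {0..<T} g" "bounded (g ` {0..<T})" "g differentiable_on {0..<T}"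
    "continuous_on {0..<T} (\<lambda>t. vector_derivative g (at t within {0..<T}))"
proof -
  show b: "continuous_on {0..<T} g" "bounded (g ` {0..<T})" "g differentiable_on {0..<T}"
    using g by auto
  have "continuous_on {0..<T} (\<lambda>t. frechet_derivative g (at t within {0..<T}) 1)" using g by auto
  moreover have "frechet_derivative g (at t within {0..<T}) 1 = vector_derivative g (at t within {0..<T})" if t: "t \<in> {0..<T}" for t
  proof -
    have D: "(g has_derivative frechet_derivative g (at t within {0..<T})) (at t within {0..<T})"
      using b(3) t frechet_derivative_works differentiable_on_def by blast
    then interpret bounded_linear "frechet_derivative g (at t within {0..<T})" by (rule has_derivative_bounded_linear)
    have "frechet_derivative g (at t within {0..<T}) = (\<lambda>h. h *\<^sub>R frechet_derivative g (at t within {0..<T}) 1)"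
    proof
      show "frechet_derivative g (at t within {0..<T}) h = h *\<^sub>R frechet_derivative g (at t within {0..<T}) 1" for h
        using scale[of h 1] by (simp only: real_scaleR_def mult_1_right)
    qed
    with D have "(g has_vector_derivative frechet_derivative g (at t within {0..<T}) 1) (at t within {0..<T})"
      unfolding has_vector_derivative_def by simp
    then show ?thesis by (rule vector_derivative_within[OF at_within_half_open_nontrivial[OF t], symmetric])
  qed
  ultimately show "continuous_on {0..<T} (\<lambda>t. vector_derivative g (at t within {0..<T}))"
    by (rule continuous_on_eq)
qed

lemma endpoint_C1b_finite:
  assumes "endpoint_C1b T \<sigma>" "t \<in> {0..<T}"
  shows "\<sigma> t = ereal (real_of_ereal (\<sigma> t))" "\<bar>\<sigma> t\<bar> \<noteq> \<infinity>"
proof -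
  show "\<bar>\<sigma> t\<bar> \<noteq> \<infinity>" by (rule assms(1)[unfolded endpoint_C1b_def, THEN conjunct1, THEN bspec, OF assms(2)])
  then show "\<sigma> t = ereal (real_of_ereal (\<sigma> t))" by (simp add: ereal_real)
qed

lemma endpoint_C1b_differentiable:
  assumes "endpoint_C1b T \<sigma>"
  shows "endpoint_differentiable T \<sigma>"
proof -
  have g: "Ckb_on 1 {0..<T} (\<lambda>t. real_of_ereal (\<sigma> t))" using assms by (simp add: endpoint_C1b_def)
  have "continuous_on {0..<T} (\<lambda>t. ereal (real_of_ereal (\<sigma> t)))" by (intro continuous_intros Ckb_on_1_real(1)[OF g])
  then have "continuous_on {0..<T} \<sigma>"
    by (rule continuous_on_eq) (rule endpoint_C1b_finite(1)[OF assms, symmetric])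
  then show ?thesis using Ckb_on_1_real(3)[OF g] by (auto simp: endpoint_differentiable_def differentiable_on_def)
qed

lemma endpoint_infinite_differentiable:
  assumes "\<And>t. t \<in> {0..<T} \<Longrightarrow> \<sigma> t = c" "\<bar>c\<bar> = \<infinity>"
  shows "endpoint_differentiable T \<sigma>"
proof -
  have "continuous_on {0..<T} \<sigma>"
    by (rule continuous_on_eq[OF continuous_on_const[of _ c]]) (use assms in auto)
  then show ?thesis using assms by (auto simp: endpoint_differentiable_def)
qed

text \<open>
  Every point of \<open>\<Omega>\<close> is a limit of interior points with positive time: move the parameter slightly
  towards an interior one, then move on to a later time.
\<close>

lemma (in sheet) zero_by_density:
  fixes g :: "real \<times> real \<Rightarrow> 'b::real_normed_vector"
  assumes c: "continuous_on \<Omega> g"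
    and z: "\<And>s t. 0 < t \<Longrightarrow> t < T \<Longrightarrow> s0 t < ereal s \<Longrightarrow> ereal s < s1 t \<Longrightarrow> g (s, t) = 0"
    and p: "p \<in> \<Omega>"
  shows "g p = 0"
proof (rule ccontr)
  assume nz: "g p \<noteq> 0"
  obtain s t where st: "p = (s, t)" by (cases p)
  have t: "t \<in> {0..<T}" and s: "s0 t \<le> ereal s" "ereal s \<le> s1 t" using p by (auto simp: st mem_domain)
  obtain d where d: "d > 0" "\<And>p'. p' \<in> \<Omega> \<Longrightarrow> dist p' p < d \<Longrightarrow> dist (g p') (g p) < norm (g p)"
    using c nz p unfolding continuous_on_iff by (metis zero_less_norm_iff)
  obtain z where zi: "s0 t < ereal z" "ereal z < s1 t" using interior_point[OF t] by blast
  define \<theta> where "\<theta> = min (1 / 2) (d / (4 * (\<bar>z - s\<bar> + 1)))"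
  have zs: "4 * (\<bar>z - s\<bar> + 1) > 0" by (intro mult_pos_pos add_nonneg_pos) auto
  have \<theta>: "0 < \<theta>" "\<theta> < 1" using d(1) divide_pos_pos[OF d(1) zs] unfolding \<theta>_def by auto
  define \<sigma> where "\<sigma> = s + \<theta> * (z - s)"
  have \<sigma>d: "\<bar>\<sigma> - s\<bar> < d / 2"
  proof -
    have "\<bar>\<sigma> - s\<bar> = \<theta> * \<bar>z - s\<bar>" using \<theta> by (simp add: \<sigma>_def abs_mult)
    also have "\<dots> \<le> (d / (4 * (\<bar>z - s\<bar> + 1))) * (\<bar>z - s\<bar> + 1)"
      using d(1) by (intro mult_mono) (auto simp: \<theta>_def)
    also have "\<dots> = d / 4"
    proof -
      have "d / (4 * x) * x = d / 4" if "x \<noteq> 0" for x using that by simp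
      from this[of "\<bar>z - s\<bar> + 1"] zs show ?thesis by simp
    qed
    finally show ?thesis using d(1) by simp
  qed
  have \<sigma>i: "s0 t < ereal \<sigma>" "ereal \<sigma> < s1 t"
  proof -
    consider "z = s" | "s < z" | "z < s" by linarith
    then have "s0 t < ereal \<sigma> \<and> ereal \<sigma> < s1 t"
    proof cases
      case 1
      then show ?thesis using zi by (simp add: \<sigma>_def)
    next
      case 2
      have "\<theta> * (z - s) < 1 * (z - s)" using \<theta> 2 by (intro mult_strict_right_mono) auto
      moreover have "0 < \<theta> * (z - s)" using \<theta> 2 by simp
      ultimately have "s < \<sigma>" "\<sigma> < z" by (simp_all add: \<sigma>_def algebra_simps)
      then show ?thesis using s zi by (meson ereal_less_le le_less_trans less_ereal.simps(1) less_trans)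
    next
      case 3
      have "z - s < \<theta> * (z - s)" "\<theta> * (z - s) < 0" using \<theta> 3 mult_strict_right_mono_neg[of \<theta> 1 "z - s"] by (auto simp: mult_pos_neg)
      then have "\<sigma> < s" "z < \<sigma>" unfolding \<sigma>_def by linarith+
      then show ?thesis using s zi by (meson less_ereal.simps(1) less_le_trans less_trans)
    qed
    then show "s0 t < ereal \<sigma>" "ereal \<sigma> < s1 t" by auto
  qed
  obtain \<delta> where \<delta>: "\<delta> > 0"
    "\<And>\<sigma>' \<tau>. \<tau> \<in> {0..<T} \<Longrightarrow> \<bar>\<tau> - t\<bar> < \<delta> \<Longrightarrow> \<bar>\<sigma>' - \<sigma>\<bar> < \<delta> \<Longrightarrow> s0 \<tau> < ereal \<sigma>' \<and> ereal \<sigma>' < s1 \<tau>"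
    using interior_stable[OF t \<sigma>i] by blast
  define M where "M = Min {\<delta>, d, T - t}"
  have M: "M > 0" "M \<le> \<delta>" "M \<le> d" "M \<le> T - t" using \<delta>(1) d(1) t by (auto simp: M_def)
  define \<tau> where "\<tau> = t + M / 2"
  have \<tau>: "0 < \<tau>" "\<tau> < T" "\<bar>\<tau> - t\<bar> < \<delta>" "\<bar>\<tau> - t\<bar> \<le> d / 2" using M t by (auto simp: \<tau>_def)
  have i: "s0 \<tau> < ereal \<sigma>" "ereal \<sigma> < s1 \<tau>" using \<delta>(2)[of \<tau> \<sigma>] \<tau> \<delta>(1) by auto
  then have mem: "(\<sigma>, \<tau>) \<in> \<Omega>" using \<tau> by (auto simp: mem_domain less_imp_le)
  have "dist (\<sigma>, \<tau>) p \<le> dist \<sigma> s + dist \<tau> t"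
    unfolding st dist_Pair_Pair by (rule sqrt_sum_squares_le_sum_abs[THEN order_trans]) auto
  also have "\<dots> < d" using \<sigma>d \<tau>(4) by (simp add: dist_real_def)
  finally have "dist (g (\<sigma>, \<tau>)) (g p) < norm (g p)" using d(2)[OF mem] by simp
  then show False using z[OF \<tau>(1,2) i] by (simp add: dist_norm)
qed

section \<open>Localizing a weak solution\<close>

locale weak_sheet = sheet +
  fixes \<gamma> :: "real \<times> real \<Rightarrow> real" and \<xi> :: "real \<times> real \<Rightarrow> real^2" and \<gamma>0 :: "real \<Rightarrow> real" and \<xi>0 :: "real \<Rightarrow> real^2"
  assumes weak: "weak_BR_solution T s0 s1 \<gamma> \<xi> \<gamma>0 \<xi>0"
    and one_to_one: "one_to_one_sheet T s0 s1 \<xi>"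
    and \<xi>: "Ckb_on 1 (sheet_domain T s0 s1) \<xi>" and \<gamma>: "Ckb_on 1 (sheet_domain T s0 s1) \<gamma>"
    and V: "Ckb_on 0 (sheet_domain T s0 s1) (velocity s0 s1 \<xi> \<gamma>)"
    and ends: "\<sigma> \<in> {s0, s1} \<Longrightarrow> (\<exists>t\<in>{0..<T}. \<bar>\<sigma> t\<bar> \<noteq> \<infinity>) \<Longrightarrow> endpoint_C1b T \<sigma>"
begin

abbreviation "vel \<equiv> velocity s0 s1 \<xi> \<gamma>"
abbreviation "\<xi>s \<equiv> pd_s \<Omega> \<xi>"
abbreviation "\<xi>t \<equiv> pd_t \<Omega> \<xi>"
abbreviation "\<gamma>t \<equiv> pd_t \<Omega> \<gamma>"

definition W where "W p = vel p - \<xi>t p"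
definition a where "a p = \<xi>s p \<bullet> W p"

lemma V_cont: "continuous_on \<Omega> vel" using V by simp
lemma W_cont: "continuous_on \<Omega> W" unfolding W_def by (intro continuous_intros V_cont Ckb_on_1D(5)[OF \<xi>])
lemma a_cont: "continuous_on \<Omega> a" unfolding a_def by (intro continuous_intros W_cont Ckb_on_1D(3)[OF \<xi>])

lemma unit_speed: "p \<in> \<Omega> \<Longrightarrow> norm (\<xi>s p) = 1"
proof -
  assume p: "p \<in> \<Omega>"
  obtain s t where st: "p = (s, t)" by (cases p)
  have t: "t \<in> {0..<T}" and s: "s \<in> I t" using p by (auto simp: st mem_domain mem_slice)
  obtain s' where s': "s' \<in> I t" "s' \<noteq> s" using two_points[OF t s] by blast
  have "norm ((\<lambda>s. \<xi>s (s, t)) s) = 1"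
  proof (rule unit_speed_if_arclength[OF is_interval_slice s s'(1) s'(2)[symmetric], of "\<lambda>s. \<xi> (s, t)"])
    show "curve_length (\<lambda>s. \<xi> (s, t)) x y = ennreal (y - x)" if "x \<in> I t" "y \<in> I t" "x \<le> y" for x y
      using weak t that by (auto simp: weak_BR_solution_def arclength_parametrized_def)
    show "((\<lambda>s. \<xi> (s, t)) has_vector_derivative \<xi>s (x, t)) (at x within I t)" if "x \<in> I t" for x
      using Ckb_on_1_has_vector_derivative(1)[OF \<xi>, of x t, unfolded slice_eq[OF t]] that t by (simp add: mem_domain mem_slice)
    show "continuous_on (I t) (\<lambda>s. \<xi>s (s, t))" by (rule slice_measurable(2)[OF Ckb_on_1D(3)[OF \<xi>] t])
  qed
  then show ?thesis by (simp add: st)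
qed

lemma s1_cases: "(\<forall>t\<in>{0..<T}. s1 t = \<infinity>) \<or> endpoint_C1b T s1"
proof (cases "\<exists>t\<in>{0..<T}. \<bar>s1 t\<bar> \<noteq> \<infinity>")
  case False
  have "s1 t = \<infinity>" if "t \<in> {0..<T}" for t
  proof -
    have "\<bar>s1 t\<bar> = \<infinity>" using False that by blast
    then show ?thesis using ordered[OF that] by (cases "s1 t") auto
  qed
  then show ?thesis by blast
qed (use ends in auto)

lemma s0_cases: "(\<forall>t\<in>{0..<T}. s0 t = - \<infinity>) \<or> endpoint_C1b T s0"
proof (cases "\<exists>t\<in>{0..<T}. \<bar>s0 t\<bar> \<noteq> \<infinity>")
  case False
  have "s0 t = - \<infinity>" if "t \<in> {0..<T}" for t
  proof -
    have "\<bar>s0 t\<bar> = \<infinity>" using False that by blast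
    then show ?thesis using ordered[OF that] by (cases "s0 t") auto
  qed
  then show ?thesis by blast
qed (use ends in auto)

lemma endpoint_bounded:
  assumes "endpoint_C1b T \<sigma>"
  obtains B where "\<And>t. t \<in> {0..<T} \<Longrightarrow> - ereal B \<le> \<sigma> t \<and> \<sigma> t \<le> ereal B"
proof -
  have "Ckb_on 1 {0..<T} (\<lambda>t. real_of_ereal (\<sigma> t))" using assms by (simp add: endpoint_C1b_def)
  from Ckb_on_1_real(2)[OF this] obtain B where B: "\<forall>t\<in>{0..<T}. \<bar>real_of_ereal (\<sigma> t)\<bar> \<le> B" by (auto simp: bounded_iff)
  show thesis
  proof (rule that)
    fix t assume t: "t \<in> {0..<T}"
    have b: "\<bar>real_of_ereal (\<sigma> t)\<bar> \<le> B" using B t by blast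
    have "- B \<le> real_of_ereal (\<sigma> t)" "real_of_ereal (\<sigma> t) \<le> B" using abs_le_D1[OF b] abs_le_D2[OF b] by linarith+
    then have "ereal (- B) \<le> ereal (real_of_ereal (\<sigma> t))" "ereal (real_of_ereal (\<sigma> t)) \<le> ereal B" unfolding ereal_less_eq(3) .
    then show "- ereal B \<le> \<sigma> t \<and> \<sigma> t \<le> ereal B" unfolding endpoint_C1b_finite(1)[OF assms t, symmetric] by simp
  qed
qed

lemma time_lipschitz:
  obtains N where "N > 0" "\<And>\<sigma> t \<tau>. (\<And>\<tau>. \<tau> \<in> {0..<T} \<Longrightarrow> (\<sigma>, \<tau>) \<in> \<Omega>) \<Longrightarrow> t \<in> {0..<T} \<Longrightarrow> \<tau> \<in> {0..<T} \<Longrightarrow>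
      norm (\<xi> (\<sigma>, \<tau>) - \<xi> (\<sigma>, t)) \<le> N * \<bar>\<tau> - t\<bar>"
proof -
  obtain N0 where N0: "\<forall>p\<in>\<Omega>. norm (\<xi>t p) \<le> N0" using Ckb_on_1D(6)[OF \<xi>] by (auto simp: bounded_iff)
  show thesis
  proof (rule that[of "max N0 1"])
    fix \<sigma> t \<tau> assume m: "\<And>\<tau>. \<tau> \<in> {0..<T} \<Longrightarrow> (\<sigma>, \<tau>) \<in> \<Omega>" and t: "t \<in> {0..<T}" "\<tau> \<in> {0..<T}"
    show "norm (\<xi> (\<sigma>, \<tau>) - \<xi> (\<sigma>, t)) \<le> max N0 1 * \<bar>\<tau> - t\<bar>"
    proof (rule vector_derivative_lipschitz[of "{0..<T}" "\<lambda>\<tau>. \<xi> (\<sigma>, \<tau>)" "\<lambda>\<tau>. \<xi>t (\<sigma>, \<tau>)"])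
      have "{\<tau>. (\<sigma>, \<tau>) \<in> \<Omega>} = {0..<T}" using m by (auto simp: mem_domain)
      then show "((\<lambda>\<tau>. \<xi> (\<sigma>, \<tau>)) has_vector_derivative \<xi>t (\<sigma>, x)) (at x within {0..<T})" if "x \<in> {0..<T}" for x
        using Ckb_on_1_has_vector_derivative(2)[OF \<xi> m[OF that]] by simp
      show "norm (\<xi>t (\<sigma>, x)) \<le> max N0 1" if "x \<in> {0..<T}" for x using N0 m[OF that] by (meson max.coboundedI1)
    qed (use t in auto)
  qed simp
qed

lemma curve_value_real: "curve_value \<xi> t (ereal r) x \<longleftrightarrow> \<xi> (r, t) = x"
  by (simp add: curve_value_def)

lemma curve_value_infinite: "curve_value \<xi> t \<infinity> x \<longleftrightarrow> ((\<lambda>r. \<xi> (r, t)) \<longlongrightarrow> x) at_top"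
  "curve_value \<xi> t (- \<infinity>) x \<longleftrightarrow> ((\<lambda>r. \<xi> (r, t)) \<longlongrightarrow> x) at_bot"
proof -
  show "curve_value \<xi> t \<infinity> x \<longleftrightarrow> ((\<lambda>r. \<xi> (r, t)) \<longlongrightarrow> x) at_top"
    by (simp only: curve_value_def PInfty_eq_infinity[symmetric] ereal.case)
  show "curve_value \<xi> t (- \<infinity>) x \<longleftrightarrow> ((\<lambda>r. \<xi> (r, t)) \<longlongrightarrow> x) at_bot"
    by (simp only: curve_value_def MInfty_eq_minfinity[symmetric] ereal.case)
qed

text \<open>
  The exceptional pair in the one-to-one condition consists of the two ends, so an interior parameter
  shares its position with no other one, infinite ends included.
\<close>

lemma one_to_one_interior:
  assumes t: "t \<in> {0..<T}" and s: "s0 t < ereal s" "ereal s < s1 t"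
    and \<sigma>: "s0 t \<le> \<sigma>" "\<sigma> \<le> s1 t" "curve_value \<xi> t \<sigma> (\<xi> (s, t))"
  shows "\<sigma> = ereal s"
proof -
  have "\<forall>\<sigma>\<in>{s0 t..s1 t}. \<forall>\<sigma>'\<in>{s0 t..s1 t}. \<forall>x.
           curve_value \<xi> t \<sigma> x \<and> curve_value \<xi> t \<sigma>' x \<longrightarrow> \<sigma> = \<sigma>' \<or> {\<sigma>, \<sigma>'} = {s0 t, s1 t}"
    using one_to_one t unfolding one_to_one_sheet_def by blast
  moreover have "curve_value \<xi> t (ereal s) (\<xi> (s, t))" by (simp add: curve_value_real)
  moreover have "ereal s \<in> {s0 t..s1 t}" using s by auto
  ultimately have "\<sigma> = ereal s \<or> {\<sigma>, ereal s} = {s0 t, s1 t}" using \<sigma> by (meson atLeastAtMost_iff)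
  moreover have "{\<sigma>, ereal s} \<noteq> {s0 t, s1 t}" using s by (auto simp: doubleton_eq_iff)
  ultimately show ?thesis by blast
qed

text \<open>
  At time \<open>t\<close> the curve has a limit other than \<open>x\<close>, or escapes to infinity, at the end in
  question.  Parameters far out belong to the sheet at all times, and each of their positions moves with
  bounded speed; hence the distance from \<open>x\<close> persists for a time that does not depend on the
  parameter.
\<close>

lemma away_near_infinite_end:
  assumes t: "t \<in> {0..<T}"
    and lim: "(\<exists>y. y \<noteq> x \<and> ((\<lambda>r. \<xi> (r, t)) \<longlongrightarrow> y) F) \<or> filterlim (\<lambda>r. \<xi> (r, t)) at_infinity F"
    and full: "\<forall>\<^sub>F \<sigma> in F. \<forall>\<tau>\<in>{0..<T}. (\<sigma>, \<tau>) \<in> \<Omega>"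
  shows "\<exists>\<mu>>0. \<exists>\<eta>>0. \<forall>\<^sub>F \<sigma> in F. \<forall>\<tau>\<in>{0..<T}. \<bar>\<tau> - t\<bar> < \<eta> \<longrightarrow> \<mu> \<le> norm (\<xi> (\<sigma>, \<tau>) - x)"
proof -
  obtain \<mu> where \<mu>: "\<mu> > 0" "\<forall>\<^sub>F r in F. 2 * \<mu> \<le> norm (\<xi> (r, t) - x)" using eventually_away[OF lim] by blast
  obtain N where N: "N > 0" "\<And>\<sigma> t \<tau>. (\<And>\<tau>. \<tau> \<in> {0..<T} \<Longrightarrow> (\<sigma>, \<tau>) \<in> \<Omega>) \<Longrightarrow> t \<in> {0..<T} \<Longrightarrow> \<tau> \<in> {0..<T} \<Longrightarrow>
      norm (\<xi> (\<sigma>, \<tau>) - \<xi> (\<sigma>, t)) \<le> N * \<bar>\<tau> - t\<bar>" using time_lipschitz by metis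
  have "\<forall>\<^sub>F \<sigma> in F. \<forall>\<tau>\<in>{0..<T}. \<bar>\<tau> - t\<bar> < \<mu> / N \<longrightarrow> \<mu> \<le> norm (\<xi> (\<sigma>, \<tau>) - x)"
    using \<mu>(2) full
  proof eventually_elim
    case (elim \<sigma>)
    show ?case
    proof (intro ballI impI)
      fix \<tau> assume \<tau>: "\<tau> \<in> {0..<T}" "\<bar>\<tau> - t\<bar> < \<mu> / N"
      have "norm (\<xi> (\<sigma>, \<tau>) - \<xi> (\<sigma>, t)) \<le> N * \<bar>\<tau> - t\<bar>" using N(2) elim(2) t \<tau>(1) by blast
      also have "\<dots> \<le> \<mu>" using \<tau>(2) N(1) by (simp add: field_simps)
      finally have "norm (\<xi> (\<sigma>, \<tau>) - \<xi> (\<sigma>, t)) \<le> \<mu>" .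
      then show "\<mu> \<le> norm (\<xi> (\<sigma>, \<tau>) - x)"
        using elim(1) norm_triangle_sub[of "\<xi> (\<sigma>, t) - x" "\<xi> (\<sigma>, \<tau>) - x"]
          norm_minus_commute[of "\<xi> (\<sigma>, t)" "\<xi> (\<sigma>, \<tau>)"]
        by simp
    qed
  qed
  moreover have "\<mu> / N > 0" using \<mu>(1) N(1) by simp
  ultimately show ?thesis using \<mu>(1) by blast
qed

lemma away_far_up:
  assumes t: "t \<in> {0..<T}" and s: "s0 t < ereal s" "ereal s < s1 t"
  shows "\<exists>R. \<exists>\<mu>>0. \<exists>\<eta>>0. \<forall>\<tau>\<in>{0..<T}. \<bar>\<tau> - t\<bar> < \<eta> \<longrightarrow>
    (\<forall>\<sigma>. (\<sigma>, \<tau>) \<in> \<Omega> \<longrightarrow> \<sigma> > R \<longrightarrow> \<mu> \<le> norm (\<xi> (\<sigma>, \<tau>) - \<xi> (s, t)))"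
  using s1_cases
proof
  assume "endpoint_C1b T s1"
  then obtain B where B: "\<And>t. t \<in> {0..<T} \<Longrightarrow> - ereal B \<le> s1 t \<and> s1 t \<le> ereal B" by (rule endpoint_bounded) (rule that, blast)
  have "\<not> \<sigma> > B" if "(\<sigma>, \<tau>) \<in> \<Omega>" for \<sigma> \<tau>
    using that B[of \<tau>] by (auto simp: mem_domain) (meson ereal_less_eq(3) leD order_trans)
  then show ?thesis by - (rule exI[of _ B], rule exI[of _ 1], rule conjI, simp, rule exI[of _ 1], auto)
next
  assume inf: "\<forall>t\<in>{0..<T}. s1 t = \<infinity>"
  have "\<exists>R0. \<forall>\<tau>\<in>{0..<T}. s0 \<tau> \<le> ereal R0"
    using s0_cases
  proof
    assume "endpoint_C1b T s0"
    then show ?thesis by (metis endpoint_bounded)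
  qed auto
  then obtain R0 where R0: "\<forall>\<tau>\<in>{0..<T}. s0 \<tau> \<le> ereal R0" by blast
  have full: "\<forall>\<^sub>F \<sigma> in at_top. \<forall>\<tau>\<in>{0..<T}. (\<sigma>, \<tau>) \<in> \<Omega>"
    using eventually_ge_at_top[of R0]
  proof eventually_elim
    case (elim \<sigma>)
    show ?case
    proof
      fix \<tau> assume \<tau>: "\<tau> \<in> {0..<T}"
      have "s0 \<tau> \<le> ereal \<sigma>" using R0 \<tau> elim by (meson ereal_less_eq(3) order_trans)
      then show "(\<sigma>, \<tau>) \<in> \<Omega>" using \<tau> inf by (auto simp: mem_domain)
    qed
  qed
  have "(\<exists>y. y \<noteq> \<xi> (s, t) \<and> ((\<lambda>r. \<xi> (r, t)) \<longlongrightarrow> y) at_top) \<or> filterlim (\<lambda>r. \<xi> (r, t)) at_infinity at_top"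
  proof -
    have "(\<exists>x. curve_value \<xi> t (s1 t) x) \<or> curve_escapes \<xi> t (s1 t)"
      using one_to_one t unfolding one_to_one_sheet_def by blast
    moreover have "s1 t = \<infinity>" using inf t by blast
    moreover have "\<not> curve_value \<xi> t \<infinity> (\<xi> (s, t))"
      using one_to_one_interior[OF t s, of \<infinity>] ordered[OF t] \<open>s1 t = \<infinity>\<close> by auto
    ultimately show ?thesis unfolding curve_escapes_def by (auto simp: curve_value_infinite) metis+
  qed
  from away_near_infinite_end[OF t this full] show ?thesis
    unfolding eventually_at_top_dense by blast
qed

lemma away_far_down:
  assumes t: "t \<in> {0..<T}" and s: "s0 t < ereal s" "ereal s < s1 t"
  shows "\<exists>R. \<exists>\<mu>>0. \<exists>\<eta>>0. \<forall>\<tau>\<in>{0..<T}. \<bar>\<tau> - t\<bar> < \<eta> \<longrightarrow>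
    (\<forall>\<sigma>. (\<sigma>, \<tau>) \<in> \<Omega> \<longrightarrow> \<sigma> < R \<longrightarrow> \<mu> \<le> norm (\<xi> (\<sigma>, \<tau>) - \<xi> (s, t)))"
  using s0_cases
proof
  assume "endpoint_C1b T s0"
  then obtain B where B: "\<And>t. t \<in> {0..<T} \<Longrightarrow> - ereal B \<le> s0 t \<and> s0 t \<le> ereal B" by (rule endpoint_bounded) (rule that, blast)
  have "\<not> \<sigma> < - B" if "(\<sigma>, \<tau>) \<in> \<Omega>" for \<sigma> \<tau>
    using that B[of \<tau>] by (auto simp: mem_domain) (meson ereal_less_eq(3) leD order_trans)
  then show ?thesis by - (rule exI[of _ "- B"], rule exI[of _ 1], rule conjI, simp, rule exI[of _ 1], auto)
next
  assume inf: "\<forall>t\<in>{0..<T}. s0 t = - \<infinity>"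
  have "\<exists>R0. \<forall>\<tau>\<in>{0..<T}. ereal R0 \<le> s1 \<tau>"
    using s1_cases
  proof
    assume "endpoint_C1b T s1"
    then show ?thesis by (metis endpoint_bounded uminus_ereal.simps(1))
  qed auto
  then obtain R0 where R0: "\<forall>\<tau>\<in>{0..<T}. ereal R0 \<le> s1 \<tau>" by blast
  have full: "\<forall>\<^sub>F \<sigma> in at_bot. \<forall>\<tau>\<in>{0..<T}. (\<sigma>, \<tau>) \<in> \<Omega>"
    using eventually_le_at_bot[of R0]
  proof eventually_elim
    case (elim \<sigma>)
    show ?case
    proof
      fix \<tau> assume \<tau>: "\<tau> \<in> {0..<T}"
      have "ereal \<sigma> \<le> s1 \<tau>" using R0 \<tau> elim by (meson ereal_less_eq(3) order_trans)
      then show "(\<sigma>, \<tau>) \<in> \<Omega>" using \<tau> inf by (auto simp: mem_domain)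
    qed
  qed
  have "(\<exists>y. y \<noteq> \<xi> (s, t) \<and> ((\<lambda>r. \<xi> (r, t)) \<longlongrightarrow> y) at_bot) \<or> filterlim (\<lambda>r. \<xi> (r, t)) at_infinity at_bot"
  proof -
    have "(\<exists>x. curve_value \<xi> t (s0 t) x) \<or> curve_escapes \<xi> t (s0 t)"
      using one_to_one t unfolding one_to_one_sheet_def by blast
    moreover have "s0 t = - \<infinity>" using inf t by blast
    moreover have "\<not> curve_value \<xi> t (- \<infinity>) (\<xi> (s, t))"
      using one_to_one_interior[OF t s, of "- \<infinity>"] ordered[OF t] \<open>s0 t = - \<infinity>\<close> by auto
    ultimately show ?thesis unfolding curve_escapes_def by (auto simp: curve_value_infinite) metis+
  qed
  from away_near_infinite_end[OF t this full] show ?thesis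
    unfolding eventually_at_bot_dense by blast
qed

text \<open>
  Parameters that are far out are handled by \<open>away_far_up\<close> and \<open>away_far_down\<close>; for the others, the
  sum of spatial and temporal distance from \<open>(\<xi> (s, t), t)\<close> is positive on a compact set because
  the curve at time \<open>t\<close> is one-to-one.
\<close>

lemma localization:
  assumes t: "t \<in> {0..<T}" and s: "s0 t < ereal s" "ereal s < s1 t" and r: "r > 0"
  obtains \<delta> \<eta> where "\<delta> > 0" "\<eta> > 0"
    "\<And>\<sigma> \<tau>. (\<sigma>, \<tau>) \<in> \<Omega> \<Longrightarrow> \<bar>\<tau> - t\<bar> < \<eta> \<Longrightarrow> norm (\<xi> (\<sigma>, \<tau>) - \<xi> (s, t)) < \<delta> \<Longrightarrow> \<bar>\<sigma> - s\<bar> < r"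
proof -
  obtain R1 \<mu>1 \<eta>1 where u: "\<mu>1 > 0" "\<eta>1 > 0"
    "\<And>\<tau> \<sigma>. \<tau> \<in> {0..<T} \<Longrightarrow> \<bar>\<tau> - t\<bar> < \<eta>1 \<Longrightarrow> (\<sigma>, \<tau>) \<in> \<Omega> \<Longrightarrow> \<sigma> > R1 \<Longrightarrow> \<mu>1 \<le> norm (\<xi> (\<sigma>, \<tau>) - \<xi> (s, t))"
    using away_far_up[OF t s] by metis
  obtain R0 \<mu>0 \<eta>0 where l: "\<mu>0 > 0" "\<eta>0 > 0"
    "\<And>\<tau> \<sigma>. \<tau> \<in> {0..<T} \<Longrightarrow> \<bar>\<tau> - t\<bar> < \<eta>0 \<Longrightarrow> (\<sigma>, \<tau>) \<in> \<Omega> \<Longrightarrow> \<sigma> < R0 \<Longrightarrow> \<mu>0 \<le> norm (\<xi> (\<sigma>, \<tau>) - \<xi> (s, t))"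
    using away_far_down[OF t s] by metis
  define R where "R = max \<bar>R0\<bar> \<bar>R1\<bar>"
  \<comment> \<open>any half-width that keeps the time interval inside \<open>[0, T)\<close>\<close>
  define e where "e = (T - t) / 2"
  have e: "e > 0" using t by (simp add: e_def)
  define \<alpha> \<beta> where "\<alpha> = max 0 (t - e)" and "\<beta> = t + e"
  have ab: "{\<alpha>..\<beta>} \<subseteq> {0..<T}" using t by (auto simp: \<alpha>_def \<beta>_def e_def field_simps)
  define K where "K = {p \<in> \<Omega>. snd p \<in> {\<alpha>..\<beta>} \<and> \<bar>fst p\<bar> \<le> R} \<inter> {p. r \<le> \<bar>fst p - s\<bar>}"
  have cl: "closed {p::real \<times> real. r \<le> \<bar>fst p - s\<bar>}" by (intro closed_Collect_le continuous_intros)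
  have K: "compact K" unfolding K_def by (intro compact_Int_closed compact_domain_part[OF ab] cl)
  define g where "g = (\<lambda>p. norm (\<xi> p - \<xi> (s, t)) + \<bar>snd p - t\<bar>)"
  have gc: "continuous_on K g" unfolding g_def
    by (intro continuous_intros continuous_on_subset[OF Ckb_on_1D(1)[OF \<xi>]]) (auto simp: K_def)
  have gpos: "g p > 0" if p: "p \<in> K" for p
  proof (rule ccontr)
    assume "\<not> g p > 0"
    then have z: "norm (\<xi> p - \<xi> (s, t)) = 0" "\<bar>snd p - t\<bar> = 0"
      unfolding g_def using norm_ge_zero[of "\<xi> p - \<xi> (s, t)"] abs_ge_zero[of "snd p - t"] by linarith+
    obtain \<sigma> where p': "p = (\<sigma>, t)" using z(2) by (cases p) auto
    have "(\<sigma>, t) \<in> \<Omega>" using p by (simp add: K_def p')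
    moreover have "curve_value \<xi> t (ereal \<sigma>) (\<xi> (s, t))" using z(1) by (simp add: curve_value_real p')
    ultimately have "ereal \<sigma> = ereal s" using one_to_one_interior[OF t s, of "ereal \<sigma>"] by (auto simp: mem_domain)
    then show False using p r by (simp add: K_def p')
  qed
  have "\<exists>\<mu>>0. \<forall>p\<in>K. 2 * \<mu> \<le> g p"
  proof (cases "K = {}")
    case False
    obtain p where p: "p \<in> K" "\<forall>q\<in>K. g p \<le> g q" using continuous_attains_inf[OF K False gc] by blast
    then show ?thesis using gpos[OF p(1)] by (intro exI[of _ "g p / 2"]) auto
  qed (auto intro!: exI[of _ 1])
  then obtain \<mu> where \<mu>: "\<mu> > 0" "\<And>p. p \<in> K \<Longrightarrow> 2 * \<mu> \<le> g p" by blast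
  show thesis
  proof (rule that[of "Min {\<mu>, \<mu>0, \<mu>1}" "Min {\<mu>, \<eta>0, \<eta>1, e}"])
    show "Min {\<mu>, \<mu>0, \<mu>1} > 0" "Min {\<mu>, \<eta>0, \<eta>1, e} > 0" using \<mu> u l e by auto
    fix \<sigma> \<tau> assume m: "(\<sigma>, \<tau>) \<in> \<Omega>" and "\<bar>\<tau> - t\<bar> < Min {\<mu>, \<eta>0, \<eta>1, e}" and "norm (\<xi> (\<sigma>, \<tau>) - \<xi> (s, t)) < Min {\<mu>, \<mu>0, \<mu>1}"
    then have h: "\<bar>\<tau> - t\<bar> < \<mu>" "\<bar>\<tau> - t\<bar> < \<eta>0" "\<bar>\<tau> - t\<bar> < \<eta>1" "\<bar>\<tau> - t\<bar> < e"
      and n: "norm (\<xi> (\<sigma>, \<tau>) - \<xi> (s, t)) < \<mu>" "norm (\<xi> (\<sigma>, \<tau>) - \<xi> (s, t)) < \<mu>0" "norm (\<xi> (\<sigma>, \<tau>) - \<xi> (s, t)) < \<mu>1" by auto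
    have \<tau>: "\<tau> \<in> {0..<T}" using m by (simp add: mem_domain)
    have "\<not> \<sigma> > R1" "\<not> \<sigma> < R0" using u(3)[OF \<tau> h(3) m] l(3)[OF \<tau> h(2) m] n by auto
    then have "\<bar>\<sigma>\<bar> \<le> R" by (auto simp: R_def)
    moreover have "\<tau> \<in> {\<alpha>..\<beta>}" using h(4) \<tau> by (auto simp: \<alpha>_def \<beta>_def)
    moreover have "g (\<sigma>, \<tau>) < 2 * \<mu>" using n(1) h(1) by (simp add: g_def)
    ultimately have "\<not> r \<le> \<bar>\<sigma> - s\<bar>" using \<mu>(2)[of "(\<sigma>, \<tau>)"] m by (auto simp: K_def)
    then show "\<bar>\<sigma> - s\<bar> < r" by simp
  qed
qed

end

section \<open>Weak solutions are classical solutions\<close>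

context weak_sheet
begin

lemma weak_test:
  "test_function T \<phi> \<Longrightarrow> (LINT t:{0<..<T}|lebesgue. LINT s:I t|lebesgue.
      \<gamma> (s, t) * (time_deriv \<phi> (\<xi> (s, t)) t + vel (s, t) \<bullet> space_grad \<phi> (\<xi> (s, t)) t))
    + (LINT s:I 0|lebesgue. \<gamma>0 s * \<phi> (\<xi>0 s, 0)) = 0"
  using weak unfolding weak_BR_solution_def by blast

text \<open>
  With \<open>\<psi>\<close> localized, the weak formulation for \<open>\<psi>(x) \<theta>(t)\<close> reads \<open>\<integral> \<theta>' A + \<theta> B dt = 0\<close>,
  where \<open>A\<close> and \<open>B\<close> integrate over a fixed parameter interval.  There \<open>A\<close> can be
  differentiated under the integral sign, so \<open>\<integral> \<theta> (B - A') dt = 0\<close> for all narrow bumps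
  \<open>\<theta>\<close>, and \<open>B - A'\<close> vanishes at \<open>t\<close>.
\<close>

lemma fixed_time_identity:
  assumes t: "0 < t" "t < T" and Q: "{s - r..s + r} \<times> {t - e..t + e} \<subseteq> \<Omega>" and r: "r > 0" and e: "e > 0"
    and \<delta>: "\<And>\<sigma> \<tau>. (\<sigma>, \<tau>) \<in> \<Omega> \<Longrightarrow> \<bar>\<tau> - t\<bar> \<le> e \<Longrightarrow> norm (\<xi> (\<sigma>, \<tau>) - x) \<le> \<delta> \<Longrightarrow> \<bar>\<sigma> - s\<bar> < r"
    and \<psi>: "smooth_alg \<psi>" "\<And>y. norm (y - x) \<ge> \<delta> \<Longrightarrow> \<psi> y = 0"
  shows "integral {s - r..s + r} (\<lambda>\<sigma>. dderiv \<psi> (\<xi> (\<sigma>, t)) (\<gamma> (\<sigma>, t) *\<^sub>R W (\<sigma>, t)) - \<gamma>t (\<sigma>, t) * \<psi> (\<xi> (\<sigma>, t))) = 0"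
proof -
  let ?J = "{s - r..s + r}" and ?K = "{t - e..t + e}"
  have tK: "t \<in> ?K" using e by simp
  have KT: "\<tau> \<in> {0..<T}" if "\<tau> \<in> ?K" for \<tau>
  proof -
    have "(s, \<tau>) \<in> \<Omega>" using Q that r by auto
    then show ?thesis by (simp add: mem_domain)
  qed
  have te: "t + e < T" "0 \<le> t - e" using KT[of "t + e"] KT[of "t - e"] e by auto
  have \<psi>c: "continuous_on UNIV \<psi>" by (rule smooth_alg_continuous[OF \<psi>(1)])
  define P where "P = (\<lambda>p. \<gamma> p * \<psi> (\<xi> p))"
  define Pt where "Pt = (\<lambda>p. \<gamma>t p * \<psi> (\<xi> p) + \<gamma> p * dderiv \<psi> (\<xi> p) (\<xi>t p))"
  define Pv where "Pv = (\<lambda>p. \<gamma> p * dderiv \<psi> (\<xi> p) (vel p))"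
  note c = Ckb_on_1D(1,3,5)[OF \<gamma>] Ckb_on_1D(1,3,5)[OF \<xi>] V_cont
  have cP: "continuous_on \<Omega> P" "continuous_on \<Omega> Pt" "continuous_on \<Omega> Pv"
    unfolding P_def Pt_def Pv_def
    by (intro continuous_intros c continuous_on_dderiv[OF \<psi>(1)] continuous_on_compose2[OF \<psi>c]; simp)+
  define D where "D = {(\<sigma>, \<tau>). \<tau> \<in> ?K \<and> s - r \<le> \<sigma> \<and> \<sigma> \<le> s + r}"
  have D: "D \<subseteq> \<Omega>" using Q by (auto simp: D_def)
  have slice_c: "continuous_on ?J (\<lambda>\<sigma>. g (\<sigma>, \<tau>))" if "continuous_on \<Omega> g" "\<tau> \<in> ?K" for g :: "real \<times> real \<Rightarrow> real" and \<tau>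
    using D that(2) by (intro continuous_on_compose2[OF that(1)] continuous_intros) (auto simp: D_def)
  have param_c: "continuous_on ?K (\<lambda>\<tau>. integral ?J (\<lambda>\<sigma>. g (\<sigma>, \<tau>)))" if "continuous_on \<Omega> g" for g :: "real \<times> real \<Rightarrow> real"
  proof -
    have "continuous_on (?K \<times> cbox (s - r) (s + r)) (\<lambda>(\<tau>, \<sigma>). g (\<sigma>, \<tau>))"
      unfolding split_beta using D by (intro continuous_on_compose2[OF that] continuous_intros) (auto simp: D_def)
    from integral_continuous_on_param[OF this] show ?thesis by simp
  qed
  define A where "A = (\<lambda>\<tau>. integral ?J (\<lambda>\<sigma>. P (\<sigma>, \<tau>)))"
  define A1 where "A1 = (\<lambda>\<tau>. integral ?J (\<lambda>\<sigma>. Pt (\<sigma>, \<tau>)))"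
  define B where "B = (\<lambda>\<tau>. integral ?J (\<lambda>\<sigma>. Pv (\<sigma>, \<tau>)))"
  have cA: "continuous_on ?K A" "continuous_on ?K A1" "continuous_on ?K B"
    unfolding A_def A1_def B_def by (rule param_c, rule cP)+
  have dA: "(A has_real_derivative A1 \<tau>) (at \<tau> within ?K)" if \<tau>: "\<tau> \<in> ?K" for \<tau>
  proof -
    have "((\<lambda>\<tau>. integral {s - r..s + r} (\<lambda>\<sigma>. P (\<sigma>, \<tau>))) has_real_derivative
        integral {s - r..s + r} (\<lambda>\<sigma>. Pt (\<sigma>, \<tau>)) + P (s + r, \<tau>) * 0 - P (s - r, \<tau>) * 0) (at \<tau> within ?K)"
    proof (rule leibniz_moving_endpoints[OF \<tau>, where m = s and l = "\<lambda>_. s - r" and u = "\<lambda>_. s + r", folded D_def])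
      show "continuous_on D P" "continuous_on D Pt" using cP D continuous_on_subset by blast+
      fix \<sigma> \<tau> assume "(\<sigma>, \<tau>) \<in> D"
      then have m: "(\<sigma>, \<tau>) \<in> \<Omega>" using D by blast
      have \<psi>d: "(\<psi> has_derivative frechet_derivative \<psi> (at (\<xi> (\<sigma>, \<tau>)))) (at (\<xi> (\<sigma>, \<tau>)))"
        using smooth_alg_differentiable[OF \<psi>(1)] frechet_derivative_works by blast
      have "((\<lambda>\<tau>. \<psi> (\<xi> (\<sigma>, \<tau>))) has_real_derivative dderiv \<psi> (\<xi> (\<sigma>, \<tau>)) (\<xi>t (\<sigma>, \<tau>))) (at \<tau> within {\<tau>. (\<sigma>, \<tau>) \<in> \<Omega>})"
        using has_derivative_compose[OF Ckb_on_1_has_vector_derivative(2)[OF \<xi> m, unfolded has_vector_derivative_def] \<psi>d]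
        unfolding has_field_derivative_def linear_scale[OF dderiv_linear[OF \<psi>(1)]]
        by (simp add: mult.commute[of _ "dderiv _ _ _"])
      from DERIV_mult[OF Ckb_on_1_has_vector_derivative(2)[OF \<gamma> m, folded has_real_derivative_iff_has_vector_derivative] this]
      have "((\<lambda>\<tau>. P (\<sigma>, \<tau>)) has_real_derivative Pt (\<sigma>, \<tau>)) (at \<tau> within {\<tau>. (\<sigma>, \<tau>) \<in> \<Omega>})"
        by (simp add: P_def Pt_def algebra_simps)
      then show "((\<lambda>\<tau>. P (\<sigma>, \<tau>)) has_real_derivative Pt (\<sigma>, \<tau>)) (at \<tau> within {\<tau>. (\<sigma>, \<tau>) \<in> D})"
        by (rule DERIV_subset) (use D in auto)
    qed (use r in auto)
    then show ?thesis by (simp add: A_def A1_def)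
  qed
  have outside: "\<psi> (\<xi> (\<sigma>, \<tau>)) = 0" "dderiv \<psi> (\<xi> (\<sigma>, \<tau>)) v = 0"
    if "(\<sigma>, \<tau>) \<in> \<Omega>" "\<tau> \<in> ?K" "\<sigma> \<notin> ?J" for \<sigma> \<tau> v
  proof -
    have "\<bar>\<tau> - t\<bar> \<le> e" using that(2) by auto
    moreover have "\<not> \<bar>\<sigma> - s\<bar> < r" using that(3) by auto
    ultimately have "norm (\<xi> (\<sigma>, \<tau>) - x) > \<delta>" using \<delta>[OF that(1)] by (meson not_le)
    then show "\<psi> (\<xi> (\<sigma>, \<tau>)) = 0" "dderiv \<psi> (\<xi> (\<sigma>, \<tau>)) v = 0"
      using \<psi>(2)[of "\<xi> (\<sigma>, \<tau>)"] dderiv_outside_support[where x = x and \<delta> = \<delta>, OF \<psi>(2), where z = "\<xi> (\<sigma>, \<tau>)"] by (auto simp: less_imp_le)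
  qed
  have "(\<lambda>\<tau>. B \<tau> - A1 \<tau>) t = 0"
  proof (rule bump_concentration[OF e, of t "\<lambda>\<tau>. B \<tau> - A1 \<tau>"])
    show "continuous_on ?K (\<lambda>\<tau>. B \<tau> - A1 \<tau>)" by (intro continuous_intros cA)
    fix \<epsilon> :: real assume \<epsilon>: "0 < \<epsilon>" "\<epsilon> < e"
    let ?E = "{t - \<epsilon>..t + \<epsilon>}"
    have EK: "?E \<subseteq> ?K" using \<epsilon> by auto
    have t\<epsilon>: "t + \<epsilon> < T" using te \<epsilon> by simp
    define \<phi> where "\<phi> = (\<lambda>p::(real^2) \<times> real. \<psi> (fst p) * bump ((snd p - t) / \<epsilon>))"
    have "\<forall>y. norm (y - x) \<ge> \<delta> \<longrightarrow> \<psi> y = 0" using \<psi>(2) by blast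
    note pt = product_test_function[OF \<psi>(1) this \<epsilon>(1) t\<epsilon>, folded \<phi>_def]
    define \<theta> where "\<theta> = (\<lambda>\<tau>. bump ((\<tau> - t) / \<epsilon>))"
    define \<theta>' where "\<theta>' = (\<lambda>\<tau>. dbump ((\<tau> - t) / \<epsilon>) / \<epsilon>)"
    have \<theta>0: "\<theta> \<tau> = 0" "\<theta>' \<tau> = 0" if "\<bar>\<tau> - t\<bar> \<ge> \<epsilon>" for \<tau>
    proof -
      have "\<bar>(\<tau> - t) / \<epsilon>\<bar> \<ge> 1" using that \<epsilon>(1) by simp
      then show "\<theta> \<tau> = 0" "\<theta>' \<tau> = 0" by (auto simp: \<theta>_def \<theta>'_def bump_0 dbump_0)
    qed
    have \<theta>d: "(\<theta> has_real_derivative \<theta>' \<tau>) (at \<tau> within S)" for \<tau> S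
    proof -
      have "((\<lambda>\<tau>. (\<tau> - t) / \<epsilon>) has_real_derivative 1 / \<epsilon>) (at \<tau> within S)"
        unfolding divide_inverse by (auto intro!: derivative_eq_intros)
      from DERIV_chain2[OF DERIV_bump this] show ?thesis by (simp add: \<theta>_def \<theta>'_def)
    qed
    have c\<theta>: "continuous_on S \<theta>" "continuous_on S \<theta>'" for S
      unfolding \<theta>_def \<theta>'_def using \<epsilon>(1)
      by (intro continuous_intros continuous_on_compose2[OF continuous_bump[of UNIV]] continuous_on_compose2[OF continuous_dbump[of UNIV]]; simp)+
    define F where "F = (\<lambda>\<tau>. LINT s:I \<tau>|lebesgue. \<gamma> (s, \<tau>) * (time_deriv \<phi> (\<xi> (s, \<tau>)) \<tau> + vel (s, \<tau>) \<bullet> space_grad \<phi> (\<xi> (s, \<tau>)) \<tau>))"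
    have integrand: "\<gamma> p * (time_deriv \<phi> (\<xi> p) \<tau> + vel p \<bullet> space_grad \<phi> (\<xi> p) \<tau>) = \<theta>' \<tau> * P p + \<theta> \<tau> * Pv p" for p \<tau>
      unfolding pt(2,3) P_def Pv_def \<theta>_def \<theta>'_def by (simp add: algebra_simps)
    have F_in: "F \<tau> = \<theta>' \<tau> * A \<tau> + \<theta> \<tau> * B \<tau>" if \<tau>: "\<tau> \<in> ?K" for \<tau>
    proof -
      have J: "?J \<subseteq> I \<tau>" using Q \<tau> by (force simp: mem_domain mem_slice)
      have cc: "continuous_on ?J (\<lambda>\<sigma>. \<theta>' \<tau> * P (\<sigma>, \<tau>) + \<theta> \<tau> * Pv (\<sigma>, \<tau>))"
        by (intro continuous_intros slice_c cP \<tau>)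
      have "F \<tau> = integral ?J (\<lambda>\<sigma>. \<theta>' \<tau> * P (\<sigma>, \<tau>) + \<theta> \<tau> * Pv (\<sigma>, \<tau>))"
        unfolding F_def integrand
      proof (rule set_integral_eq_on_subinterval[OF cc J])
        fix \<sigma> assume "\<sigma> \<in> I \<tau>" "\<sigma> \<notin> ?J"
        then show "\<theta>' \<tau> * P (\<sigma>, \<tau>) + \<theta> \<tau> * Pv (\<sigma>, \<tau>) = 0"
          using outside[of \<sigma> \<tau>] KT[OF \<tau>] \<tau> by (simp add: P_def Pv_def mem_domain mem_slice)
      qed
      also have "\<dots> = \<theta>' \<tau> * A \<tau> + \<theta> \<tau> * B \<tau>"
      proof -
        have i: "(\<lambda>\<sigma>. \<theta>' \<tau> * P (\<sigma>, \<tau>)) integrable_on ?J" "(\<lambda>\<sigma>. \<theta> \<tau> * Pv (\<sigma>, \<tau>)) integrable_on ?J"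
          by (intro integrable_continuous_real continuous_intros slice_c cP \<tau>)+
        show ?thesis using Henstock_Kurzweil_Integration.integral_add[OF i] by (simp add: A_def B_def)
      qed
      finally show ?thesis .
    qed
    have F_out: "F \<tau> = 0" if "\<tau> \<notin> ?E" for \<tau>
    proof -
      have "\<bar>\<tau> - t\<bar> \<ge> \<epsilon>" using that by auto
      then show ?thesis unfolding F_def integrand by (simp add: \<theta>0)
    qed
    have cE: "continuous_on ?E A" "continuous_on ?E A1" "continuous_on ?E B" using cA EK continuous_on_subset by blast+
    have cF: "continuous_on ?E (\<lambda>\<tau>. \<theta>' \<tau> * A \<tau> + \<theta> \<tau> * B \<tau>)" by (intro continuous_intros cE c\<theta>)
    have cF': "continuous_on ?E F" by (rule continuous_on_eq[OF cF]) (use F_in EK in auto)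
    have "(LINT \<tau>:{0<..<T}|lebesgue. F \<tau>) = integral ?E F"
      by (rule set_integral_eq_on_subinterval[OF cF']) (use te \<epsilon> F_out in auto)
    moreover have "integral ?E F = integral ?E (\<lambda>\<tau>. \<theta>' \<tau> * A \<tau> + \<theta> \<tau> * B \<tau>)"
      using F_in EK by (intro Henstock_Kurzweil_Integration.integral_cong) auto
    moreover have "(LINT s:I 0|lebesgue. \<gamma>0 s * \<phi> (\<xi>0 s, 0)) = 0"
    proof -
      have "\<bar>0 - t\<bar> \<ge> \<epsilon>" using te \<epsilon> by simp
      from \<theta>0(1)[OF this] have "\<phi> (y, 0) = 0" for y by (simp add: \<phi>_def \<theta>_def)
      then show ?thesis by simp
    qed
    ultimately have w0: "integral ?E (\<lambda>\<tau>. \<theta>' \<tau> * A \<tau> + \<theta> \<tau> * B \<tau>) = 0"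
      using weak_test[OF pt(1)] by (simp add: F_def)
    have "((\<lambda>\<tau>. \<theta>' \<tau> * A \<tau> + \<theta> \<tau> * A1 \<tau>) has_integral \<theta> (t + \<epsilon>) * A (t + \<epsilon>) - \<theta> (t - \<epsilon>) * A (t - \<epsilon>)) ?E"
    proof (rule fundamental_theorem_of_calculus)
      fix \<tau> assume \<tau>: "\<tau> \<in> ?E"
      have "((\<lambda>\<tau>. \<theta> \<tau> * A \<tau>) has_real_derivative \<theta>' \<tau> * A \<tau> + A1 \<tau> * \<theta> \<tau>) (at \<tau> within ?E)"
        using DERIV_mult[OF \<theta>d DERIV_subset[OF dA EK]] \<tau> EK by blast
      then show "((\<lambda>\<tau>. \<theta> \<tau> * A \<tau>) has_vector_derivative \<theta>' \<tau> * A \<tau> + \<theta> \<tau> * A1 \<tau>) (at \<tau> within ?E)"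
        by (simp add: has_real_derivative_iff_has_vector_derivative mult.commute)
    qed (use \<epsilon> in simp)
    then have w1: "((\<lambda>\<tau>. \<theta>' \<tau> * A \<tau> + \<theta> \<tau> * A1 \<tau>) has_integral 0) ?E"
      using \<theta>0(1)[of "t + \<epsilon>"] \<theta>0(1)[of "t - \<epsilon>"] \<epsilon>(1) by simp
    have w0': "((\<lambda>\<tau>. \<theta>' \<tau> * A \<tau> + \<theta> \<tau> * B \<tau>) has_integral 0) ?E"
      using integrable_integral[OF integrable_continuous_real[OF cF]] w0 by simp
    have "((\<lambda>\<tau>. \<theta> \<tau> * (B \<tau> - A1 \<tau>)) has_integral 0 - 0) ?E"
      by (rule has_integral_eq[OF _ has_integral_diff[OF w0' w1]]) (simp add: algebra_simps)
    then show "integral ?E (\<lambda>\<tau>. bump ((\<tau> - t) / \<epsilon>) * (B \<tau> - A1 \<tau>)) = 0"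
      using integral_unique by (simp add: \<theta>_def)
  qed
  then have "B t - A1 t = 0" by simp
  moreover have "B t - A1 t = integral ?J (\<lambda>\<sigma>. Pv (\<sigma>, t) - Pt (\<sigma>, t))"
    unfolding B_def A1_def
    using integrable_continuous_real[OF slice_c[OF cP(3) tK]] integrable_continuous_real[OF slice_c[OF cP(2) tK]]
    by (simp add: Henstock_Kurzweil_Integration.integral_diff)
  moreover have "Pv p - Pt p = dderiv \<psi> (\<xi> p) (\<gamma> p *\<^sub>R W p) - \<gamma>t p * \<psi> (\<xi> p)" for p
    unfolding Pv_def Pt_def W_def linear_scale[OF dderiv_linear[OF \<psi>(1)]] linear_diff[OF dderiv_linear[OF \<psi>(1)]]
    by (simp add: algebra_simps)
  ultimately show ?thesis by simp
qed

lemma local_weak_curve: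
  assumes t: "0 < t" "t < T" and s: "s0 t < ereal s" "ereal s < s1 t"
  obtains r \<delta> where "r > 0" "{s - r..s + r} \<subseteq> I t"
    "weak_curve (\<lambda>\<sigma>. \<xi> (\<sigma>, t)) (\<lambda>\<sigma>. \<xi>s (\<sigma>, t)) (\<lambda>\<sigma>. \<gamma> (\<sigma>, t) *\<^sub>R W (\<sigma>, t)) (\<lambda>\<sigma>. \<gamma>t (\<sigma>, t)) (s - r) s (s + r) \<delta>"
proof -
  have tT: "t \<in> {0..<T}" using t by simp
  have st: "(s, t) \<in> \<Omega>" using s tT by (simp add: mem_domain less_imp_le)
  obtain d where d: "d > 0"
    "\<And>\<sigma> \<tau>. \<tau> \<in> {0..<T} \<Longrightarrow> \<bar>\<tau> - t\<bar> < d \<Longrightarrow> \<bar>\<sigma> - s\<bar> < d \<Longrightarrow> s0 \<tau> < ereal \<sigma> \<and> ereal \<sigma> < s1 \<tau>"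
    using interior_stable[OF tT s] by blast
  have "continuous_on (I t) (\<lambda>\<sigma>. \<xi>s (\<sigma>, t) \<bullet> \<xi>s (s, t))"
    by (intro continuous_intros slice_measurable(2)[OF Ckb_on_1D(3)[OF \<xi>] tT])
  moreover have "s \<in> I t" using s by (simp add: mem_slice less_imp_le)
  ultimately have "\<exists>k>0. \<forall>\<sigma>\<in>I t. \<bar>\<sigma> - s\<bar> < k \<longrightarrow> \<bar>\<xi>s (\<sigma>, t) \<bullet> \<xi>s (s, t) - \<xi>s (s, t) \<bullet> \<xi>s (s, t)\<bar> < 1 / 2"
    unfolding continuous_on_iff dist_real_def by (elim ballE[of _ _ s] allE[of _ "1/2"]) auto
  then obtain k where k: "k > 0" "\<And>\<sigma>. \<sigma> \<in> I t \<Longrightarrow> \<bar>\<sigma> - s\<bar> < k \<Longrightarrow> \<bar>\<xi>s (\<sigma>, t) \<bullet> \<xi>s (s, t) - \<xi>s (s, t) \<bullet> \<xi>s (s, t)\<bar> < 1 / 2"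
    by blast
  have one: "\<xi>s (s, t) \<bullet> \<xi>s (s, t) = 1" using unit_speed[OF st] by (simp add: dot_square_norm)
  define r where "r = min d k / 2"
  have r: "r > 0" "r < d" "r < k" using d(1) k(1) by (auto simp: r_def)
  obtain \<delta> \<eta> where \<delta>: "\<delta> > 0" "\<eta> > 0"
    "\<And>\<sigma> \<tau>. (\<sigma>, \<tau>) \<in> \<Omega> \<Longrightarrow> \<bar>\<tau> - t\<bar> < \<eta> \<Longrightarrow> norm (\<xi> (\<sigma>, \<tau>) - \<xi> (s, t)) < \<delta> \<Longrightarrow> \<bar>\<sigma> - s\<bar> < r"
    using localization[OF tT s r(1)] by metis
  define e where "e = Min {d, \<eta>, t, T - t} / 2"
  have e: "e > 0" "e < d" "e < \<eta>" "e < t" "e < T - t" using d(1) \<delta>(2) t by (auto simp: e_def min_def)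
  have Q: "{s - r..s + r} \<times> {t - e..t + e} \<subseteq> \<Omega>"
  proof clarify
    fix \<sigma> \<tau> assume h: "\<sigma> \<in> {s - r..s + r}" "\<tau> \<in> {t - e..t + e}"
    have \<tau>: "\<tau> \<in> {0..<T}" using h e by auto
    have "\<bar>\<tau> - t\<bar> < d" "\<bar>\<sigma> - s\<bar> < d" using h e r by (auto simp: abs_less_iff)
    from d(2)[OF \<tau> this] show "(\<sigma>, \<tau>) \<in> \<Omega>" using \<tau> by (simp add: mem_domain less_imp_le)
  qed
  have \<delta>2: "\<bar>\<sigma> - s\<bar> < r" if "(\<sigma>, \<tau>) \<in> \<Omega>" "\<bar>\<tau> - t\<bar> \<le> e" "norm (\<xi> (\<sigma>, \<tau>) - \<xi> (s, t)) \<le> \<delta> / 2" for \<sigma> \<tau>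
    using \<delta>(3)[OF that(1)] that(2,3) e(3) \<delta>(1) by simp
  have mem: "(\<sigma>, t) \<in> \<Omega>" if "\<sigma> \<in> {s - r..s + r}" for \<sigma>
  proof -
    have "(\<sigma>, t) \<in> {s - r..s + r} \<times> {t - e..t + e}" using that e(1) by simp
    then show ?thesis using Q by blast
  qed
  have J: "{s - r..s + r} \<subseteq> I t"
  proof
    fix \<sigma> assume "\<sigma> \<in> {s - r..s + r}"
    from mem[OF this] show "\<sigma> \<in> I t" by (simp add: mem_domain mem_slice)
  qed
  have cJ: "continuous_on {s - r..s + r} (\<lambda>\<sigma>. g (\<sigma>, t))" if "continuous_on \<Omega> g" for g :: "real \<times> real \<Rightarrow> 'z::{banach, second_countable_topology}"
    using continuous_on_subset[OF slice_measurable(2)[OF that tT] J] .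
  show thesis
  proof (rule that[OF r(1) J, of "\<delta> / 2"], unfold_locales)
    fix \<sigma> assume \<sigma>: "\<sigma> \<in> {s - r..s + r}"
    show "((\<lambda>\<sigma>. \<xi> (\<sigma>, t)) has_vector_derivative \<xi>s (\<sigma>, t)) (at \<sigma> within {s - r..s + r})"
      by (rule has_vector_derivative_within_subset[OF Ckb_on_1_has_vector_derivative(1)[OF \<xi> mem[OF \<sigma>]]]) (use mem in auto)
    show "norm (\<xi>s (\<sigma>, t)) = 1" by (rule unit_speed[OF mem[OF \<sigma>]])
    have "\<bar>\<sigma> - s\<bar> < k" using \<sigma> r(3) by (auto simp: abs_less_iff)
    then have "\<bar>\<xi>s (\<sigma>, t) \<bullet> \<xi>s (s, t) - 1\<bar> < 1 / 2" using k(2)[of \<sigma>] J \<sigma> one by auto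
    then show "1 / 2 \<le> \<xi>s (\<sigma>, t) \<bullet> \<xi>s (s, t)" unfolding abs_diff_less_iff by simp
  next
    fix \<psi> :: "real^2 \<Rightarrow> real" assume \<psi>: "smooth_alg \<psi>" "\<And>y. \<delta> / 2 \<le> norm (y - \<xi> (s, t)) \<Longrightarrow> \<psi> y = 0"
    show "integral {s - r..s + r} (\<lambda>\<sigma>. dderiv \<psi> (\<xi> (\<sigma>, t)) (\<gamma> (\<sigma>, t) *\<^sub>R W (\<sigma>, t)) - \<gamma>t (\<sigma>, t) * \<psi> (\<xi> (\<sigma>, t))) = 0"
      by (rule fixed_time_identity[OF t Q r(1) e(1) \<delta>2 \<psi>])
  next
    show "continuous_on {s - r..s + r} (\<lambda>\<sigma>. \<xi>s (\<sigma>, t))" by (rule cJ[OF Ckb_on_1D(3)[OF \<xi>]])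
    show "continuous_on {s - r..s + r} (\<lambda>\<sigma>. \<gamma>t (\<sigma>, t))" by (rule cJ[OF Ckb_on_1D(5)[OF \<gamma>]])
    show "continuous_on {s - r..s + r} (\<lambda>\<sigma>. \<gamma> (\<sigma>, t) *\<^sub>R W (\<sigma>, t))"
      by (intro continuous_intros cJ Ckb_on_1D(1)[OF \<gamma>] W_cont)
  qed (use r(1) \<delta>(1) in auto)
qed

text \<open>
  By \<open>normal_eq_0\<close> the vector \<open>\<gamma> (U - \<xi>\<^sub>t)\<close> is tangential at interior points; its tangential
  component is \<open>a \<gamma>\<close> by definition of \<open>a\<close>.
\<close>

lemma motion_weighted:
  assumes p: "p \<in> \<Omega>"
  shows "\<gamma> p *\<^sub>R W p = (a p * \<gamma> p) *\<^sub>R \<xi>s p"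
proof -
  have "\<gamma> p *\<^sub>R W p - (a p * \<gamma> p) *\<^sub>R \<xi>s p = 0"
  proof (rule zero_by_density[OF _ _ p])
    show "continuous_on \<Omega> (\<lambda>p. \<gamma> p *\<^sub>R W p - (a p * \<gamma> p) *\<^sub>R \<xi>s p)"
      by (intro continuous_intros Ckb_on_1D(1)[OF \<gamma>] W_cont a_cont Ckb_on_1D(3)[OF \<xi>])
    fix s t assume t: "0 < t" "t < T" and s: "s0 t < ereal s" "ereal s < s1 t"
    have st: "(s, t) \<in> \<Omega>" using s t by (simp add: mem_domain less_imp_le)
    obtain r \<delta> where "weak_curve (\<lambda>\<sigma>. \<xi> (\<sigma>, t)) (\<lambda>\<sigma>. \<xi>s (\<sigma>, t)) (\<lambda>\<sigma>. \<gamma> (\<sigma>, t) *\<^sub>R W (\<sigma>, t)) (\<lambda>\<sigma>. \<gamma>t (\<sigma>, t)) (s - r) s (s + r) \<delta>"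
      by (rule local_weak_curve[OF t s]) (rule that)
    from weak_curve.normal_eq_0[OF this] have n: "(\<gamma> (s, t) *\<^sub>R W (s, t)) \<bullet> perp (\<xi>s (s, t)) = 0" .
    have tang: "(\<gamma> (s, t) *\<^sub>R W (s, t)) \<bullet> \<xi>s (s, t) = a (s, t) * \<gamma> (s, t)" by (simp add: a_def inner_commute)
    have "\<gamma> (s, t) *\<^sub>R W (s, t) = (a (s, t) * \<gamma> (s, t)) *\<^sub>R \<xi>s (s, t) + 0 *\<^sub>R perp (\<xi>s (s, t))"
      using unit_frame_decomposition[OF unit_speed[OF st], of "\<gamma> (s, t) *\<^sub>R W (s, t)"] unfolding n tang .
    then show "\<gamma> (s, t) *\<^sub>R W (s, t) - (a (s, t) * \<gamma> (s, t)) *\<^sub>R \<xi>s (s, t) = 0" by simp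
  qed
  then show ?thesis by simp
qed

definition current where "current p = a p * \<gamma> p"

lemma current_cont: "continuous_on \<Omega> current" unfolding current_def by (intro continuous_intros a_cont Ckb_on_1D(1)[OF \<gamma>])

lemma conservation_positive_time:
  assumes t: "0 < t" "t < T" and s: "s0 t < ereal s" "ereal s < s1 t"
  shows "((\<lambda>\<sigma>. current (\<sigma>, t)) has_real_derivative - \<gamma>t (s, t)) (at s)"
proof -
  have tT: "t \<in> {0..<T}" using t by simp
  obtain r \<delta> where J: "{s - r..s + r} \<subseteq> I t" and w: "weak_curve (\<lambda>\<sigma>. \<xi> (\<sigma>, t)) (\<lambda>\<sigma>. \<xi>s (\<sigma>, t)) (\<lambda>\<sigma>. \<gamma> (\<sigma>, t) *\<^sub>R W (\<sigma>, t)) (\<lambda>\<sigma>. \<gamma>t (\<sigma>, t)) (s - r) s (s + r) \<delta>"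
    by (rule local_weak_curve[OF t s]) (rule that)
  show ?thesis
  proof (rule weak_curve.tangential_derivative[OF w])
    show "continuous_on {s - r..s + r} (\<lambda>\<sigma>. current (\<sigma>, t))"
      using continuous_on_subset[OF slice_measurable(2)[OF current_cont tT] J] .
    show "\<gamma> (\<sigma>, t) *\<^sub>R W (\<sigma>, t) = current (\<sigma>, t) *\<^sub>R \<xi>s (\<sigma>, t)" if "\<sigma> \<in> {s - r..s + r}" for \<sigma>
      unfolding current_def using J that tT by (intro motion_weighted) (auto simp: mem_domain mem_slice)
  qed
qed

text \<open>
  The integrated form of the conservation law is continuous in time, so it survives the passage to
  \<open>t = 0\<close>, where no derivative is available beforehand.
\<close>

lemma conservation_integrated:
  assumes t: "t \<in> {0..<T}" and x: "x1 \<le> x2" "s0 t < ereal x1" "ereal x2 < s1 t"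
  shows "current (x2, t) - current (x1, t) + integral {x1..x2} (\<lambda>\<sigma>. \<gamma>t (\<sigma>, t)) = 0"
proof -
  have pos: "current (x2, \<tau>) - current (x1, \<tau>) + integral {x1..x2} (\<lambda>\<sigma>. \<gamma>t (\<sigma>, \<tau>)) = 0"
    if \<tau>: "0 < \<tau>" "\<tau> < T" and x\<tau>: "s0 \<tau> < ereal x1" "ereal x2 < s1 \<tau>" for \<tau>
  proof -
    have i: "s0 \<tau> < ereal \<sigma>" "ereal \<sigma> < s1 \<tau>" if "\<sigma> \<in> {x1..x2}" for \<sigma>
      using x\<tau> that by (auto intro: less_le_trans le_less_trans[of _ "ereal x2"])
    have sub: "{x1..x2} \<subseteq> I \<tau>" using i by (auto simp: mem_slice less_imp_le)
    have "((\<lambda>\<sigma>. - \<gamma>t (\<sigma>, \<tau>)) has_integral current (x2, \<tau>) - current (x1, \<tau>)) {x1..x2}"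
      using x(1) conservation_positive_time[OF \<tau>] i
      by (intro fundamental_theorem_of_calculus)
        (auto simp: has_real_derivative_iff_has_vector_derivative intro: has_vector_derivative_at_within)
    from integral_unique[OF this] show ?thesis by simp
  qed
  show ?thesis
  proof (cases "t = 0")
    case False
    then show ?thesis using pos t x by auto
  next
    case True
    have i1: "ereal x1 < s1 t" and i2: "s0 t < ereal x2"
      using x by (auto intro: le_less_trans[of _ "ereal x2"] less_le_trans[of _ "ereal x1"])
    obtain d1 where d1: "d1 > 0"
      "\<And>\<sigma> \<tau>. \<tau> \<in> {0..<T} \<Longrightarrow> \<bar>\<tau> - t\<bar> < d1 \<Longrightarrow> \<bar>\<sigma> - x1\<bar> < d1 \<Longrightarrow> s0 \<tau> < ereal \<sigma> \<and> ereal \<sigma> < s1 \<tau>"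
      using interior_stable[OF t x(2) i1] by blast
    obtain d2 where d2: "d2 > 0"
      "\<And>\<sigma> \<tau>. \<tau> \<in> {0..<T} \<Longrightarrow> \<bar>\<tau> - t\<bar> < d2 \<Longrightarrow> \<bar>\<sigma> - x2\<bar> < d2 \<Longrightarrow> s0 \<tau> < ereal \<sigma> \<and> ereal \<sigma> < s1 \<tau>"
      using interior_stable[OF t i2 x(3)] by blast
    define \<eta> where "\<eta> = Min {d1, d2, T} / 2"
    have \<eta>: "\<eta> > 0" "\<eta> < d1" "\<eta> < d2" "\<eta> < T" using d1(1) d2(1) T_pos by (auto simp: \<eta>_def min_def)
    have ends: "s0 \<tau> < ereal x1" "ereal x2 < s1 \<tau>" if "\<tau> \<in> {0..\<eta>}" for \<tau>
      using d1(2)[of \<tau> x1] d2(2)[of \<tau> x2] that \<eta> d1(1) d2(1) True by auto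
    have mem: "(\<sigma>, \<tau>) \<in> \<Omega>" if "\<sigma> \<in> {x1..x2}" "\<tau> \<in> {0..\<eta>}" for \<sigma> \<tau>
    proof -
      have "s0 \<tau> \<le> ereal \<sigma>" "ereal \<sigma> \<le> s1 \<tau>"
        using ends[OF that(2)] that(1) by (auto intro: order_trans[OF less_imp_le] order_trans[of _ "ereal x2"] less_imp_le)
      then show ?thesis using that(2) \<eta>(4) by (simp add: mem_domain)
    qed
    have "current (x2, 0) - current (x1, 0) + integral {x1..x2} (\<lambda>\<sigma>. \<gamma>t (\<sigma>, 0)) = 0"
    proof (rule zero_at_left_end[OF \<eta>(1), of "\<lambda>\<tau>. current (x2, \<tau>) - current (x1, \<tau>) + integral {x1..x2} (\<lambda>\<sigma>. \<gamma>t (\<sigma>, \<tau>))"])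
      have "continuous_on ({0..\<eta>} \<times> cbox x1 x2) (\<lambda>(\<tau>, \<sigma>). \<gamma>t (\<sigma>, \<tau>))"
        unfolding split_beta using mem by (intro continuous_on_compose2[OF Ckb_on_1D(5)[OF \<gamma>]] continuous_intros) auto
      from integral_continuous_on_param[OF this]
      have "continuous_on {0..\<eta>} (\<lambda>\<tau>. integral {x1..x2} (\<lambda>\<sigma>. \<gamma>t (\<sigma>, \<tau>)))" by simp
      moreover have "continuous_on {0..\<eta>} (\<lambda>\<tau>. current (x, \<tau>))" if "x \<in> {x1..x2}" for x
        using mem that by (intro continuous_on_compose2[OF current_cont] continuous_intros) auto
      ultimately show "continuous_on {0..\<eta>} (\<lambda>\<tau>. current (x2, \<tau>) - current (x1, \<tau>) + integral {x1..x2} (\<lambda>\<sigma>. \<gamma>t (\<sigma>, \<tau>)))"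
        using x(1) by (intro continuous_intros) auto
      show "current (x2, \<tau>) - current (x1, \<tau>) + integral {x1..x2} (\<lambda>\<sigma>. \<gamma>t (\<sigma>, \<tau>)) = 0" if "0 < \<tau>" "\<tau> \<le> \<eta>" for \<tau>
        using pos[of \<tau>] ends[of \<tau>] that \<eta>(4) by auto
    qed
    then show ?thesis by (simp add: True)
  qed
qed

lemma conservation_interior:
  assumes t: "t \<in> {0..<T}" and s: "s0 t < ereal s" "ereal s < s1 t"
  shows "((\<lambda>\<sigma>. current (\<sigma>, t)) has_real_derivative - \<gamma>t (s, t)) (at s)"
proof -
  obtain d where d: "d > 0"
    "\<And>\<sigma> \<tau>. \<tau> \<in> {0..<T} \<Longrightarrow> \<bar>\<tau> - t\<bar> < d \<Longrightarrow> \<bar>\<sigma> - s\<bar> < d \<Longrightarrow> s0 \<tau> < ereal \<sigma> \<and> ereal \<sigma> < s1 \<tau>"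
    using interior_stable[OF t s] by blast
  define l u where "l = s - d / 2" and "u = s + d / 2"
  have lu: "l < s" "s < u" using d(1) by (auto simp: l_def u_def)
  have i: "s0 t < ereal x \<and> ereal x < s1 t" if "x \<in> {l..u}" for x
    using d(2)[OF t, of x] that d(1) by (auto simp: l_def u_def abs_less_iff)
  have sub: "{l..u} \<subseteq> I t" using i by (auto simp: mem_slice less_imp_le)
  have c: "continuous_on {l..u} (\<lambda>\<sigma>. \<gamma>t (\<sigma>, t))"
    using continuous_on_subset[OF slice_measurable(2)[OF Ckb_on_1D(5)[OF \<gamma>] t] sub] .
  have "((\<lambda>x. current (l, t) - integral {l..x} (\<lambda>\<sigma>. \<gamma>t (\<sigma>, t))) has_real_derivative 0 - \<gamma>t (s, t)) (at s within {l..u})"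
    using integral_has_real_derivative[OF c, of s] lu by (intro DERIV_diff) auto
  then have "((\<lambda>\<sigma>. current (\<sigma>, t)) has_real_derivative 0 - \<gamma>t (s, t)) (at s within {l..u})"
  proof (rule has_field_derivative_transform_within[OF _ zero_less_one])
    show "s \<in> {l..u}" using lu by simp
    fix x assume "x \<in> {l..u}"
    then show "current (l, t) - integral {l..x} (\<lambda>\<sigma>. \<gamma>t (\<sigma>, t)) = current (x, t)"
      using conservation_integrated[OF t, of l x] i[of l] i[of x] lu by simp
  qed
  then show ?thesis using at_within_interior[of s "{l..u}"] lu by (simp add: interior_atLeastAtMost_real)
qed

text \<open>
  At the ends of the slice the derivative comes from the mean value theorem: difference quotients of
  \<open>a \<gamma>\<close> are values of \<open>- \<gamma>\<^sub>t\<close> at interior points in between, and \<open>\<gamma>\<^sub>t\<close> is continuous up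
  to the ends.
\<close>

lemma conservation_slice:
  assumes st: "(s, t) \<in> \<Omega>"
  shows "((\<lambda>\<sigma>. current (\<sigma>, t)) has_real_derivative - \<gamma>t (s, t)) (at s within I t)"
proof -
  have t: "t \<in> {0..<T}" and s: "s \<in> I t" using st by (auto simp: mem_domain mem_slice)
  note mc = slice_measurable(2)[OF current_cont t]
  note gc = slice_measurable(2)[OF Ckb_on_1D(5)[OF \<gamma>] t]
  have mv: "\<exists>z. min x y < z \<and> z < max x y \<and> current (y, t) - current (x, t) = (y - x) * (- \<gamma>t (z, t))"
    if xy: "x \<in> I t" "y \<in> I t" "x < y" for x y
  proof -
    have i: "s0 t < ereal z" "ereal z < s1 t" if "x < z" "z < y" for z
      using xy that by (auto simp: mem_slice intro: le_less_trans[of _ "ereal x"] less_le_trans[of _ "ereal y"])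
    have "continuous_on {x..y} (\<lambda>\<sigma>. current (\<sigma>, t))" using continuous_on_subset[OF mc slice_ivl[OF xy(1,2)]] .
    then have "\<exists>l z. x < z \<and> z < y \<and> ((\<lambda>\<sigma>. current (\<sigma>, t)) has_real_derivative l) (at z) \<and> current (y, t) - current (x, t) = (y - x) * l"
      using conservation_interior[OF t i] xy(3) by (intro MVT) (auto simp: real_differentiable_def)
    then obtain l z where z: "x < z" "z < y" "((\<lambda>\<sigma>. current (\<sigma>, t)) has_real_derivative l) (at z)" "current (y, t) - current (x, t) = (y - x) * l" by blast
    have "l = - \<gamma>t (z, t)" using DERIV_unique[OF z(3) conservation_interior[OF t i[OF z(1,2)]]] .
    then show ?thesis using z xy(3) by auto
  qed
  have mv2: "\<exists>z\<in>I t. \<bar>z - s\<bar> < \<bar>y - s\<bar> \<and> current (y, t) - current (s, t) = (y - s) * (- \<gamma>t (z, t))"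
    if y: "y \<in> I t" "y \<noteq> s" for y
  proof (cases "s < y")
    case True
    obtain z where z: "s < z" "z < y" "current (y, t) - current (s, t) = (y - s) * (- \<gamma>t (z, t))" using mv[OF s y(1) True] True by auto
    have "z \<in> I t" using slice_ivl[OF s y(1)] z by auto
    then show ?thesis using z by (intro bexI[of _ z]) auto
  next
    case False
    then have ys: "y < s" using y by simp
    obtain z where z: "y < z" "z < s" "current (s, t) - current (y, t) = (s - y) * (- \<gamma>t (z, t))" using mv[OF y(1) s ys] ys by auto
    have "z \<in> I t" using slice_ivl[OF y(1) s] z by auto
    then show ?thesis using z by (intro bexI[of _ z]) (auto simp: algebra_simps)
  qed
  show ?thesis
    unfolding has_field_derivative_def has_derivative_within_alt
  proof (intro conjI allI impI)
    fix e :: real assume e: "e > 0"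
    obtain d where d: "d > 0" "\<And>z. z \<in> I t \<Longrightarrow> \<bar>z - s\<bar> < d \<Longrightarrow> \<bar>\<gamma>t (z, t) - \<gamma>t (s, t)\<bar> < e"
      using gc[unfolded continuous_on_iff dist_real_def, THEN bspec, OF s, THEN spec, THEN mp, OF e] by blast
    show "\<exists>d>0. \<forall>y\<in>I t. norm (y - s) < d \<longrightarrow> norm (current (y, t) - current (s, t) - (- \<gamma>t (s, t)) * (y - s)) \<le> e * norm (y - s)"
    proof (intro exI[of _ d] conjI ballI impI d(1))
      fix y assume y: "y \<in> I t" "norm (y - s) < d"
      show "norm (current (y, t) - current (s, t) - (- \<gamma>t (s, t)) * (y - s)) \<le> e * norm (y - s)"
      proof (cases "y = s")
        case False
        obtain z where z: "z \<in> I t" "\<bar>z - s\<bar> < \<bar>y - s\<bar>" "current (y, t) - current (s, t) = (y - s) * (- \<gamma>t (z, t))"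
          using mv2[OF y(1) False] by blast
        have "current (y, t) - current (s, t) - (- \<gamma>t (s, t)) * (y - s) = - ((\<gamma>t (z, t) - \<gamma>t (s, t)) * (y - s))"
          unfolding z(3) by (simp add: algebra_simps)
        moreover have "\<bar>\<gamma>t (z, t) - \<gamma>t (s, t)\<bar> \<le> e" using d(2)[OF z(1)] z(2) y(2) by simp
        then have "\<bar>\<gamma>t (z, t) - \<gamma>t (s, t)\<bar> * \<bar>y - s\<bar> \<le> e * \<bar>y - s\<bar>" by (rule mult_right_mono) simp
        ultimately show ?thesis by (simp add: abs_mult)
      qed simp
    qed
  qed (rule bounded_linear_mult_right)
qed

lemma conservation: "BR_conservation T s0 s1 \<gamma> a"
  unfolding BR_conservation_def Let_def
proof clarify
  fix s t assume "(s, t) \<in> \<Omega>"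
  from conservation_slice[OF this] show "\<exists>D. ((\<lambda>s'. a (s', t) * \<gamma> (s', t)) has_real_derivative D) (at s within I t) \<and> \<gamma>t (s, t) + D = 0"
    by (intro exI[of _ "- \<gamma>t (s, t)"]) (simp add: current_def)
qed

text \<open>
  The product of \<open>\<gamma>\<close> with the defect of the motion law vanishes.  Where the defect is nonzero, it is
  nonzero on a neighbourhood, and there \<open>\<gamma>\<close> vanishes identically.
\<close>

lemma motion_off_vacuum:
  assumes p: "p \<in> \<Omega>" and nv: "\<not> (\<exists>N. open N \<and> p \<in> N \<and> (\<forall>q\<in>N \<inter> \<Omega>. \<gamma> q = 0))"
  shows "BR_motion_at T s0 s1 \<xi> \<gamma> a p"
proof -
  define Z where "Z q = W q - a q *\<^sub>R \<xi>s q" for q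
  have Zc: "continuous_on \<Omega> Z" unfolding Z_def by (intro continuous_intros W_cont a_cont Ckb_on_1D(3)[OF \<xi>])
  have prod: "\<gamma> q *\<^sub>R Z q = 0" if "q \<in> \<Omega>" for q
    using motion_weighted[OF that] by (simp add: Z_def scaleR_right_diff_distrib mult.commute)
  have "Z p = 0"
  proof (rule ccontr)
    assume nz: "Z p \<noteq> 0"
    have "open (- {0 :: real^2})" by auto
    then obtain N where N: "open N" "N \<inter> \<Omega> = Z -` (- {0}) \<inter> \<Omega>" using Zc unfolding continuous_on_open_invariant by blast
    then have "p \<in> N" using p nz by blast
    moreover have "\<gamma> q = 0" if "q \<in> N \<inter> \<Omega>" for q
    proof -
      have "Z q \<noteq> 0" "q \<in> \<Omega>" using that N(2) by auto
      then show ?thesis using prod[of q] by simp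
    qed
    ultimately show False using nv N(1) by blast
  qed
  moreover have "velocity_defined s0 s1 \<xi> \<gamma> p" using weak p by (auto simp: weak_BR_solution_def)
  ultimately show ?thesis by (simp add: BR_motion_at_def Let_def Z_def W_def algebra_simps)
qed

lemma transported: "transported_sheet T s0 s1 \<gamma> a \<xi> vel"
proof
  show "bounded (a ` \<Omega>)"
  proof -
    have "bounded (vel ` \<Omega>)" using V by simp
    then obtain C1 where C1: "\<forall>p\<in>\<Omega>. norm (vel p) \<le> C1" by (auto simp: bounded_iff)
    obtain C2 where C2: "\<forall>p\<in>\<Omega>. norm (\<xi>t p) \<le> C2" using Ckb_on_1D(6)[OF \<xi>] by (auto simp: bounded_iff)
    have "norm (a p) \<le> C1 + C2" if p: "p \<in> \<Omega>" for p
    proof -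
      have "\<bar>a p\<bar> \<le> norm (\<xi>s p) * norm (W p)" unfolding a_def by (rule Cauchy_Schwarz_ineq2)
      also have "\<dots> \<le> norm (vel p) + norm (\<xi>t p)" using unit_speed[OF p] norm_triangle_ineq4[of "vel p" "\<xi>t p"] by (simp add: W_def)
      also have "\<dots> \<le> C1 + C2" using C1 C2 p by (intro add_mono) auto
      finally show ?thesis by simp
    qed
    then show ?thesis by (intro boundedI[where B = "C1 + C2"]) blast
  qed
  show "\<gamma> p *\<^sub>R (\<xi>t p + a p *\<^sub>R \<xi>s p) = \<gamma> p *\<^sub>R vel p" if "p \<in> \<Omega>" for p
    using motion_weighted[OF that] by (simp add: W_def algebra_simps)
  show "Linf_L1 T s0 s1 \<gamma>" using weak by (simp add: weak_BR_solution_def)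
qed (use \<gamma> \<xi> a_cont conservation in auto)

abbreviation "flux \<sigma> t \<equiv> endpoint_flux T \<gamma> a \<sigma> t"

lemma endpoint_in_domain:
  assumes "\<sigma> \<in> {s0, s1}" "endpoint_C1b T \<sigma>" "t \<in> {0..<T}"
  shows "(real_of_ereal (\<sigma> t), t) \<in> \<Omega>"
  using ordered[OF assms(3)] endpoint_C1b_finite(1)[OF assms(2,3)] assms by (auto simp: mem_domain less_imp_le)

lemma endpoint_continuous:
  assumes \<sigma>: "\<sigma> \<in> {s0, s1}" and C: "endpoint_C1b T \<sigma>"
  shows "continuous_on {0..<T} (\<lambda>t. \<xi> (real_of_ereal (\<sigma> t), t))" "continuous_on {0..<T} (flux \<sigma>)"
proof -
  have g: "Ckb_on 1 {0..<T} (\<lambda>t. real_of_ereal (\<sigma> t))" using C by (simp add: endpoint_C1b_def)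
  have pr: "continuous_on {0..<T} (\<lambda>t. (real_of_ereal (\<sigma> t), t))"
    by (intro continuous_intros Ckb_on_1_real(1)[OF g])
  have comp: "continuous_on {0..<T} (\<lambda>t. h (real_of_ereal (\<sigma> t), t))" if "continuous_on \<Omega> h" for h :: "real \<times> real \<Rightarrow> 'z::real_normed_vector"
    using endpoint_in_domain[OF \<sigma> C] by (intro continuous_on_compose2[OF that pr]) auto
  show "continuous_on {0..<T} (\<lambda>t. \<xi> (real_of_ereal (\<sigma> t), t))" by (rule comp[OF Ckb_on_1D(1)[OF \<xi>]])
  show "continuous_on {0..<T} (flux \<sigma>)"
    unfolding endpoint_flux_def by (intro continuous_intros comp Ckb_on_1D(1)[OF \<gamma>] a_cont Ckb_on_1_real(4)[OF g])
qed

lemma endpoint_cases: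
  assumes "\<sigma> \<in> {s0, s1}"
  shows "(\<forall>t\<in>{0..<T}. \<bar>\<sigma> t\<bar> = \<infinity>) \<or> endpoint_C1b T \<sigma>"
  using assms s0_cases s1_cases by auto

definition outflow where
  "outflow \<psi> \<sigma> t = (if \<bar>\<sigma> t\<bar> = \<infinity> then 0 else flux \<sigma> t * \<psi> (\<xi> (real_of_ereal (\<sigma> t), t)))"

lemma outflow_continuous:
  assumes \<sigma>: "\<sigma> \<in> {s0, s1}" and \<psi>: "continuous_on UNIV \<psi>"
  shows "continuous_on {0..<T} (outflow \<psi> \<sigma>)"
  using endpoint_cases[OF \<sigma>]
proof
  assume inf: "\<forall>t\<in>{0..<T}. \<bar>\<sigma> t\<bar> = \<infinity>"
  show ?thesis by (rule continuous_on_eq[OF continuous_on_const[of _ 0]]) (use inf in \<open>auto simp: outflow_def\<close>)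
next
  assume C: "endpoint_C1b T \<sigma>"
  have "continuous_on {0..<T} (\<lambda>t. flux \<sigma> t * \<psi> (\<xi> (real_of_ereal (\<sigma> t), t)))"
    by (intro continuous_on_mult endpoint_continuous(2)[OF \<sigma> C] continuous_on_compose2[OF \<psi> endpoint_continuous(1)[OF \<sigma> C]]) simp
  then show ?thesis
    by (rule continuous_on_eq) (use endpoint_C1b_finite(2)[OF C] in \<open>auto simp: outflow_def\<close>)
qed

text \<open>
  \<open>weak_identity\<close> and the weak formulation differ by the endpoint terms alone when \<open>\<phi>\<close> vanishes at
  time \<open>0\<close>, so the integral of their difference is \<open>0\<close>; \<open>bump_concentration\<close> removes the integral.
\<close>

lemma outflow_balance:
  assumes \<psi>: "smooth_alg \<psi>" "\<And>y. norm (y - x) \<ge> \<delta> \<Longrightarrow> \<psi> y = 0" and t: "0 < t" "t < T"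
  shows "outflow \<psi> s1 t = outflow \<psi> s0 t"
proof -
  define e where "e = min t (T - t) / 2"
  have e: "e > 0" "e < t" "e < T - t" using t by (auto simp: e_def min_def)
  have \<psi>c: "continuous_on UNIV \<psi>" by (rule smooth_alg_continuous[OF \<psi>(1)])
  have sub: "{t - e..t + e} \<subseteq> {0..<T}" using e by auto
  have c: "continuous_on {0..<T} (outflow \<psi> s1)" "continuous_on {0..<T} (outflow \<psi> s0)"
    by (rule outflow_continuous[OF _ \<psi>c]; simp)+
  have "(\<lambda>\<tau>. outflow \<psi> s1 \<tau> - outflow \<psi> s0 \<tau>) t = 0"
  proof (rule bump_concentration[OF e(1), of t "\<lambda>\<tau>. outflow \<psi> s1 \<tau> - outflow \<psi> s0 \<tau>"])
    show "continuous_on {t - e..t + e} (\<lambda>\<tau>. outflow \<psi> s1 \<tau> - outflow \<psi> s0 \<tau>)"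
      by (intro continuous_intros continuous_on_subset[OF c(1) sub] continuous_on_subset[OF c(2) sub])
    fix \<epsilon> :: real assume \<epsilon>: "0 < \<epsilon>" "\<epsilon> < e"
    have t\<epsilon>: "t + \<epsilon> < T" using e \<epsilon> by simp
    define \<phi> where "\<phi> = (\<lambda>p::(real^2) \<times> real. \<psi> (fst p) * bump ((snd p - t) / \<epsilon>))"
    have "\<forall>y. norm (y - x) \<ge> \<delta> \<longrightarrow> \<psi> y = 0" using \<psi>(2) by blast
    note pt = product_test_function[OF \<psi>(1) this \<epsilon>(1) t\<epsilon>, folded \<phi>_def]
    interpret tt: transported_sheet_test T s0 s1 \<gamma> a \<xi> vel \<phi>
      unfolding transported_sheet_test_def transported_sheet_test_axioms_def using transported pt(1) by simp
    have bt: "tt.boundary_term \<sigma> \<tau> = bump ((\<tau> - t) / \<epsilon>) * outflow \<psi> \<sigma> \<tau>" for \<sigma> \<tau>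
      unfolding tt.boundary_term_def outflow_def by (simp add: \<phi>_def)
    have \<theta>c: "continuous_on S (\<lambda>\<tau>. bump ((\<tau> - t) / \<epsilon>))" for S
      using \<epsilon>(1) by (intro continuous_on_compose2[OF continuous_bump[of UNIV]] continuous_intros) auto
    have \<theta>0: "bump ((\<tau> - t) / \<epsilon>) = 0" if "\<bar>\<tau> - t\<bar> \<ge> \<epsilon>" for \<tau>
    proof (rule bump_0)
      show "1 \<le> \<bar>(\<tau> - t) / \<epsilon>\<bar>" using that \<epsilon>(1) by simp
    qed
    have btc: "continuous_on {0..<T} (tt.boundary_term s1)" "continuous_on {0..<T} (tt.boundary_term s0)"
      unfolding bt by (intro continuous_intros \<theta>c c)+
    obtain T' where T': "0 < T'" "T' < T" "\<forall>\<tau>\<ge>T'. tt.boundary_term s1 \<tau> = 0 \<and> tt.boundary_term s0 \<tau> = 0"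
      and id: "(LINT t:{0<..<T}|lebesgue. LINT s:I t|lebesgue.
          \<gamma> (s, t) * (time_deriv \<phi> (\<xi> (s, t)) t + vel (s, t) \<bullet> space_grad \<phi> (\<xi> (s, t)) t))
        + integral {0..T'} (\<lambda>t. tt.boundary_term s1 t - tt.boundary_term s0 t)
        + (LINT s:I 0|lebesgue. \<gamma> (s, 0) * \<phi> (\<xi> (s, 0), 0)) = 0"
      using tt.weak_identity[OF btc] by blast
    have \<phi>0: "\<phi> (y, 0) = 0" for y using \<theta>0[of 0] e \<epsilon> by (simp add: \<phi>_def)
    have z: "integral {0..T'} (\<lambda>t. tt.boundary_term s1 t - tt.boundary_term s0 t) = 0"
      using id weak_test[OF pt(1)] by (simp add: \<phi>0)
    define T'' where "T'' = max T' (t + \<epsilon>)"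
    have T'': "T' \<le> T''" "t + \<epsilon> \<le> T''" "T'' < T" using T'(2) t\<epsilon> by (auto simp: T''_def)
    have bc: "continuous_on {0..T''} (\<lambda>\<tau>. tt.boundary_term s1 \<tau> - tt.boundary_term s0 \<tau>)"
      using T''(3) by (intro continuous_intros continuous_on_subset[OF btc(1)] continuous_on_subset[OF btc(2)]) auto
    have s1: "integral {0..T''} (\<lambda>\<tau>. tt.boundary_term s1 \<tau> - tt.boundary_term s0 \<tau>) = integral {0..T'} (\<lambda>\<tau>. tt.boundary_term s1 \<tau> - tt.boundary_term s0 \<tau>)"
      by (rule integral_eq_on_subinterval[OF bc]) (use T'' T' in auto)
    have s2: "integral {0..T''} (\<lambda>\<tau>. tt.boundary_term s1 \<tau> - tt.boundary_term s0 \<tau>) = integral {t - \<epsilon>..t + \<epsilon>} (\<lambda>\<tau>. tt.boundary_term s1 \<tau> - tt.boundary_term s0 \<tau>)"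
    proof (rule integral_eq_on_subinterval[OF bc])
      show "{t - \<epsilon>..t + \<epsilon>} \<subseteq> {0..T''}" using e \<epsilon> T'' by auto
      fix \<tau> assume "\<tau> \<notin> {t - \<epsilon>..t + \<epsilon>}"
      then have "\<bar>\<tau> - t\<bar> \<ge> \<epsilon>" by auto
      from \<theta>0[OF this] show "tt.boundary_term s1 \<tau> - tt.boundary_term s0 \<tau> = 0" by (simp add: bt)
    qed
    show "integral {t - \<epsilon>..t + \<epsilon>} (\<lambda>\<tau>. bump ((\<tau> - t) / \<epsilon>) * (outflow \<psi> s1 \<tau> - outflow \<psi> s0 \<tau>)) = 0"
      using s1 s2 z by (simp add: bt right_diff_distrib)
  qed
  then show ?thesis by simp
qed

lemma plane_bump:
  fixes x :: "real^2"
  assumes "\<delta> > 0"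
  obtains \<psi> where "smooth_alg \<psi>" "\<psi> x = 1" "\<And>y. norm (y - x) \<ge> \<delta> \<Longrightarrow> \<psi> y = 0"
proof -
  define \<psi> where "\<psi> = (\<lambda>y. bump ((y - x) \<bullet> axis 1 1 / (\<delta> / 2)) * bump ((y - x) \<bullet> axis 2 1 / (\<delta> / 2)))"
  have e: "(y - x) \<bullet> v / k = y \<bullet> (inverse k *\<^sub>R v) + (- (x \<bullet> v) / k)" for y v k
    by (simp add: inner_diff_left divide_inverse algebra_simps)
  have sm: "smooth_alg \<psi>" unfolding \<psi>_def e by (intro smooth_alg.mult smooth_alg_bump)
  have z: "\<psi> y = 0" if n: "norm (y - x) \<ge> \<delta>" for y
  proof -
    have "norm (y - x) \<le> \<bar>(y - x) $ 1\<bar> + \<bar>(y - x) $ 2\<bar>"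
      using norm_le_l1_cart[of "y - x"] by (simp add: sum_2)
    then have "\<bar>(y - x) $ 1\<bar> \<ge> \<delta> / 2 \<or> \<bar>(y - x) $ 2\<bar> \<ge> \<delta> / 2" using n by linarith
    moreover have "\<bar>k / (\<delta> / 2)\<bar> \<ge> 1" if "\<bar>k\<bar> \<ge> \<delta> / 2" for k
      using assms that by (simp add: abs_divide le_divide_eq)
    moreover have "(y - x) \<bullet> axis i 1 = (y - x) $ i" for i by (simp add: inner_axis)
    ultimately have "\<bar>(y - x) \<bullet> axis 1 1 / (\<delta> / 2)\<bar> \<ge> 1 \<or> \<bar>(y - x) \<bullet> axis 2 1 / (\<delta> / 2)\<bar> \<ge> 1"
      by metis
    then show ?thesis unfolding \<psi>_def using bump_0 by force
  qed
  show thesis by (rule that[OF sm _ z]) (simp add: \<psi>_def bump_1)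
qed

text \<open>
  If the ends are at different points, or one of them is infinite, a bump at one end does not meet the
  other.
\<close>

lemma flux_positive_time:
  assumes t: "0 < t" "t < T"
  shows "closed_at s0 s1 \<xi> t \<Longrightarrow> flux s0 t = flux s1 t"
    and "\<not> closed_at s0 s1 \<xi> t \<Longrightarrow> \<sigma> \<in> {s0, s1} \<Longrightarrow> \<bar>\<sigma> t\<bar> \<noteq> \<infinity> \<Longrightarrow> flux \<sigma> t = 0"
proof -
  assume cl: "closed_at s0 s1 \<xi> t"
  obtain \<psi> where \<psi>: "smooth_alg \<psi>" "\<psi> (\<xi> (real_of_ereal (s0 t), t)) = 1"
    "\<And>y. norm (y - \<xi> (real_of_ereal (s0 t), t)) \<ge> 1 \<Longrightarrow> \<psi> y = 0"
    using plane_bump[OF zero_less_one] by metis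
  show "flux s0 t = flux s1 t"
    using outflow_balance[OF \<psi>(1,3) t] \<psi>(2) cl by (simp add: outflow_def closed_at_def)
next
  assume ncl: "\<not> closed_at s0 s1 \<xi> t" and \<sigma>: "\<sigma> \<in> {s0, s1}" and fin: "\<bar>\<sigma> t\<bar> \<noteq> \<infinity>"
  define \<sigma>' where "\<sigma>' = (if \<sigma> = s0 then s1 else s0)"
  have pair: "(\<sigma> = s0 \<and> \<sigma>' = s1) \<or> (\<sigma> = s1 \<and> \<sigma>' = s0)" using \<sigma> by (auto simp: \<sigma>'_def)
  let ?x = "\<xi> (real_of_ereal (\<sigma> t), t)" and ?x' = "\<xi> (real_of_ereal (\<sigma>' t), t)"
  define \<delta> where "\<delta> = (if \<bar>\<sigma>' t\<bar> = \<infinity> then 1 else norm (?x' - ?x))"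
  have ne: "\<bar>\<sigma>' t\<bar> \<noteq> \<infinity> \<Longrightarrow> ?x' \<noteq> ?x" using ncl pair fin by (auto simp: closed_at_def)
  then have \<delta>: "\<delta> > 0" by (simp add: \<delta>_def)
  obtain \<psi> where \<psi>: "smooth_alg \<psi>" "\<psi> ?x = 1" "\<And>y. norm (y - ?x) \<ge> \<delta> \<Longrightarrow> \<psi> y = 0"
    using plane_bump[OF \<delta>] by metis
  have "outflow \<psi> \<sigma> t = outflow \<psi> \<sigma>' t" using outflow_balance[OF \<psi>(1,3) t] pair by auto
  moreover have "outflow \<psi> \<sigma>' t = 0" using \<psi>(3)[of ?x'] by (simp add: outflow_def \<delta>_def)
  moreover have "outflow \<psi> \<sigma> t = flux \<sigma> t" using \<psi>(2) fin by (simp add: outflow_def)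
  ultimately show "flux \<sigma> t = 0" by simp
qed

text \<open>
  At \<open>t = 0\<close> the condition is a limit of those at positive times.  If the curve is closed at \<open>0\<close>,
  the fluxes agree at all later times, since they vanish whenever the curve is open; if it is open at
  \<open>0\<close>, it stays open for a while.
\<close>

lemma endpoint_flux_condition:
  assumes t: "t \<in> {0..<T}"
  shows "if closed_at s0 s1 \<xi> t then flux s0 t = flux s1 t
         else \<forall>\<sigma>\<in>{s0, s1}. \<bar>\<sigma> t\<bar> \<noteq> \<infinity> \<longrightarrow> flux \<sigma> t = 0"
proof (cases "t = 0")
  case False
  then have t': "0 < t" "t < T" using t by auto
  show ?thesis using flux_positive_time[OF t'] by simp
next
  case True
  have C: "endpoint_C1b T \<sigma>" if "\<sigma> \<in> {s0, s1}" "\<bar>\<sigma> 0\<bar> \<noteq> \<infinity>" for \<sigma>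
  proof -
    have "0 \<in> {0..<T}" using T_pos by simp
    then show ?thesis using endpoint_cases[OF that(1)] that(2) by metis
  qed
  have sub: "{0..T / 2} \<subseteq> {0..<T}" using T_pos by auto
  show ?thesis
  proof (cases "closed_at s0 s1 \<xi> 0")
    case cl: True
    then have C01: "endpoint_C1b T s0" "endpoint_C1b T s1" using C by (auto simp: closed_at_def)
    have "flux s0 0 - flux s1 0 = 0"
    proof (rule zero_at_left_end[of "T / 2" "\<lambda>t. flux s0 t - flux s1 t"])
      show "continuous_on {0..T / 2} (\<lambda>t. flux s0 t - flux s1 t)"
        using endpoint_continuous(2)[OF _ C01(1)] endpoint_continuous(2)[OF _ C01(2)] sub
        by (intro continuous_intros) (auto elim: continuous_on_subset)
      fix \<tau> assume \<tau>: "0 < \<tau>" "\<tau> \<le> T / 2"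
      then have \<tau>T: "\<tau> < T" "\<tau> \<in> {0..<T}" using T_pos by auto
      show "flux s0 \<tau> - flux s1 \<tau> = 0"
        using flux_positive_time[OF \<tau>(1) \<tau>T(1)] endpoint_C1b_finite(2)[OF C01(1) \<tau>T(2)] endpoint_C1b_finite(2)[OF C01(2) \<tau>T(2)]
        by (cases "closed_at s0 s1 \<xi> \<tau>") auto
    qed (use T_pos in simp)
    then show ?thesis using cl True by simp
  next
    case ncl: False
    have "flux \<sigma> 0 = 0" if \<sigma>: "\<sigma> \<in> {s0, s1}" and fin: "\<bar>\<sigma> 0\<bar> \<noteq> \<infinity>" for \<sigma>
    proof -
      have C\<sigma>: "endpoint_C1b T \<sigma>" by (rule C[OF \<sigma> fin])
      have "\<exists>\<eta>>0. \<eta> < T \<and> (\<forall>\<tau>. 0 < \<tau> \<and> \<tau> \<le> \<eta> \<longrightarrow> \<not> closed_at s0 s1 \<xi> \<tau>)"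
      proof (cases "\<bar>s0 0\<bar> \<noteq> \<infinity> \<and> \<bar>s1 0\<bar> \<noteq> \<infinity>")
        case True
        then have C01: "endpoint_C1b T s0" "endpoint_C1b T s1" using C by auto
        define g where "g = (\<lambda>t. norm (\<xi> (real_of_ereal (s0 t), t) - \<xi> (real_of_ereal (s1 t), t)))"
        have gc: "continuous_on {0..<T} g" unfolding g_def
          by (intro continuous_intros endpoint_continuous(1)[OF _ C01(1)] endpoint_continuous(1)[OF _ C01(2)]) auto
        have g0: "g 0 > 0" using ncl True by (simp add: g_def closed_at_def)
        have "0 \<in> {0..<T}" using T_pos by simp
        from gc[unfolded continuous_on_iff dist_real_def, THEN bspec, OF this, THEN spec, THEN mp, OF g0]
        obtain d where d: "d > 0" "\<And>\<tau>. \<tau> \<in> {0..<T} \<Longrightarrow> \<bar>\<tau> - 0\<bar> < d \<Longrightarrow> \<bar>g \<tau> - g 0\<bar> < g 0" by blast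
        show ?thesis
        proof (intro exI[of _ "min d T / 2"] conjI allI impI)
          fix \<tau> assume \<tau>: "0 < \<tau> \<and> \<tau> \<le> min d T / 2"
          then have "\<tau> \<in> {0..<T}" "\<bar>\<tau> - 0\<bar> < d" using d(1) T_pos by (auto simp: min_def split: if_splits)
          from d(2)[OF this] have "g \<tau> \<noteq> 0" by auto
          then show "\<not> closed_at s0 s1 \<xi> \<tau>" by (auto simp: closed_at_def g_def)
        qed (use d(1) T_pos in \<open>auto simp: min_def\<close>)
      next
        case False
        then have "(\<forall>t\<in>{0..<T}. \<bar>s0 t\<bar> = \<infinity>) \<or> (\<forall>t\<in>{0..<T}. \<bar>s1 t\<bar> = \<infinity>)"
          using endpoint_cases[of s0] endpoint_cases[of s1] endpoint_C1b_finite(2)[of T s0 0] endpoint_C1b_finite(2)[of T s1 0] T_pos by auto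
        have "\<not> closed_at s0 s1 \<xi> \<tau>" if "0 < \<tau> \<and> \<tau> \<le> T / 2" for \<tau>
        proof -
          have "\<tau> \<in> {0..<T}" using that T_pos by auto
          then have "\<bar>s0 \<tau>\<bar> = \<infinity> \<or> \<bar>s1 \<tau>\<bar> = \<infinity>"
            using \<open>(\<forall>t\<in>{0..<T}. \<bar>s0 t\<bar> = \<infinity>) \<or> (\<forall>t\<in>{0..<T}. \<bar>s1 t\<bar> = \<infinity>)\<close> by metis
          then show ?thesis unfolding closed_at_def by metis
        qed
        then show ?thesis using T_pos by (intro exI[of _ "T / 2"]) auto
      qed
      then obtain \<eta> where \<eta>: "\<eta> > 0" "\<eta> < T" "\<And>\<tau>. 0 < \<tau> \<Longrightarrow> \<tau> \<le> \<eta> \<Longrightarrow> \<not> closed_at s0 s1 \<xi> \<tau>" by blast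
      show ?thesis
      proof (rule zero_at_left_end[OF \<eta>(1), of "flux \<sigma>"])
        show "continuous_on {0..\<eta>} (flux \<sigma>)"
          by (rule continuous_on_subset[OF endpoint_continuous(2)[OF \<sigma> C\<sigma>]]) (use \<eta>(2) in auto)
        fix \<tau> assume \<tau>: "0 < \<tau>" "\<tau> \<le> \<eta>"
        then have \<tau>T: "\<tau> < T" "\<tau> \<in> {0..<T}" using \<eta>(2) by auto
        show "flux \<sigma> \<tau> = 0"
          by (rule flux_positive_time(2)[OF \<tau>(1) \<tau>T(1) \<eta>(3)[OF \<tau>] \<sigma> endpoint_C1b_finite(2)[OF C\<sigma> \<tau>T(2)]])
      qed
    qed
    then show ?thesis using ncl True by simp
  qed
qed

end

section \<open>The equivalence\<close>

theorem theorem2p2: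
  fixes T :: real
    and s0 s1 :: "real \<Rightarrow> ereal"
    and \<Omega> :: "(real \<times> real) set"
    and \<xi> :: "real \<times> real \<Rightarrow> real^2"
    and \<gamma> :: "real \<times> real \<Rightarrow> real"
  assumes "T > 0"
    and "\<And>t. t \<in> {0..<T} \<Longrightarrow> s0 t < s1 t"
    and "\<Omega> = sheet_domain T s0 s1"
  shows
    "(\<forall>a :: real \<times> real \<Rightarrow> real.
        Ckb_on 1 \<Omega> \<xi> \<and> Ckb_on 1 \<Omega> \<gamma> \<and> Ckb_on 1 \<Omega> a \<and>
        (\<forall>p\<in>\<Omega>. BR_motion_at T s0 s1 \<xi> \<gamma> a p) \<and>
        BR_conservation T s0 s1 \<gamma> a \<and>
        BR_unit_speed T s0 s1 \<xi> \<and>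
        Linf_L1 T s0 s1 \<gamma> \<and>
        (\<forall>\<sigma>\<in>{s0, s1}. endpoint_differentiable T \<sigma>) \<and>
        (\<forall>\<sigma>\<in>{s0, s1}. \<forall>t\<in>{0..<T}. \<bar>\<sigma> t\<bar> \<noteq> \<infinity> \<longrightarrow> endpoint_flux T \<gamma> a \<sigma> t = 0) \<and>
        (\<exists>c::real. \<forall>\<sigma>\<in>{s0, s1}. \<forall>t\<in>{0..<T}.
           \<bar>\<sigma> t\<bar> = \<infinity> \<and> (\<exists>x. curve_value \<xi> t (\<sigma> t) x) \<longrightarrow>
           (\<integral>\<^sup>+s\<in>slice s0 s1 t. ennreal \<bar>\<gamma> (s, t)\<bar> \<partial>lebesgue) \<le> ennreal c)
        \<longrightarrow> weak_BR_solution T s0 s1 \<gamma> \<xi> (\<lambda>s. \<gamma> (s, 0)) (\<lambda>s. \<xi> (s, 0)))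
     \<and>
     (\<forall>(\<gamma>0 :: real \<Rightarrow> real) (\<xi>0 :: real \<Rightarrow> real^2) (a :: real \<times> real \<Rightarrow> real).
        weak_BR_solution T s0 s1 \<gamma> \<xi> \<gamma>0 \<xi>0 \<and>
        one_to_one_sheet T s0 s1 \<xi> \<and>
        Ckb_on 1 \<Omega> \<xi> \<and> Ckb_on 1 \<Omega> \<gamma> \<and>
        Ckb_on 0 \<Omega> (velocity s0 s1 \<xi> \<gamma>) \<and>
        (\<forall>\<sigma>\<in>{s0, s1}. (\<exists>t\<in>{0..<T}. \<bar>\<sigma> t\<bar> \<noteq> \<infinity>) \<longrightarrow> endpoint_C1b T \<sigma>) \<and>
        a = (\<lambda>p. pd_s \<Omega> \<xi> p \<bullet> (velocity s0 s1 \<xi> \<gamma> p - pd_t \<Omega> \<xi> p))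
        \<longrightarrow>
        (\<forall>p\<in>\<Omega>. \<not> (\<exists>V. open V \<and> p \<in> V \<and> (\<forall>q\<in>V \<inter> \<Omega>. \<gamma> q = 0))
                 \<longrightarrow> BR_motion_at T s0 s1 \<xi> \<gamma> a p) \<and>
        BR_conservation T s0 s1 \<gamma> a \<and>
        BR_unit_speed T s0 s1 \<xi> \<and>
        (\<forall>t\<in>{0..<T}.
           if closed_at s0 s1 \<xi> t
           then endpoint_flux T \<gamma> a s0 t = endpoint_flux T \<gamma> a s1 t
           else \<forall>\<sigma>\<in>{s0, s1}. \<bar>\<sigma> t\<bar> \<noteq> \<infinity> \<longrightarrow> endpoint_flux T \<gamma> a \<sigma> t = 0))"
proof ((rule conjI; intro allI; rule impI), goal_cases)
  case (1 a)
  then interpret sheet T s0 s1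
    by unfold_locales (use assms in auto)
  show ?case
    using 1 unfolding assms(3) by (intro classical_solution_is_weak[of \<xi> \<gamma> a]) auto
next
  case prems: (2 \<gamma>0 \<xi>0 a)
  have ends: "endpoint_C1b T \<sigma>" if "\<sigma> \<in> {s0, s1}" "\<exists>t\<in>{0..<T}. \<bar>\<sigma> t\<bar> \<noteq> \<infinity>" for \<sigma>
  proof -
    have "\<forall>\<sigma>\<in>{s0, s1}. (\<exists>t\<in>{0..<T}. \<bar>\<sigma> t\<bar> \<noteq> \<infinity>) \<longrightarrow> endpoint_C1b T \<sigma>"
      using prems by (elim conjE)
    from this[THEN bspec, OF that(1), THEN mp, OF that(2)] show ?thesis .
  qed
  \<comment> \<open>an endpoint is either infinite at all times, hence constant because of the order of the ends, or \<open>C\<^sup>1\<close> and finite\<close>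
  have diff: "endpoint_differentiable T \<sigma>"
    if \<sigma>: "\<sigma> \<in> {s0, s1}" and c: "\<bar>c\<bar> = \<infinity>" "\<And>t. t \<in> {0..<T} \<Longrightarrow> \<bar>\<sigma> t\<bar> = \<infinity> \<Longrightarrow> \<sigma> t = c" for \<sigma> c
  proof (cases "\<exists>t\<in>{0..<T}. \<bar>\<sigma> t\<bar> \<noteq> \<infinity>")
    case True
    show ?thesis by (rule endpoint_C1b_differentiable[OF ends[OF \<sigma> True]])
  next
    case False
    have "\<sigma> t = c" if t: "t \<in> {0..<T}" for t
    proof (rule c(2)[OF t])
      show "\<bar>\<sigma> t\<bar> = \<infinity>" using False t by metis
    qed
    then show ?thesis using c(1) by (rule endpoint_infinite_differentiable)
  qed
  have "s0 t = - \<infinity>" if "t \<in> {0..<T}" "\<bar>s0 t\<bar> = \<infinity>" for t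
    using assms(2)[OF that(1)] that(2) by (cases "s0 t") auto
  then have s0_diff: "endpoint_differentiable T s0" by (intro diff[of s0 "- \<infinity>"]) auto
  have "s1 t = \<infinity>" if "t \<in> {0..<T}" "\<bar>s1 t\<bar> = \<infinity>" for t
    using assms(2)[OF that(1)] that(2) by (cases "s1 t") auto
  then have s1_diff: "endpoint_differentiable T s1" by (intro diff[of s1 \<infinity>]) auto
  interpret w: weak_sheet T s0 s1 \<gamma> \<xi> \<gamma>0 \<xi>0
  proof
    show "endpoint_C1b T \<sigma>" if "\<sigma> \<in> {s0, s1}" "\<exists>t\<in>{0..<T}. \<bar>\<sigma> t\<bar> \<noteq> \<infinity>" for \<sigma> by (rule ends[OF that])
  qed (use assms(1,2) s0_diff s1_diff prems[unfolded assms(3)] in auto)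
  have a: "a = w.a"
    using prems unfolding assms(3) by (simp add: fun_eq_iff w.a_def w.W_def)
  show ?case
    unfolding assms(3) a
    using w.motion_off_vacuum w.conservation w.endpoint_flux_condition w.unit_speed
    by (intro conjI ballI impI) (auto simp: BR_unit_speed_def Let_def)
qed

end
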